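(* There exist constants $C>0$ and $N\in\mathbb{N}$ such that, for all $n\ge N$, $$d_{W,\mathcal{S}}\big(\vartheta_n,\mathfrak{A}[\theta_{\mathcal S}]\big)\le \frac{C}{\log n}\,(\log\log n)^{\mathrm e-\frac32},$$ where $\mathrm e$ is Euler's number (the base of the natural logarithm), $\vartheta_n$ is the law of the normalized logarithms of the distinct prime divisors of a harmonic random sample on $\{1,\dots,n\}$ listed in decreasing order, and $\mathfrak{A}[\theta_{\mathcal S}]$ is the uniformly attenuated Poisson-Dirichlet law (all objects as defined in the context).
   Context: Harmonic sample: $H_n$ is a random variable with $\mathbb{P}[H_n=k]=\frac{1}{\mathfrak{l}_n k}$ for $k=1,\dots,n$, where $\mathfrak{l}_n=\sum_{j=1}^n \frac1j$. Prime divisors: for a natural number $h$, $\mathfrak{P}(h)$ is the set of prime numbers dividing $h$ (distinct primes, without multiplicity). Let $\boldsymbol{\Xi}^n=(\Xi^n_1,\Xi^n_2,\dots)$ be the sequence whose coordinates list the elements of $\mathfrak{P}(H_n)$ in decreasing order, with the convention $\Xi^n_k=1$ when $H_n$ has fewer than $k$ distinct prime divisors. Sequence space: $\mathcal{S}=\{(x_i)_{i\ge1}\in[0,\infty)^{\mathbb{N}} : x_i\ge x_{i+1} \text{ for all } i,\ \sum_{i\ge1}x_i\le1\}$, with the metric $d_{\mathcal S}(\mathbf{x},\mathbf{y})=\sum_{k\ge1}|x_k-y_k|$. The law $\vartheta_n$ is the distribution on $\mathcal S$ of the sequence $\big(\frac{\log \Xi^n_k}{\log n}\big)_{k\ge1}$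 (for $n\ge 2$). Wasserstein distance: for probability measures $\mu,\nu$ on $\mathcal S$, $$d_{W,\mathcal S}(\mu,\nu)=\inf_{\pi\in\Pi(\mu,\nu)}\int_{\mathcal S\times\mathcal S} d_{\mathcal S}(\mathbf x,\mathbf y)\,\pi(d\mathbf x,d\mathbf y),$$ where $\Pi(\mu,\nu)$ is the set of probability measures on $\mathcal S\times\mathcal S$ with marginals $\mu$ and $\nu$. Poisson-Dirichlet law: let $(U_k)_{k\ge1}$ be i.i.d. uniform on $(0,1)$, and let $L_k=U_k\prod_{i<k}(1-U_i)$ (empty product equal to $1$). The decreasing rearrangement $(V_k)_{k\ge1}$ of $(L_k)_{k\ge1}$ has the Poisson-Dirichlet distribution with parameter one; $\theta_{\mathcal S}$ denotes its law on $\mathcal S$. Uniform attenuation: for a probability measure $\gamma$ on $\mathcal S$, $\mathfrak{A}[\gamma]$ is the law of $U\mathbf X=(UX_1,UX_2,\dots)$, where $\mathbf X=(X_1,X_2,\dots)$ has law $\gamma$ and $U$ is uniform on $(0,1)$ and independent of $\mathbf X$. *)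

theory Defs
  imports
    "HOL-Probability.Probability"
    "HOL-Computational_Algebra.Primes"
begin

text \<open>Sequences indexed by \<open>{1, 2, \<dots>}\<close> are represented as functions on \<^typ>\<open>nat\<close> with the
  index shifted by one: the \<open>k\<close>-th term is the value at \<open>k - 1\<close>.\<close>

definition seq_space :: "(nat \<Rightarrow> real) set" where
  "seq_space = {x. (\<forall>i. 0 \<le> x i) \<and> (\<forall>i. x (Suc i) \<le> x i) \<and>
                   x summable_on UNIV \<and> (\<Sum>\<^sub>\<infinity>i. x i) \<le> 1}"

definition seq_dist :: "(nat \<Rightarrow> real) \<Rightarrow> (nat \<Rightarrow> real) \<Rightarrow> real" where
  "seq_dist x y = (\<Sum>\<^sub>\<infinity>k. \<bar>x k - y k\<bar>)"

lemma seq_diff_summable: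
  assumes "x \<in> seq_space" "y \<in> seq_space"
  shows "(\<lambda>k. \<bar>x k - y k\<bar>) summable_on UNIV"
proof (rule summable_on_comparison_test)
  show "(\<lambda>k. x k + y k) summable_on UNIV"
    using assms by (auto simp: seq_space_def intro: summable_on_add)
  fix k :: nat
  have "0 \<le> x k" "0 \<le> y k"
    using assms by (auto simp: seq_space_def)
  then show "\<bar>x k - y k\<bar> \<le> x k + y k" "0 \<le> \<bar>x k - y k\<bar>"
    by auto
qed

lemma Metric_space_seq: "Metric_space seq_space seq_dist"
proof
  fix x y :: "nat \<Rightarrow> real"
  show "0 \<le> seq_dist x y"
    by (auto simp: seq_dist_def intro: infsum_nonneg)
  show "seq_dist x y = seq_dist y x"
    by (simp add: seq_dist_def abs_minus_commute)
next
  fix x y assume xy: "x \<in> seq_space" "y \<in> seq_space"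
  show "seq_dist x y = 0 \<longleftrightarrow> x = y"
  proof
    assume "seq_dist x y = 0"
    then have "\<bar>x k - y k\<bar> = 0" for k
      using seq_diff_summable[OF xy] unfolding seq_dist_def
      by (intro nonneg_infsum_le_0D[where A = UNIV and f = "\<lambda>k. \<bar>x k - y k\<bar>"]) auto
    then show "x = y" by auto
  qed (simp add: seq_dist_def)
next
  fix x y z assume xyz: "x \<in> seq_space" "y \<in> seq_space" "z \<in> seq_space"
  note s = seq_diff_summable[OF xyz(1,2)] seq_diff_summable[OF xyz(2,3)]
  have "seq_dist x z \<le> (\<Sum>\<^sub>\<infinity>k. \<bar>x k - y k\<bar> + \<bar>y k - z k\<bar>)"
    unfolding seq_dist_def
    by (intro infsum_mono seq_diff_summable xyz summable_on_add s) auto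
  also have "\<dots> = seq_dist x y + seq_dist y z"
    unfolding seq_dist_def by (intro infsum_add s)
  finally show "seq_dist x z \<le> seq_dist x y + seq_dist y z" .
qed

text \<open>The Borel \<open>\<sigma>\<close>-algebra of the metric space above.\<close>

definition seq_borel :: "(nat \<Rightarrow> real) measure" where
  "seq_borel = sigma seq_space {A. openin (Metric_space.mtopology seq_space seq_dist) A}"

definition couplings ::
    "(nat \<Rightarrow> real) measure \<Rightarrow> (nat \<Rightarrow> real) measure \<Rightarrow> ((nat \<Rightarrow> real) \<times> (nat \<Rightarrow> real)) measure set" where
  "couplings \<mu> \<nu> = {\<pi>. prob_space \<pi> \<and> sets \<pi> = sets (seq_borel \<Otimes>\<^sub>M seq_borel) \<and>
                        distr \<pi> seq_borel fst = \<mu> \<and> distr \<pi> seq_borel snd = \<nu>}"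

text \<open>Extended-valued, so that the infimum over an empty set of couplings is \<open>\<infinity>\<close>.\<close>

definition wasserstein :: "(nat \<Rightarrow> real) measure \<Rightarrow> (nat \<Rightarrow> real) measure \<Rightarrow> ennreal" where
  "wasserstein \<mu> \<nu> = (INF \<pi>\<in>couplings \<mu> \<nu>. \<integral>\<^sup>+z. ennreal (seq_dist (fst z) (snd z)) \<partial>\<pi>)"

definition harmonic_sample :: "nat \<Rightarrow> nat measure" where
  "harmonic_sample n = point_measure {1..n} (\<lambda>k. ennreal (1 / (harm n * real k)))"

definition prime_div_seq :: "nat \<Rightarrow> nat \<Rightarrow> nat" where
  "prime_div_seq h k =
     (let ps = rev (sorted_list_of_set {p. prime p \<and> p dvd h})
      in if k < length ps then ps ! k else 1)"

definition prime_div_law :: "nat \<Rightarrow> (nat \<Rightarrow> real) measure" where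
  "prime_div_law n =
     distr (harmonic_sample n) seq_borel (\<lambda>h k. ln (real (prime_div_seq h k)) / ln (real n))"

text \<open>Lebesgue measure on the sample space \<open>(0,1)\<close>, not on all of \<^typ>\<open>real\<close>: hence every sample
  of an i.i.d. sequence, and not just almost every one, has a stick-breaking sequence that is
  positive and summable, and therefore has a decreasing rearrangement.\<close>

definition unif01 :: "real measure" where
  "unif01 = restrict_space lborel {0<..<1}"

definition stick_breaking :: "(nat \<Rightarrow> real) \<Rightarrow> nat \<Rightarrow> real" where
  "stick_breaking u k = u k * (\<Prod>i<k. 1 - u i)"

definition decr_rearrangement :: "(nat \<Rightarrow> real) \<Rightarrow> nat \<Rightarrow> real" where
  "decr_rearrangement x = (THE y. decseq y \<and> (\<exists>\<sigma>. bij \<sigma> \<and> y = x \<circ> \<sigma>))"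

definition poisson_dirichlet :: "(nat \<Rightarrow> real) measure" where
  "poisson_dirichlet =
     distr (\<Pi>\<^sub>M i\<in>(UNIV :: nat set). unif01) seq_borel (\<lambda>u. decr_rearrangement (stick_breaking u))"

definition attenuation :: "(nat \<Rightarrow> real) measure \<Rightarrow> (nat \<Rightarrow> real) measure" where
  "attenuation \<gamma> = distr (unif01 \<Otimes>\<^sub>M \<gamma>) seq_borel (\<lambda>(u, x) k. u * x k)"

end

(* A harmonic sample on {1..n} can be generated recursively: draw a bound k <= n and a prime power
   d <= k, and multiply d by a harmonic sample on {1..k div d}. The attenuated Poisson-Dirichlet law
   Z is likewise the law of {Y B} together with Y (1 - B) Z, where Y equals 1 or is uniform on (0,1),
   with probability 1/2 each, and B has density 2 (1 - b). By Mertens' first theorem the distribution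
   functions of (ln k, ln d) and (Y ln n, B ln k) differ by O(1 / ln n) and O(1 / ln k), so the quantile
   couplings cost O(1) per step on the logarithmic scale. As ln (k div d) is on average at most 3/4 ln n
   up to a constant, the expected number of steps is O(ln ln n), and the total cost is O(ln ln n / ln n).
   This suffices because e - 3/2 >= 1. Replacing prime powers by distinct primes costs O(1 / ln n). *)

theory Submission
  imports Defs "HOL-Number_Theory.Prime_Powers"
begin

section \<open>Mertens' first theorem\<close>

text \<open>The primes of a harmonic sample are dependent and of random number, so they cannot be
  matched one by one with the points of the limit. A size-biased sample, with weights
  \<open>ln h / h\<close>, has an exact recursion: \<open>ln h\<close> is the sum of the von
  Mangoldt function over the divisors \<open>d\<close> of \<open>h\<close>, and given
  \<open>d\<close> the cofactor is harmonic on a shorter range. The random bound \<open>k\<close>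
  removes the bias: its law makes the size-biased laws with \<open>k >= h\<close> add up to
  \<open>ln h / h\<close> times \<open>1 / ln h\<close>. In the limit it becomes Y, whose atom at 1
  stems from \<open>k = n\<close>. Both recursions being exact, only the discretisation errors of
  each step matter, and they add up because inserting a point into a decreasing sequence is
  nonexpansive. One thing does not fit: a prime power contributes only \<open>ln p\<close>, or
  nothing if \<open>p\<close> occurs already. This defect depends on the number and not on its prime
  sequence alone, so couplings carry the number itself, and the defect is charged to the logarithm
  of the number over its radical. That excess telescopes, since divisor times cofactor is again the
  harmonic sample, and its mean is bounded.\<close>

lemma sum_dvd_swap:
  fixes f :: "nat \<Rightarrow> nat \<Rightarrow> 'a :: comm_monoid_add"
  shows "(\<Sum>m\<in>{1..n}. \<Sum>d | d dvd m. f d (m div d)) = (\<Sum>d\<in>{1..n}. \<Sum>j\<in>{1..n div d}. f d j)"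
proof -
  have fin: "finite {d. d dvd m}" if "m \<in> {1..n}" for m :: nat
    using that by (intro finite_divisors_nat) auto
  have "(\<Sum>m\<in>{1..n}. \<Sum>d | d dvd m. f d (m div d)) = (\<Sum>(m, d)\<in>(SIGMA m:{1..n}. {d. d dvd m}). f d (m div d))"
    by (subst sum.Sigma) (use fin in auto)
  also have "\<dots> = (\<Sum>(d, j)\<in>(SIGMA d:{1..n}. {1..n div d}). f d j)"
  proof (rule sum.reindex_bij_witness[where i = "\<lambda>(d, j). (d * j, d)" and j = "\<lambda>(m, d). (d, m div d)"])
    fix a assume "a \<in> (SIGMA m:{1..n}. {d. d dvd m})"
    then obtain m d where a: "a = (m, d)" "1 \<le> m" "m \<le> n" "d dvd m"
      by auto
    then have "1 \<le> d" "d \<le> m"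
      using dvd_imp_le[of d m] dvd_pos_nat[of m d] by auto
    moreover have "1 \<le> m div d" "m div d \<le> n div d"
      using a \<open>d \<le> m\<close> \<open>1 \<le> d\<close> div_le_mono[of m n d] by (auto simp: div_greater_zero_iff Suc_le_eq)
    ultimately show "(case a of (m, d) \<Rightarrow> (d, m div d)) \<in> (SIGMA d:{1..n}. {1..n div d})"
      using a by auto
    show "(case (case a of (m, d) \<Rightarrow> (d, m div d)) of (d, j) \<Rightarrow> (d * j, d)) = a"
      using a by auto
  next
    fix b assume "b \<in> (SIGMA d:{1..n}. {1..n div d})"
    then obtain d j where b: "b = (d, j)" "1 \<le> d" "d \<le> n" "1 \<le> j" "j \<le> n div d"
      by auto
    have "d * j \<le> n"
      using b less_eq_div_iff_mult_less_eq[of d j n] by (simp add: mult.commute)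
    then show "(case b of (d, j) \<Rightarrow> (d * j, d)) \<in> (SIGMA m:{1..n}. {d. d dvd m})"
      using b by auto
    show "(case (case b of (d, j) \<Rightarrow> (d * j, d)) of (m, d) \<Rightarrow> (d, m div d)) = b"
      using b by auto
  qed auto
  also have "\<dots> = (\<Sum>d\<in>{1..n}. \<Sum>j\<in>{1..n div d}. f d j)"
    by (subst sum.Sigma) auto
  finally show ?thesis .
qed

text \<open>Legendre's formula: \<open>ln m\<close> is the divisor sum of the von Mangoldt function,
  and \<open>n div d\<close> counts the multiples of \<open>d\<close> up to
  \<open>n\<close>.\<close>

lemma ln_fact_conv_mangoldt:
  "ln (fact n :: real) = (\<Sum>d=1..n. mangoldt d * real (n div d))"
proof -
  have "ln (fact n :: real) = (\<Sum>m=1..n. ln (real m))"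
    by (induction n) (simp_all add: ln_mult)
  also have "\<dots> = (\<Sum>m=1..n. \<Sum>d | d dvd m. mangoldt d)"
    by (intro sum.cong) (auto simp: mangoldt_sum)
  also have "\<dots> = (\<Sum>d=1..n. mangoldt d * real (n div d))"
    using sum_dvd_swap[of "\<lambda>d _. mangoldt d :: real" n] by (simp add: mult.commute)
  finally show ?thesis .
qed

text \<open>Chebyshev's argument by halving: the central binomial coefficient
  \<open>2 * m choose m\<close> is at most \<open>2 ^ (2 * m)\<close>, and its logarithm dominates
  the sum over \<open>m < d <= 2 * m\<close>.\<close>

lemma chebyshev_psi_upper: "(\<Sum>d=1..n. mangoldt d :: real) \<le> 4 * real n"
proof (induction n rule: less_induct)
  case (less n)
  show ?case
  proof (cases "n \<le> 1")
    case True
    then have "n = 0 \<or> n = 1" by auto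
    then show ?thesis by auto
  next
    case False
    define m where "m = n div 2"
    have m: "m < n" "n = 2 * m \<or> n = 2 * m + 1" "m > 0"
      using False unfolding m_def by auto
    have "(\<Sum>d=1..2*m. mangoldt d * real (2 * m div d)) - 2 * (\<Sum>d=1..m. mangoldt d * real (m div d)) =
          (\<Sum>d=1..2*m. mangoldt d * (real (2 * m div d) - 2 * real (m div d)))"
    proof -
      have "(\<Sum>d=1..m. mangoldt d * real (m div d)) = (\<Sum>d=1..2*m. mangoldt d * real (m div d))"
        by (rule sum.mono_neutral_left) auto
      then show ?thesis
        by (simp add: sum_distrib_left sum_subtractf algebra_simps)
    qed
    \<comment> \<open>The coefficient of \<open>mangoldt d\<close> is never negative, and for
      \<open>m < d <= 2 * m\<close> it is at least 1, because then \<open>m div d = 0\<close> while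
      \<open>2 * m div d >= 1\<close>.\<close>
    also have "\<dots> \<ge> (\<Sum>d=1..2*m. if d > m then mangoldt d else 0)"
    proof (rule sum_mono)
      fix d assume d: "d \<in> {1..2*m}"
      have "2 * (m div d) \<le> 2 * m div d"
        using div_times_less_eq_dividend[of m d] d
        by (subst less_eq_div_iff_mult_less_eq) auto
      moreover have "2 * m div d \<ge> 1" if "d > m"
        using d by (simp add: Suc_le_eq div_greater_zero_iff)
      ultimately have "(if d > m then 1 else 0) \<le> real (2 * m div d) - 2 * real (m div d)"
        by (auto simp flip: of_nat_mult)
      from mult_left_mono[OF this mangoldt_nonneg[of d]]
      show "(if d > m then mangoldt d else 0) \<le> mangoldt d * (real (2 * m div d) - 2 * real (m div d))"
        by (auto split: if_splits)
    qed
    also have "(\<Sum>d=1..2*m. if d > m then mangoldt d else (0::real)) =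
        (\<Sum>d=1..2*m. mangoldt d) - (\<Sum>d=1..m. mangoldt d)"
    proof -
      have "(\<Sum>d=1..2*m. if d > m then mangoldt d else (0::real)) = (\<Sum>d\<in>{1..2*m} - {1..m}. mangoldt d)"
        by (rule sum.mono_neutral_cong_right) auto
      then show ?thesis
        by (simp add: sum_diff)
    qed
    finally have "(\<Sum>d=1..2*m. mangoldt d) - (\<Sum>d=1..m. mangoldt d) \<le> ln (fact (2*m)) - 2 * ln (fact m :: real)"
      by (simp add: ln_fact_conv_mangoldt)
    also have "\<dots> = ln (real (2 * m choose m))"
      by (simp add: binomial_fact ln_div ln_mult)
    also have "\<dots> \<le> ln (2 ^ (2 * m))"
    proof -
      have "2 * m choose m \<le> 2 ^ (2 * m)"
        by (rule binomial_le_pow2)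
      then have "real (2 * m choose m) \<le> 2 ^ (2 * m)"
        by (metis of_nat_le_iff of_nat_numeral of_nat_power)
      then show ?thesis
        by (subst ln_le_cancel_iff) auto
    qed
    also have "\<dots> = 2 * real m * ln 2"
      by (simp add: ln_realpow)
    also have "\<dots> \<le> 2 * real m * (5/6)"
    proof -
      have "ln (2::real) \<le> 5/6" using ln_2_less_1 ln2_le_25_over_36 by simp
      then show ?thesis by (intro mult_left_mono) auto
    qed
    finally have 1: "(\<Sum>d=1..2*m. mangoldt d :: real) \<le> (\<Sum>d=1..m. mangoldt d) + 2 * real m * (5/6)"
      by simp
    have 2: "(\<Sum>d=1..m. mangoldt d :: real) \<le> 4 * real m"
      using less m by auto
    have 3: "(\<Sum>d=1..n. mangoldt d :: real) \<le> (\<Sum>d=1..2*m. mangoldt d) + ln (real n)"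
    proof (cases "n = 2 * m")
      case True
      then show ?thesis using m by simp
    next
      case False
      then have "n = Suc (2 * m)" using m by simp
      then show ?thesis
        using mangoldt_le[of n] by simp
    qed
    have 4: "ln (real n) \<le> 2 * real m"
      using ln_le_minus_one[of "real n"] m by auto
    \<comment> \<open>The contributions are \<open>4 * m\<close> by induction,
      \<open>5/3 * m\<close> from the binomial coefficient and \<open>2 * m\<close> for a possible
      odd last term; together they stay below \<open>8 * m <= 4 * n\<close>.\<close>
    show ?thesis
      using 1 2 3 4 m by auto
  qed
qed

text \<open>Stirling's formula up to an error of order \<open>n\<close>; for the lower bound,
  \<open>n ^ n / fact n\<close> is a single term of the exponential series at \<open>n\<close>,
  hence at most \<open>exp n\<close>.\<close>

lemma ln_fact_bounds:
  assumes "n > 0"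
  shows "ln (fact n :: real) \<le> real n * ln (real n)" "real n * ln (real n) - real n \<le> ln (fact n)"
proof -
  have "fact n \<le> real n ^ n"
    using fact_le_power[of n, where 'a = real] by simp
  then have "ln (fact n :: real) \<le> ln (real n ^ n)"
    using assms by (subst ln_le_cancel_iff) auto
  then show "ln (fact n :: real) \<le> real n * ln (real n)"
    using assms by (simp add: ln_realpow)
  have "sum (\<lambda>k. real n ^ k /\<^sub>R fact k) {n} \<le> exp (real n)"
    unfolding exp_def by (intro sum_le_suminf summable_exp_generic) auto
  then have "real n ^ n / fact n \<le> exp (real n)"
    by (simp add: divide_inverse mult.commute)
  then have "ln (real n ^ n / fact n) \<le> real n"
    using assms by (subst (asm) ln_le_cancel_iff[symmetric]) auto
  then show "real n * ln (real n) - real n \<le> ln (fact n)"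
    using assms by (simp add: ln_div ln_realpow)
qed

lemma divide_le_div_plus_1: "real n / real d \<le> real (n div d) + 1"
proof -
  have "real n / real d < real_of_int \<lfloor>real n / real d\<rfloor> + 1"
    by linarith
  then show ?thesis by (simp add: floor_divide_of_nat_eq)
qed

definition mertens_sum :: "nat \<Rightarrow> real" where
  "mertens_sum n = (\<Sum>d=1..n. mangoldt d / real d)"

text \<open>Removing the integer parts in Legendre's formula changes the sum by at most Chebyshev's
  \<open>4 * n\<close>; comparison with \<open>ln (fact n)\<close> and division by \<open>n\<close>
  leave a constant.\<close>

lemma mertens_first:
  assumes "n > 0"
  shows "\<bar>mertens_sum n - ln (real n)\<bar> \<le> 4"
proof -
  have "real n * mertens_sum n = (\<Sum>d=1..n. mangoldt d * (real n / real d))"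
    by (simp add: mertens_sum_def sum_distrib_left mult_ac)
  moreover have "(\<Sum>d=1..n. mangoldt d * (real n / real d)) \<ge> (\<Sum>d=1..n. mangoldt d * real (n div d))"
    by (intro sum_mono mult_left_mono of_nat_div_le_of_nat mangoldt_nonneg)
  moreover have "(\<Sum>d=1..n. mangoldt d * (real n / real d)) \<le> (\<Sum>d=1..n. mangoldt d * real (n div d) + mangoldt d)"
  proof (intro sum_mono)
    fix d
    have "mangoldt d * (real n / real d) \<le> mangoldt d * (real (n div d) + 1)"
      using divide_le_div_plus_1[of n d] by (intro mult_left_mono mangoldt_nonneg) auto
    then show "mangoldt d * (real n / real d) \<le> mangoldt d * real (n div d) + mangoldt d"
      by (simp add: algebra_simps)
  qed
  ultimately have "real n * mertens_sum n \<ge> ln (fact n)" "real n * mertens_sum n \<le> ln (fact n) + 4 * real n"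
    using chebyshev_psi_upper[of n] by (auto simp: ln_fact_conv_mangoldt sum.distrib)
  then have "real n * (mertens_sum n - ln n) \<ge> real n * (-4)" "real n * (mertens_sum n - ln n) \<le> real n * 4"
    using ln_fact_bounds[OF assms] by (auto simp: algebra_simps)
  then show ?thesis
    using assms by (simp only: mult_le_cancel_left_pos of_nat_0_less_iff)
qed

section \<open>The laws of the bound and of the divisor\<close>

lemma ln_Suc_diff_bounds:
  assumes "m > 0"
  shows "1 / real (Suc m) \<le> ln (real (Suc m)) - ln (real m)" "ln (real (Suc m)) - ln (real m) \<le> 1 / real m"
proof -
  have "ln (real m / real (Suc m)) \<le> real m / real (Suc m) - 1"
    using assms by (intro ln_le_minus_one) auto
  then show "1 / real (Suc m) \<le> ln (real (Suc m)) - ln (real m)"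
    using assms by (simp add: ln_div field_simps)
  have "ln (real (Suc m) / real m) \<le> real (Suc m) / real m - 1"
    using assms by (intro ln_le_minus_one) auto
  then show "ln (real (Suc m)) - ln (real m) \<le> 1 / real m"
    using assms by (simp add: ln_div field_simps)
qed

lemma harm_bounds_ln:
  assumes "n > 0"
  shows "ln (real n) \<le> harm n" "harm n \<le> ln (real n) + (1::real)"
proof -
  have "ln (real n) \<le> ln (real n + 1)"
    using assms by simp
  also have "\<dots> \<le> harm n" by (rule ln_le_harm)
  finally show "ln (real n) \<le> harm n" .
  show "harm n \<le> ln (real n) + (1::real)"
    using assms
  proof (induction n rule: nat_induct_non_zero)
    case 1
    then show ?case by (simp add: harm_def)
  next
    case (Suc n)
    then show ?case
      using ln_Suc_diff_bounds(1)[of n] by (simp add: harm_Suc inverse_eq_divide)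
  qed
qed

lemma ln_floor_bounds:
  assumes "y \<ge> 1"
  shows "nat \<lfloor>y\<rfloor> \<ge> 1" "ln (real (nat \<lfloor>y\<rfloor>)) \<le> ln y" "ln y \<le> ln (real (nat \<lfloor>y\<rfloor>)) + 1"
proof -
  show 1: "nat \<lfloor>y\<rfloor> \<ge> 1" using assms by linarith
  have 2: "real (nat \<lfloor>y\<rfloor>) \<le> y" using assms by linarith
  then show "ln (real (nat \<lfloor>y\<rfloor>)) \<le> ln y"
    using 1 by (subst ln_le_cancel_iff) auto
  have "y \<le> real (Suc (nat \<lfloor>y\<rfloor>))" using assms by linarith
  then have "ln y \<le> ln (real (Suc (nat \<lfloor>y\<rfloor>)))"
    using assms by (subst ln_le_cancel_iff) auto
  also have "\<dots> \<le> ln (real (nat \<lfloor>y\<rfloor>)) + 1 / real (nat \<lfloor>y\<rfloor>)"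
    using ln_Suc_diff_bounds(2)[of "nat \<lfloor>y\<rfloor>"] 1 by linarith
  also have "\<dots> \<le> ln (real (nat \<lfloor>y\<rfloor>)) + 1"
    using divide_le_eq_1_pos[of "real (nat \<lfloor>y\<rfloor>)" 1] 1 by linarith
  finally show "ln y \<le> ln (real (nat \<lfloor>y\<rfloor>)) + 1" .
qed

lemma ln_div_bounds:
  assumes "1 \<le> m" "m \<le> k"
  shows "ln (real (k div m)) \<le> ln (real k) - ln (real m)"
    "ln (real k) - ln (real m) \<le> ln (real (k div m)) + 1"
proof -
  have "nat \<lfloor>real k / real m\<rfloor> = k div m"
    by (simp add: floor_divide_of_nat_eq)
  moreover have "real k / real m \<ge> 1"
    using assms by simp
  ultimately show "ln (real (k div m)) \<le> ln (real k) - ln (real m)"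
    "ln (real k) - ln (real m) \<le> ln (real (k div m)) + 1"
    using ln_floor_bounds[of "real k / real m"] assms by (auto simp: ln_div)
qed

text \<open>Normalising constant of the size-biased sample on \<open>{1..k}\<close>, whose weights
  are \<open>ln m / m\<close>; it grows like \<open>(ln k)^2 / 2\<close>.\<close>

definition log_harm :: "nat \<Rightarrow> real" where
  "log_harm k = (\<Sum>m=1..k. ln (real m) / real m)"

lemma log_harm_Suc: "log_harm (Suc k) = log_harm k + ln (real (Suc k)) / real (Suc k)"
  by (simp add: log_harm_def)

lemma log_harm_nonneg: "0 \<le> log_harm k"
  unfolding log_harm_def by (intro sum_nonneg) auto

text \<open>A crude bound valid for every \<open>k\<close>, meant for denominators:
  \<open>log_harm_approx\<close> says nothing for small \<open>k\<close>, where its error exceeds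
  the main term.\<close>

lemma log_harm_ge: "(ln (real k))\<^sup>2 / 4 \<le> log_harm k"
proof (induction k)
  case (Suc m)
  show ?case
  proof (cases "m = 0")
    case True
    then show ?thesis by (simp add: log_harm_def)
  next
    case False
    define a b where "a = ln (real m)" and "b = ln (real (Suc m))"
    have ab: "0 \<le> a" "a \<le> b" using False by (auto simp: a_def b_def)
    have "b\<^sup>2 - a\<^sup>2 = (b - a) * (b + a)"
      by (simp add: power2_eq_square algebra_simps)
    also have "\<dots> \<le> (1 / real m) * (b + b)"
      using ab ln_Suc_diff_bounds(2)[of m] False
      by (intro mult_mono) (auto simp: a_def b_def)
    \<comment> \<open>Replacing \<open>1 / m\<close> by \<open>2 / (m + 1)\<close> costs the factor
      2 that turns the true \<open>1/2\<close> into \<open>1/4\<close>.\<close>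
    also have "\<dots> \<le> (2 / real (Suc m)) * (b + b)"
      using ab False by (intro mult_right_mono) (auto simp: field_simps)
    finally have "b\<^sup>2 / 4 \<le> a\<^sup>2 / 4 + b / real (Suc m)"
      by (simp add: algebra_simps)
    then show ?thesis
      using Suc.IH by (simp add: a_def b_def log_harm_Suc)
  qed
qed (simp add: log_harm_def)

lemma log_harm_pos:
  assumes "k \<ge> 2"
  shows "log_harm k > 0"
proof -
  have "0 < ln (real k)" using assms by simp
  then have "0 < (ln (real k))\<^sup>2 / 4" by simp
  with log_harm_ge[of k] show ?thesis by linarith
qed

text \<open>With \<open>m = d * j\<close>, the weight \<open>ln m / m\<close> splits into pieces
  \<open>mangoldt d / d\<close> times \<open>1 / j\<close>. Divided by \<open>log_harm k\<close>,
  the terms on the right thus form a probability law for \<open>d\<close>.\<close>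

lemma log_harm_conv_mangoldt:
  "log_harm k = (\<Sum>d=1..k. mangoldt d / real d * harm (k div d))"
proof -
  have "log_harm k = (\<Sum>m=1..k. \<Sum>d | d dvd m. mangoldt d / real d * (1 / real (m div d)))"
    unfolding log_harm_def
  proof (intro sum.cong refl)
    fix m assume m: "m \<in> {1..k}"
    have "ln (real m) / real m = (\<Sum>d | d dvd m. mangoldt d / real m)"
      using m by (simp add: mangoldt_sum flip: sum_divide_distrib)
    also have "\<dots> = (\<Sum>d | d dvd m. mangoldt d / real d * (1 / real (m div d)))"
      using m by (intro sum.cong) (auto simp: real_of_nat_div)
    finally show "ln (real m) / real m = \<dots>" .
  qed
  also have "\<dots> = (\<Sum>d=1..k. mangoldt d / real d * harm (k div d))"
    by (subst sum_dvd_swap) (simp add: harm_def sum_distrib_left inverse_eq_divide)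
  finally show ?thesis .
qed

text \<open>Mertens' theorem concerns \<open>mangoldt d / d\<close> without the factor
  \<open>harm (k div d)\<close>. Expanding this factor and exchanging the sums over pairs with
  \<open>d * m <= k\<close> isolates sums to which it applies.\<close>

lemma mangoldt_harm_swap:
  assumes "x \<le> k"
  shows "(\<Sum>d=1..x. mangoldt d / real d * harm (k div d)) = (\<Sum>m=1..k. 1 / real m * mertens_sum (min x (k div m)))"
proof -
  have *: "{1..k div d} = {m \<in> {1..k}. d * m \<le> k}" if "d \<ge> 1" for d
  proof -
    have "m \<le> k" if "d * m \<le> k" for m
      using mult_le_mono1[of 1 d m] that \<open>d \<ge> 1\<close> by linarith
    then show ?thesis
      using that by (auto simp: less_eq_div_iff_mult_less_eq mult.commute)
  qed
  have **: "{1..min x (k div m)} = {d \<in> {1..x}. d * m \<le> k}" if "m \<ge> 1" for m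
    using that by (auto simp: less_eq_div_iff_mult_less_eq)
  have "(\<Sum>d=1..x. mangoldt d / real d * harm (k div d)) =
        (\<Sum>d=1..x. \<Sum>m=1..k. if d * m \<le> k then mangoldt d / real d * (1 / real m) else 0)"
  proof (intro sum.cong refl)
    fix d assume "d \<in> {1..x}"
    then have "d \<ge> 1" by simp
    show "mangoldt d / real d * harm (k div d) = (\<Sum>m=1..k. if d * m \<le> k then mangoldt d / real d * (1 / real m) else 0)"
      unfolding harm_def *[OF \<open>d \<ge> 1\<close>] sum.inter_filter[OF finite_atLeastAtMost]
      by (auto simp: sum_distrib_left inverse_eq_divide intro!: sum.cong)
  qed
  also have "\<dots> = (\<Sum>m=1..k. \<Sum>d=1..x. if d * m \<le> k then mangoldt d / real d * (1 / real m) else 0)"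
    by (rule sum.swap)
  also have "\<dots> = (\<Sum>m=1..k. 1 / real m * mertens_sum (min x (k div m)))"
  proof (intro sum.cong refl)
    fix m assume "m \<in> {1..k}"
    then have "m \<ge> 1" by simp
    show "(\<Sum>d=1..x. if d * m \<le> k then mangoldt d / real d * (1 / real m) else 0) = 1 / real m * mertens_sum (min x (k div m))"
      unfolding mertens_sum_def **[OF \<open>m \<ge> 1\<close>] sum.inter_filter[OF finite_atLeastAtMost]
      by (auto simp: sum_distrib_left mult.commute intro!: sum.cong)
  qed
  finally show ?thesis .
qed

text \<open>The function \<open>r \<mapsto> r * min t r - (min t r)\<^sup>2 / 2\<close> is the antiderivative of \<open>min t\<close> on \<open>[0, \<infinity>)\<close>.\<close>

lemma min_antiderivative_bounds:
  fixes t r s :: real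
  defines "R \<equiv> \<lambda>r. r * min t r - (min t r)\<^sup>2 / 2"
  assumes "0 \<le> r" "r \<le> s" "0 \<le> t"
  shows "(s - r) * min t r \<le> R s - R r" "R s - R r \<le> (s - r) * min t s"
proof -
  have "R s - R r - (s - r) * min t r = (s - min t s/2) * min t s - (s - min t r/2) * min t r"
    by (simp add: R_def power2_eq_square field_simps)
  also have "\<dots> = (min t s - min t r) * (s - (min t s + min t r) / 2)"
    by (simp add: field_simps)
  also have "\<dots> \<ge> 0"
    using assms by (intro mult_nonneg_nonneg) (auto simp: min_def)
  finally show "(s - r) * min t r \<le> R s - R r" by simp
  have "(s - r) * min t s - (R s - R r) = (min t s - min t r) * ((min t s + min t r) / 2 - r)"
    by (simp add: R_def power2_eq_square field_simps)
  also have "\<dots> \<ge> 0"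
    using assms by (cases "t \<le> r") (auto simp: min_def intro!: mult_nonneg_nonneg)
  finally show "R s - R r \<le> (s - r) * min t s" by simp
qed

text \<open>In the variable \<open>r = L - ln m\<close> this is a Riemann sum of
  \<open>min t\<close> over \<open>[0, L]\<close>, whose integral is \<open>L * t - t^2 / 2\<close>.
  The integrand is monotone and the weights \<open>1 / m\<close> interlace with the mesh
  \<open>ln (m + 1) - ln m\<close>, so the error is at most the first term,
  \<open>t\<close>.\<close>

lemma sum_min_ln_bounds:
  fixes t :: real
  assumes "k > 0" "0 \<le> t" "t \<le> ln (real k)"
  defines "L \<equiv> ln (real k)"
  shows "\<bar>(\<Sum>m=1..k. 1 / real m * min t (L - ln (real m))) - (L * t - t\<^sup>2 / 2)\<bar> \<le> L"
proof -
  define R where "R = (\<lambda>r. r * min t r - (min t r)\<^sup>2 / 2)"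
  define g where "g m = min t (L - ln (real m))" for m :: nat
  have R0: "R 0 = 0" "R L = L * t - t\<^sup>2 / 2"
    using assms by (auto simp: R_def L_def)
  have lnL: "0 \<le> L - ln (real m)" if "m \<le> k" "m \<ge> 1" for m
    using that by (auto simp: L_def)
  have g0: "0 \<le> g m" if "m \<le> k" "m \<ge> 1" for m
    using lnL[OF that] assms(2) by (simp add: g_def)
  have up: "j \<le> k \<Longrightarrow> (\<Sum>m=1..j. 1 / real m * g m) \<le> t + R L - R (L - ln (real j))" if "j > 0" for j
    using that
  proof (induction j rule: nat_induct_non_zero)
    case 1
    then show ?case using assms by (simp add: g_def L_def)
  next
    case (Suc j)
    have "1 / real (Suc j) * g (Suc j) \<le> (ln (real (Suc j)) - ln (real j)) * g (Suc j)"
      using Suc g0[of "Suc j"] ln_Suc_diff_bounds(1)[of j] by (intro mult_right_mono) auto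
    also have "\<dots> \<le> R (L - ln (real j)) - R (L - ln (real (Suc j)))"
      using min_antiderivative_bounds(1)[of "L - ln (real (Suc j))" "L - ln (real j)" t] lnL[of "Suc j"] Suc assms(2)
      unfolding R_def g_def by simp
    finally show ?case using Suc by simp
  qed
  \<comment> \<open>Here \<open>1 / m\<close> is compared with the next mesh step instead of the
    previous one, so the first \<open>j\<close> terms reach \<open>ln (j + 1)\<close>. For
    \<open>j + 1 = k\<close> this exhausts the interval, and the last term is dropped.\<close>
  have low: "Suc j \<le> k \<Longrightarrow> (\<Sum>m=1..j. 1 / real m * g m) \<ge> R L - R (L - ln (real (Suc j)))" for j
  proof (induction j)
    case 0
    then show ?case by simp
  next
    case (Suc j)
    have "1 / real (Suc j) * g (Suc j) \<ge> (ln (real (Suc (Suc j))) - ln (real (Suc j))) * g (Suc j)"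
      using Suc g0[of "Suc j"] ln_Suc_diff_bounds(2)[of "Suc j"] by (intro mult_right_mono) auto
    moreover have "(ln (real (Suc (Suc j))) - ln (real (Suc j))) * g (Suc j) \<ge> R (L - ln (real (Suc j))) - R (L - ln (real (Suc (Suc j))))"
      using min_antiderivative_bounds(2)[of "L - ln (real (Suc (Suc j)))" "L - ln (real (Suc j))" t] lnL[of "Suc (Suc j)"] Suc assms(2)
      unfolding R_def g_def by simp
    ultimately show ?case using Suc by simp
  qed
  have u: "(\<Sum>m=1..k. 1 / real m * g m) \<le> t + R L"
    using up[of k] assms(1) R0 by (simp add: L_def)
  obtain j where j: "k = Suc j" using assms(1) gr0_implies_Suc by blast
  have l: "(\<Sum>m=1..k. 1 / real m * g m) \<ge> R L"
    using low[of j] g0[of k] R0 unfolding j by (simp add: L_def j add_increasing2)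
  show ?thesis
    using u l R0 assms(3) unfolding g_def L_def by (auto simp: abs_le_iff)
qed

text \<open>The freedom of \<open>t\<close> in a unit interval above \<open>ln x\<close>
  accommodates \<open>x\<close> as the integer part of \<open>exp t\<close>. Mertens' error 4 and
  the rounding error 1, summed against \<open>1 / m\<close>, give
  \<open>5 * harm k <= 5 * L + 5\<close>; the Riemann sum adds \<open>L\<close>.\<close>

lemma mangoldt_harm_sum_approx:
  assumes "1 \<le> x" "x \<le> k" and t: "ln (real x) \<le> t" "t \<le> ln (real x) + 1" "t \<le> ln (real k)"
  defines "L \<equiv> ln (real k)"
  shows "\<bar>(\<Sum>d=1..x. mangoldt d / real d * harm (k div d)) - (L * t - t\<^sup>2 / 2)\<bar> \<le> 6 * L + 5"
proof -
  have "0 \<le> ln (real x)" using assms by simp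
  then have t0: "0 \<le> t" using t by linarith
  have bound: "\<bar>mertens_sum (min x (k div m)) - min t (L - ln (real m))\<bar> \<le> 5" if m: "1 \<le> m" "m \<le> k" for m
  proof -
    have kd: "1 \<le> k div m" using m by (simp add: Suc_le_eq div_greater_zero_iff)
    have "\<bar>mertens_sum (min x (k div m)) - ln (real (min x (k div m)))\<bar> \<le> 4"
      using assms kd by (intro mertens_first) auto
    moreover have "ln (real (min x (k div m))) = min (ln (real x)) (ln (real (k div m)))"
      using assms kd by (auto simp: min_def)
    moreover have "\<bar>min (ln (real x)) (ln (real (k div m))) - min t (L - ln (real m))\<bar> \<le> 1"
      using t ln_div_bounds[OF m] unfolding L_def by linarith
    ultimately show ?thesis by linarith
  qed
  have "\<bar>(\<Sum>d=1..x. mangoldt d / real d * harm (k div d)) - (\<Sum>m=1..k. 1 / real m * min t (L - ln (real m)))\<bar>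
     = \<bar>\<Sum>m=1..k. 1 / real m * (mertens_sum (min x (k div m)) - min t (L - ln (real m)))\<bar>"
    using assms by (simp only: mangoldt_harm_swap right_diff_distrib sum_subtractf)
  also have "\<dots> \<le> (\<Sum>m=1..k. 1 / real m * 5)"
    by (rule order.trans[OF sum_abs], rule sum_mono) (use bound in \<open>auto simp: abs_mult divide_right_mono\<close>)
  also have "\<dots> = 5 * harm k"
    by (simp add: harm_def sum_distrib_left inverse_eq_divide)
  also have "\<dots> \<le> 5 * (L + 1)"
    using harm_bounds_ln(2)[of k] assms by (simp add: L_def)
  finally show ?thesis
    using sum_min_ln_bounds[of k t] t0 assms by (simp add: L_def)
qed

lemma log_harm_approx:
  assumes "k > 0"
  shows "\<bar>log_harm k - (ln (real k))\<^sup>2 / 2\<bar> \<le> 6 * ln (real k) + 5"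
  using mangoldt_harm_sum_approx[of k k "ln (real k)"] assms
  by (simp add: log_harm_conv_mangoldt power2_eq_square)

section \<open>Distribution functions of the divisor and of the bound\<close>

lemma ln_ge_half: "k \<ge> 2 \<Longrightarrow> ln (real k) \<ge> 1/2"
proof -
  assume "k \<ge> 2"
  have "1/2 \<le> ln (2::real)" using ln2_ge_two_thirds by simp
  also have "\<dots> \<le> ln (real k)" using \<open>k \<ge> 2\<close> by simp
  finally show ?thesis .
qed

text \<open>Since \<open>ln m\<close> is the sum of the von Mangoldt function over the divisors of \<open>m\<close>, the size-biased
  sample on \<open>{1..k}\<close> is a prime power \<open>d\<close> with this distribution function times an independent
  harmonic sample on \<open>{1..k div d}\<close>.\<close>

definition divisor_cdf :: "nat \<Rightarrow> nat \<Rightarrow> real" where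
  "divisor_cdf k x = (\<Sum>d=1..x. mangoldt d / real d * harm (k div d)) / log_harm k"

text \<open>\<open>1 - (1 - t / L)^2\<close> is the distribution function of \<open>L * B\<close>,
  where B has density \<open>2 * (1 - b)\<close>. Numerator and normaliser each deviate by O(L) from
  their main terms, and the normaliser has order \<open>L^2\<close>, which leaves an error O(1 /
  L).\<close>

lemma divisor_cdf_approx:
  assumes k: "k \<ge> 2" and x: "1 \<le> x" "x \<le> k" and t: "ln (real x) \<le> t" "t \<le> ln (real x) + 1" "t \<le> ln (real k)"
  defines "L \<equiv> ln (real k)"
  shows "\<bar>divisor_cdf k x - (1 - (1 - t / L)\<^sup>2)\<bar> \<le> 128 / L"
proof -
  define S where "S = log_harm k"
  define N where "N = (\<Sum>d=1..x. mangoldt d / real d * harm (k div d))"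
  define q where "q = L * t - t\<^sup>2 / 2"
  define \<tau> where "\<tau> = 1 - (1 - t / L)\<^sup>2"
  have L: "L \<ge> 1/2" using ln_ge_half[OF k] by (simp add: L_def)
  have "0 \<le> ln (real x)" using x by simp
  then have t0: "0 \<le> t" using t by linarith
  have S: "S > 0" "S \<ge> L\<^sup>2 / 4" using log_harm_pos[OF k] log_harm_ge[of k] by (auto simp: S_def L_def)
  have q: "q = \<tau> * (L\<^sup>2 / 2)"
    using L by (simp add: q_def \<tau>_def power2_eq_square field_simps)
  have \<tau>: "0 \<le> \<tau>" "\<tau> \<le> 1"
  proof -
    have "0 \<le> 1 - t / L" "1 - t / L \<le> 1"
      using t0 t(3) L by (auto simp: L_def)
    then show "0 \<le> \<tau>" "\<tau> \<le> 1"
      by (auto simp: \<tau>_def intro: power_le_one)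
  qed
  have "\<bar>N - \<tau> * S\<bar> \<le> \<bar>N - q\<bar> + \<bar>\<tau> * (L\<^sup>2 / 2 - S)\<bar>"
    unfolding q by (simp add: algebra_simps)
  also have "\<bar>\<tau> * (L\<^sup>2 / 2 - S)\<bar> \<le> 1 * \<bar>L\<^sup>2 / 2 - S\<bar>"
    using \<tau> by (simp only: abs_mult) (intro mult_right_mono, auto)
  \<comment> \<open>Both errors are at most \<open>6 * L + 5\<close>, and
    \<open>10 <= 20 * L\<close> because \<open>L >= 1/2\<close>.\<close>
  also have "\<bar>N - q\<bar> + 1 * \<bar>L\<^sup>2 / 2 - S\<bar> \<le> 32 * L"
    using mangoldt_harm_sum_approx[OF x t] log_harm_approx[of k] k L
    unfolding N_def q_def S_def L_def by (simp add: abs_minus_commute)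
  finally have "\<bar>N - \<tau> * S\<bar> \<le> 32 * L" by simp
  moreover have "\<bar>N / S - \<tau>\<bar> = \<bar>N - \<tau> * S\<bar> / S"
  proof -
    have "N / S - \<tau> = (N - \<tau> * S) / S" using S by (simp add: field_simps)
    then show ?thesis using S by (simp add: abs_divide)
  qed
  ultimately have "\<bar>N / S - \<tau>\<bar> \<le> 32 * L / (L\<^sup>2 / 4)"
    using S L by (simp only:) (intro frac_le, auto)
  also have "\<dots> = 128 / L"
    using L by (simp add: power2_eq_square)
  finally show ?thesis
    by (simp add: divisor_cdf_def N_def S_def \<tau>_def)
qed

text \<open>The harmonic sample on \<open>{1..n}\<close> is a mixture over \<open>k\<close> of the size-biased samples on \<open>{1..k}\<close>, with
  weights proportional to \<open>ln m / m\<close>. Summation by parts gives the distribution function of \<open>k\<close>; at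
  \<open>j = 0\<close> the formula relies on \<open>0 / 0 = 0\<close>.\<close>

definition bound_cdf :: "nat \<Rightarrow> nat \<Rightarrow> real" where
  "bound_cdf n j = (if j \<ge> n then 1 else (harm j - log_harm j / ln (real (Suc j))) / harm n)"

text \<open>Up to O(1), \<open>harm j\<close> is \<open>t\<close> and
  \<open>log_harm j / ln (j + 1)\<close> is \<open>t / 2\<close>, so only about half of the mass
  lies below \<open>n\<close>; the other half, at \<open>j = n\<close>, corresponds to the atom of Y
  at 1.\<close>

lemma bound_cdf_approx:
  assumes j: "1 \<le> j" "j < n" and t: "ln (real j) \<le> t" "t \<le> ln (real j) + 1" "t \<le> ln (real n)"
  defines "L \<equiv> ln (real n)"
  shows "\<bar>bound_cdf n j - t / (2 * L)\<bar> \<le> 20 / L"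
proof -
  define a b where "a = ln (real j)" and "b = ln (real (Suc j))"
  have n: "n \<ge> 2" using j by simp
  have L: "L \<ge> 1/2" using ln_ge_half[OF n] by (simp add: L_def)
  have b: "b \<ge> 1/2" using ln_ge_half[of "Suc j"] j by (simp add: b_def)
  have a: "a \<ge> 0" using j by (simp add: a_def)
  have ab: "a \<le> b" "b \<le> a + 1"
  proof -
    have "1 / real j \<le> 1" using j by simp
    then show "b \<le> a + 1"
      using ln_Suc_diff_bounds(2)[of j] j unfolding a_def b_def by linarith
    show "a \<le> b" using j by (simp add: a_def b_def)
  qed
  have S: "\<bar>log_harm j - a\<^sup>2 / 2\<bar> \<le> 6 * a + 5"
    using log_harm_approx[of j] j by (simp add: a_def)
  \<comment> \<open>The numerator is off by at most \<open>6 * a + 5 + a / 2 <= 17 * b\<close>, by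
    \<open>a <= b\<close> and \<open>b >= 1/2\<close>. With the errors of \<open>harm j\<close> and
    of \<open>t\<close> this makes the 19 below.\<close>
  have "\<bar>log_harm j / b - a / 2\<bar> \<le> 17"
  proof -
    have "\<bar>log_harm j - a * b / 2\<bar> \<le> \<bar>log_harm j - a\<^sup>2 / 2\<bar> + \<bar>a * (b - a) / 2\<bar>"
      by (simp add: power2_eq_square algebra_simps diff_divide_distrib)
    also have "\<bar>a * (b - a) / 2\<bar> \<le> a / 2"
      using a ab by (auto simp: abs_mult intro: mult_left_le)
    finally have "\<bar>log_harm j - a * b / 2\<bar> \<le> 17 * b"
      using S ab b a by linarith
    moreover have "log_harm j / b - a / 2 = (log_harm j - a * b / 2) / b"
      using b by (simp add: field_simps)
    ultimately show ?thesis using b by (simp add: abs_divide divide_le_eq)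
  qed
  moreover have "\<bar>harm j - a\<bar> \<le> 1"
    using harm_bounds_ln[of j] j by (auto simp: a_def abs_le_iff)
  ultimately have N: "\<bar>harm j - log_harm j / b - t / 2\<bar> \<le> 19"
    using t unfolding a_def by linarith
  have h: "L \<le> harm n" "harm n \<le> L + 1" using harm_bounds_ln[of n] n by (auto simp: L_def)
  have t0: "0 \<le> t" using a t by (simp add: a_def)
  \<comment> \<open>The second term is the price of replacing \<open>harm n\<close> by
    \<open>L\<close> in the denominator: at most \<open>1 / L\<close>, on top of
    \<open>19 / L\<close>.\<close>
  have "(harm j - log_harm j / b) / harm n - t / (2 * L) =
     (harm j - log_harm j / b - t / 2) / harm n - (t / 2) * (harm n - L) / (harm n * L)"
  proof -
    have "(t / 2) * (harm n - L) / (harm n * L) = (t / 2) / L - (t / 2) / harm n"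
      using h L by (simp add: right_diff_distrib diff_divide_distrib)
    then show ?thesis by (simp add: diff_divide_distrib)
  qed
  moreover have "\<bar>(harm j - log_harm j / b - t / 2) / harm n\<bar> \<le> 19 / L"
    using N h L by (simp add: abs_divide) (intro frac_le, auto)
  moreover have "\<bar>(t / 2) * (harm n - L) / (harm n * L)\<bar> \<le> 1 / L"
  proof -
    have "\<bar>(t / 2) * (harm n - L) / (harm n * L)\<bar> = (t / 2) * (harm n - L) / (harm n * L)"
      using h L t0 by simp
    also have "\<dots> \<le> (harm n * 1) / (harm n * L)"
      using h L t0 t by (intro divide_right_mono mult_mono) (auto simp: L_def)
    also have "\<dots> = 1 / L" using h L by simp
    finally show ?thesis .
  qed
  ultimately have "\<bar>(harm j - log_harm j / b) / harm n - t / (2 * L)\<bar> \<le> 19 / L + 1 / L"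
    by (simp only:) (intro order.trans[OF abs_triangle_ineq4] add_mono)
  then show ?thesis
    using j by (simp add: bound_cdf_def b_def flip: add_divide_distrib)
qed

section \<open>The space of decreasing sequences\<close>

text \<open>An \<open>ennreal\<close> series needs no summability, so the triangle inequality and
  measurability hold for arbitrary real sequences; on \<open>seq_space\<close> it coincides with
  \<open>seq_dist\<close>.\<close>

definition l1_dist :: "(nat \<Rightarrow> real) \<Rightarrow> (nat \<Rightarrow> real) \<Rightarrow> ennreal" where
  "l1_dist x y = (\<Sum>k. ennreal \<bar>x k - y k\<bar>)"

lemma suminf_ennreal_eq_infsum:
  fixes f :: "nat \<Rightarrow> real"
  assumes "f summable_on UNIV" "\<And>i. 0 \<le> f i"
  shows "(\<Sum>i. ennreal (f i)) = ennreal (\<Sum>\<^sub>\<infinity>i. f i)"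
  using assms by (intro suminf_ennreal_eq has_sum_imp_sums has_sum_infsum) auto

lemma seq_space_iff:
  "x \<in> seq_space \<longleftrightarrow> (\<forall>i. 0 \<le> x i) \<and> decseq x \<and> (\<Sum>i. ennreal (x i)) \<le> 1"
proof (cases "(\<forall>i. 0 \<le> x i) \<and> decseq x")
  case True
  show ?thesis
  proof
    assume "x \<in> seq_space"
    then have "x summable_on UNIV" "(\<Sum>\<^sub>\<infinity>i. x i) \<le> 1" by (auto simp: seq_space_def)
    moreover from this True have "(\<Sum>i. ennreal (x i)) = ennreal (\<Sum>\<^sub>\<infinity>i. x i)"
      by (intro suminf_ennreal_eq_infsum) auto
    ultimately show "(\<forall>i. 0 \<le> x i) \<and> decseq x \<and> (\<Sum>i. ennreal (x i)) \<le> 1"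
      using True by (simp only: ennreal_le_1) blast
  next
    assume *: "(\<forall>i. 0 \<le> x i) \<and> decseq x \<and> (\<Sum>i. ennreal (x i)) \<le> 1"
    then have "(\<Sum>i. ennreal (x i)) \<noteq> top"
      by (metis ennreal_one_less_top leD)
    then have "summable x"
      using * by (intro summable_suminf_not_top) blast+
    then have s: "x summable_on UNIV"
      using * by (intro summable_nonneg_imp_summable_on) auto
    then have "(\<Sum>i. ennreal (x i)) = ennreal (\<Sum>\<^sub>\<infinity>i. x i)"
      using * by (intro suminf_ennreal_eq_infsum) auto
    then have "(\<Sum>\<^sub>\<infinity>i. x i) \<le> 1"
      using * by (simp only: ennreal_le_1)
    with s * show "x \<in> seq_space"
      by (auto simp: seq_space_def decseq_Suc_iff)
  qed
qed (auto simp: seq_space_def decseq_Suc_iff)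

lemma seq_space_summable:
  assumes "x \<in> seq_space"
  shows "summable x"
proof (rule summable_suminf_not_top)
  show "(\<Sum>i. ennreal (x i)) \<noteq> top"
    using assms unfolding seq_space_iff by (metis ennreal_one_less_top leD)
qed (use assms in \<open>auto simp: seq_space_iff\<close>)

lemma l1_dist_eq_seq_dist:
  assumes "x \<in> seq_space" "y \<in> seq_space"
  shows "ennreal (seq_dist x y) = l1_dist x y"
  unfolding seq_dist_def l1_dist_def
  by (rule suminf_ennreal_eq_infsum[OF seq_diff_summable[OF assms], symmetric]) simp

lemma seq_dist_less_iff:
  assumes "x \<in> seq_space" "y \<in> seq_space"
  shows "seq_dist x y < r \<longleftrightarrow> l1_dist x y < ennreal r"
proof -
  have "0 \<le> seq_dist x y" by (simp add: seq_dist_def infsum_nonneg)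
  then show ?thesis by (simp add: ennreal_less_iff flip: l1_dist_eq_seq_dist[OF assms])
qed

lemma l1_dist_triangle: "l1_dist x z \<le> l1_dist x y + l1_dist y z"
proof -
  have "l1_dist x z \<le> (\<Sum>k. ennreal \<bar>x k - y k\<bar> + ennreal \<bar>y k - z k\<bar>)"
    unfolding l1_dist_def by (intro suminf_le) (auto simp flip: ennreal_plus)
  also have "\<dots> = l1_dist x y + l1_dist y z"
    unfolding l1_dist_def by (intro suminf_add [symmetric]) auto
  finally show ?thesis .
qed

lemma l1_dist_scale: "c \<ge> 0 \<Longrightarrow> l1_dist (\<lambda>k. c * x k) (\<lambda>k. c * y k) = ennreal c * l1_dist x y"
proof -
  assume c: "c \<ge> 0"
  have "l1_dist (\<lambda>k. c * x k) (\<lambda>k. c * y k) = (\<Sum>k. ennreal c * ennreal \<bar>x k - y k\<bar>)"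
    unfolding l1_dist_def using c by (simp add: abs_mult ennreal_mult' flip: right_diff_distrib del: ennreal_suminf_cmult)
  then show ?thesis by (simp add: l1_dist_def)
qed

lemma l1_dist_scale_diff:
  assumes "x \<in> seq_space"
  shows "l1_dist (\<lambda>k. a * x k) (\<lambda>k. b * x k) \<le> ennreal \<bar>a - b\<bar>"
proof -
  have "l1_dist (\<lambda>k. a * x k) (\<lambda>k. b * x k) = (\<Sum>k. ennreal \<bar>a - b\<bar> * ennreal (x k))"
    unfolding l1_dist_def using assms
    by (simp add: seq_space_iff abs_mult ennreal_mult' flip: left_diff_distrib del: ennreal_suminf_cmult)
  also have "\<dots> = ennreal \<bar>a - b\<bar> * (\<Sum>k. ennreal (x k))" by simp
  also have "\<dots> \<le> ennreal \<bar>a - b\<bar> * 1"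
    using assms by (intro mult_left_mono) (auto simp: seq_space_iff)
  finally show ?thesis by simp
qed

lemma measurable_l1_dist[measurable (raw)]:
  assumes [measurable]: "f \<in> M \<rightarrow>\<^sub>M (\<Pi>\<^sub>M i\<in>UNIV. borel)" "g \<in> M \<rightarrow>\<^sub>M (\<Pi>\<^sub>M i\<in>UNIV. borel)"
  shows "(\<lambda>x. l1_dist (f x) (g x)) \<in> borel_measurable M"
  unfolding l1_dist_def by measurable

abbreviation real_seq :: "(nat \<Rightarrow> real) measure" where
  "real_seq \<equiv> \<Pi>\<^sub>M i\<in>(UNIV::nat set). (borel :: real measure)"

section \<open>Separability and the Borel sets of the sequence space\<close>

text \<open>The approximants have finite support and a common denominator; encoded by a list and a
  number, they are countably many. Rounding down preserves monotonicity and does not increase the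
  sum, so they stay in \<open>seq_space\<close>.\<close>

lemma seq_space_dense:
  assumes x: "x \<in> seq_space" and e: "e > 0"
  obtains l :: "nat list" and N :: nat where
    "(\<lambda>i. if i < length l then real (l ! i) / real N else 0) \<in> seq_space"
    "l1_dist x (\<lambda>i. if i < length l then real (l ! i) / real N else 0) < ennreal e"
proof -
  have x0: "0 \<le> x i" "decseq x" for i using x by (auto simp: seq_space_iff)
  have sx: "summable x" using seq_space_summable[OF x] .
  obtain m where m: "\<And>n. n \<ge> m \<Longrightarrow> norm (\<Sum>i. x (i + n)) < e / 2"
    using suminf_exist_split[of "e / 2" x] e sx by auto
  \<comment> \<open>The first \<open>m\<close> entries each lose at most \<open>1 / N\<close> and
    the tail has mass below \<open>e / 2\<close>, so \<open>m / N < e / 2\<close> suffices.\<close>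
  define N where "N = nat \<lceil>2 * real m / e\<rceil> + 1"
  have N: "N > 0" "real m / real N < e / 2"
  proof -
    show "N > 0" by (simp add: N_def)
    have "2 * real m / e < real N" by (simp add: N_def) linarith
    then show "real m / real N < e / 2" using e \<open>N > 0\<close> by (simp add: field_simps)
  qed
  define l where "l = map (\<lambda>i. nat \<lfloor>real N * x i\<rfloor>) [0..<m]"
  define c where "c i = (if i < length l then real (l ! i) / real N else 0)" for i
  have c: "c i = (if i < m then real_of_int \<lfloor>real N * x i\<rfloor> / real N else 0)" for i
    using x0(1)[of i] by (simp add: c_def l_def)
  have cx: "0 \<le> c i" "c i \<le> x i" for i
    using x0(1)[of i] N by (auto simp: c field_simps)
  have cd: "decseq c"
    unfolding decseq_Suc_iff
  proof
    fix i
    have "real N * x (Suc i) \<le> real N * x i"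
      using x0(2) by (auto simp: decseq_Suc_iff intro: mult_left_mono)
    then have "\<lfloor>real N * x (Suc i)\<rfloor> \<le> \<lfloor>real N * x i\<rfloor>"
      by (rule floor_mono)
    then show "c (Suc i) \<le> c i"
      using x0(1)[of i] by (auto simp: c divide_right_mono)
  qed
  have "(\<Sum>i. ennreal (c i)) \<le> (\<Sum>i. ennreal (x i))"
    using cx by (intro suminf_le ennreal_leI) auto
  then have cS: "c \<in> seq_space"
    using x cd cx by (auto simp: seq_space_iff)
  have diff: "\<bar>x i - c i\<bar> \<le> (if i < m then 1 / real N else x i)" for i
  proof (cases "i < m")
    case True
    have "real N * x i - 1 \<le> real_of_int \<lfloor>real N * x i\<rfloor>" by linarith
    then have "(real N * x i - 1) / real N \<le> real_of_int \<lfloor>real N * x i\<rfloor> / real N"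
      by (intro divide_right_mono) auto
    then have "x i - 1 / real N \<le> c i"
      using N True by (simp add: c diff_divide_distrib)
    then show ?thesis using True cx[of i] by simp
  next
    case False
    then show ?thesis using x0(1)[of i] by (simp add: c)
  qed
  define g where "g i = (if i < m then 1 / real N else x i)" for i
  have sg: "summable g"
    using sx by (subst summable_cong[where g = x])
      (auto simp: g_def eventually_at_top_linorder intro!: exI[of _ m])
  have "l1_dist x c \<le> (\<Sum>i. ennreal (g i))"
    unfolding l1_dist_def using diff by (intro suminf_le ennreal_leI) (auto simp: g_def)
  also have "\<dots> = ennreal (suminf g)"
    using x0 by (intro suminf_ennreal_eq summable_sums sg) (auto simp: g_def)
  also have "suminf g = (\<Sum>i. x (i + m)) + real m / real N"
    using suminf_split_initial_segment[OF sg, of m] by (simp add: g_def)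
  also have "ennreal \<dots> < ennreal e"
  proof (intro ennreal_lessI)
    have "(\<Sum>i. x (i + m)) < e / 2" using m[of m] by (simp add: abs_less_iff)
    then show "(\<Sum>i. x (i + m)) + real m / real N < e" using N by linarith
  qed (use e in auto)
  finally show ?thesis
    using cS by (intro that[of l N]) (auto simp: c_def[abs_def])
qed

lemma space_seq_borel [simp]: "space seq_borel = seq_space"
proof -
  interpret Metric_space seq_space seq_dist by (rule Metric_space_seq)
  show ?thesis
    unfolding seq_borel_def by (rule space_measure_of) (auto dest!: openin_subset)
qed

lemma measurable_coord_seq_borel: "(\<lambda>x. x i) \<in> borel_measurable seq_borel"
proof -
  interpret Metric_space seq_space seq_dist by (rule Metric_space_seq)
  show ?thesis
    unfolding borel_measurable_iff_greater
  proof safe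
    fix a
    \<comment> \<open>Coordinates are 1-Lipschitz, so their strict superlevel sets are open.\<close>
    have "openin mtopology {x \<in> seq_space. a < x i}"
      unfolding openin_mtopology
    proof safe
      fix x assume x: "x \<in> seq_space" "a < x i"
      have "mball x (x i - a) \<subseteq> {x \<in> seq_space. a < x i}"
      proof
        fix y assume "y \<in> mball x (x i - a)"
        then have y: "y \<in> seq_space" "seq_dist x y < x i - a" by auto
        have "ennreal \<bar>x i - y i\<bar> = (\<Sum>k\<in>{i}. ennreal \<bar>x k - y k\<bar>)" by simp
        also have "\<dots> \<le> l1_dist x y"
          unfolding l1_dist_def by (intro sum_le_suminf) auto
        also have "\<dots> = ennreal (seq_dist x y)"
          using x y by (simp add: l1_dist_eq_seq_dist)
        finally have "\<bar>x i - y i\<bar> \<le> seq_dist x y"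
          by (subst (asm) ennreal_le_iff) auto
        then show "y \<in> {x \<in> seq_space. a < x i}" using y by auto
      qed
      then show "\<exists>r>0. mball x r \<subseteq> {x \<in> seq_space. a < x i}"
        using x by (intro exI[of _ "x i - a"]) auto
    qed
    then show "{w \<in> space seq_borel. a < w i} \<in> sets seq_borel"
      unfolding space_seq_borel unfolding seq_borel_def by (intro in_measure_of) (auto dest!: openin_subset)
  qed
qed

text \<open>By separability every open set is a countable union of balls with centres in the dense
  set, and balls are measurable in the product sense because the distance is a series of coordinate
  functions. Measurability into \<open>seq_borel\<close> thereby reduces to single
  coordinates.\<close>

lemma sets_seq_borel: "sets seq_borel = sets (restrict_space real_seq seq_space)"
proof
  interpret Metric_space seq_space seq_dist by (rule Metric_space_seq)
  have sp: "space (restrict_space real_seq seq_space) = seq_space"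
    by (auto simp: space_restrict_space space_PiM)
  have id: "(\<lambda>x. x) \<in> restrict_space real_seq seq_space \<rightarrow>\<^sub>M real_seq"
    by (intro measurable_restrict_space1) simp
  define cen where "cen = (\<lambda>(l::nat list, N::nat) i. if i < length l then real (l ! i) / real N else 0)"
  have ball: "mball c r \<in> sets (restrict_space real_seq seq_space)" if c: "c \<in> seq_space" for c r
  proof -
    have "mball c r = {x \<in> space (restrict_space real_seq seq_space). l1_dist c x < ennreal r}"
      using c by (auto simp: sp seq_dist_less_iff)
    also have "\<dots> \<in> sets (restrict_space real_seq seq_space)"
    proof -
      have [measurable]: "(\<lambda>x. l1_dist c x) \<in> borel_measurable (restrict_space real_seq seq_space)"
        by (intro measurable_l1_dist id measurable_const) (simp add: space_PiM)
      show ?thesis by measurable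
    qed
    finally show ?thesis .
  qed
  have "U \<in> sets (restrict_space real_seq seq_space)" if U: "openin mtopology U" for U
  proof -
    define B where "B = {p. cen (fst p) \<in> seq_space \<and> mball (cen (fst p)) (1 / real (Suc (snd p))) \<subseteq> U}"
    have "U = (\<Union>p\<in>B. mball (cen (fst p)) (1 / real (Suc (snd p))))"
    proof
      show "U \<subseteq> (\<Union>p\<in>B. mball (cen (fst p)) (1 / real (Suc (snd p))))"
      proof
        fix x assume "x \<in> U"
        then obtain r where r: "r > 0" "mball x r \<subseteq> U" and x: "x \<in> seq_space"
          using U unfolding openin_mtopology by blast
        obtain j where j: "1 / real (Suc j) < r / 2"
          using reals_Archimedean[of "r / 2"] r by (auto simp: inverse_eq_divide)
        obtain l N where lN: "cen (l, N) \<in> seq_space" "l1_dist x (cen (l, N)) < ennreal (1 / real (Suc j))"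
          using seq_space_dense[OF x, of "1 / real (Suc j)"] unfolding cen_def by auto
        then have d: "seq_dist x (cen (l, N)) < 1 / real (Suc j)"
          using x by (simp add: seq_dist_less_iff)
        have "mball (cen (l, N)) (1 / real (Suc j)) \<subseteq> mball x r"
        proof
          fix y assume "y \<in> mball (cen (l, N)) (1 / real (Suc j))"
          then have y: "y \<in> seq_space" "seq_dist (cen (l, N)) y < 1 / real (Suc j)" by auto
          have "seq_dist x y \<le> seq_dist x (cen (l, N)) + seq_dist (cen (l, N)) y"
            using x y lN by (intro triangle)
          then show "y \<in> mball x r" using x y j d by auto
        qed
        then have "((l, N), j) \<in> B" using r lN by (auto simp: B_def)
        moreover have "x \<in> mball (cen (l, N)) (1 / real (Suc j))"
          using x lN d by (auto simp: commute)
        ultimately show "x \<in> (\<Union>p\<in>B. mball (cen (fst p)) (1 / real (Suc (snd p))))"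
          by (intro UN_I[of "((l, N), j)"]) auto
      qed
    qed (auto simp: B_def)
    also have "\<dots> \<in> sets (restrict_space real_seq seq_space)"
      by (intro sets.countable_UN'' ball) (auto simp: B_def)
    finally show ?thesis .
  qed
  then have "{A. openin mtopology A} \<subseteq> sets (restrict_space real_seq seq_space)" by auto
  from sets.sigma_sets_subset[OF this]
  have "sigma_sets seq_space {A. openin mtopology A} \<subseteq> sets (restrict_space real_seq seq_space)"
    by (simp add: sp)
  moreover have "{A. openin mtopology A} \<subseteq> Pow seq_space"
    by (auto dest!: openin_subset)
  ultimately show "sets seq_borel \<subseteq> sets (restrict_space real_seq seq_space)"
    unfolding seq_borel_def by simp
  have "(\<lambda>x. x) \<in> seq_borel \<rightarrow>\<^sub>M restrict_space real_seq seq_space"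
  proof (rule measurable_restrict_space2)
    show "(\<lambda>x. x) \<in> seq_borel \<rightarrow>\<^sub>M real_seq"
      by (rule measurable_PiM_single') (auto intro: measurable_coord_seq_borel)
  qed auto
  then show "sets (restrict_space real_seq seq_space) \<subseteq> sets seq_borel"
  proof (intro subsetI)
    fix A assume A: "A \<in> sets (restrict_space real_seq seq_space)"
    then have "A \<subseteq> seq_space" using sets.sets_into_space[OF A] by (simp add: sp)
    with measurable_sets[OF \<open>(\<lambda>x. x) \<in> seq_borel \<rightarrow>\<^sub>M restrict_space real_seq seq_space\<close> A]
    show "A \<in> sets seq_borel" by (simp add: Int_absorb2)
  qed
qed

lemma measurable_seq_borelI:
  assumes "f \<in> M \<rightarrow>\<^sub>M real_seq" "\<And>x. x \<in> space M \<Longrightarrow> f x \<in> seq_space"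
  shows "f \<in> M \<rightarrow>\<^sub>M seq_borel"
  using assms by (subst measurable_cong_sets[OF refl sets_seq_borel]) (auto intro: measurable_restrict_space2)

lemma measurable_seq_borelD:
  assumes "f \<in> M \<rightarrow>\<^sub>M seq_borel"
  shows "f \<in> M \<rightarrow>\<^sub>M real_seq"
  using assms measurable_cong_sets[OF refl sets_seq_borel, of M] by (auto simp: measurable_restrict_space2_iff)

section \<open>Inserting a point into a decreasing sequence\<close>

text \<open>For decreasing \<open>s\<close> the entry at \<open>Suc j\<close> is the median of
  \<open>a\<close>, \<open>s j\<close> and \<open>s (Suc j)\<close>, which describes sorted
  insertion without naming the position of \<open>a\<close>.\<close>

definition insert_seq :: "real \<Rightarrow> (nat \<Rightarrow> real) \<Rightarrow> nat \<Rightarrow> real" where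
  "insert_seq a s k = (case k of 0 \<Rightarrow> max a (s 0) | Suc j \<Rightarrow> max (min a (s j)) (s (Suc j)))"

lemma insert_seq_0 [simp]: "insert_seq a s 0 = max a (s 0)"
  and insert_seq_Suc [simp]: "insert_seq a s (Suc k) = max (min a (s k)) (s (Suc k))"
  by (simp_all add: insert_seq_def)

lemma decseq_insert_seq: "decseq s \<Longrightarrow> decseq (insert_seq a s)"
  unfolding decseq_Suc_iff
proof
  fix n assume s: "\<forall>n. s (Suc n) \<le> s n"
  show "insert_seq a s (Suc n) \<le> insert_seq a s n"
    using s[rule_format, of n] s[rule_format, of "n - 1"] by (cases n) auto
qed

lemma insert_seq_nonneg: "(\<And>k. 0 \<le> s k) \<Longrightarrow> 0 \<le> insert_seq a s k"
  by (cases k) (auto simp: le_max_iff_disj)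

lemma insert_seq_scale: "c \<ge> 0 \<Longrightarrow> insert_seq (c * a) (\<lambda>k. c * s k) = (\<lambda>k. c * insert_seq a s k)"
proof
  fix k assume "c \<ge> 0"
  then show "insert_seq (c * a) (\<lambda>k. c * s k) k = c * insert_seq a s k"
    by (cases k) (simp_all add: max_mult_distrib_left min_mult_distrib_left)
qed

lemma insert_seq_zero:
  assumes "decseq s" "\<And>k. 0 \<le> s k"
  shows "insert_seq 0 s = s"
proof
  fix k show "insert_seq 0 s k = s k"
    using assms by (cases k) (auto simp: max_def min_def)
qed

text \<open>Insertion is a cascade of compare-exchange steps, and each such step is nonexpansive for the
  sum of absolute differences.\<close>

lemma l1_dist_insert_seq:
  assumes s: "decseq s" and t: "decseq t"
  shows "l1_dist (insert_seq a s) (insert_seq b t) \<le> ennreal \<bar>a - b\<bar> + l1_dist s t"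
proof -
  have exch: "\<bar>max p q - max p' q'\<bar> + \<bar>min p q - min p' q'\<bar> \<le> \<bar>p - p'\<bar> + \<bar>q - q'\<bar>" for p q p' q' :: real
    by (auto simp: max_def min_def)
  \<comment> \<open>\<open>min a (s n)\<close> is the value handed on to the next exchange. Keeping
    its discrepancy on the left makes the induction close.\<close>
  have *: "(\<Sum>k<Suc n. \<bar>insert_seq a s k - insert_seq b t k\<bar>) + \<bar>min a (s n) - min b (t n)\<bar>
      \<le> \<bar>a - b\<bar> + (\<Sum>k<Suc n. \<bar>s k - t k\<bar>)" for n
  proof (induction n)
    case 0
    show ?case using exch[of a "s 0" b "t 0"] by simp
  next
    case (Suc n)
    have "min (min a (s n)) (s (Suc n)) = min a (s (Suc n))"
      "min (min b (t n)) (t (Suc n)) = min b (t (Suc n))"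
      using decseq_SucD[OF s, of n] decseq_SucD[OF t, of n] by (auto simp: min_def)
    then show ?case
      using exch[of "min a (s n)" "s (Suc n)" "min b (t n)" "t (Suc n)"] Suc.IH
      by simp
  qed
  have "(\<Sum>k<n. ennreal \<bar>insert_seq a s k - insert_seq b t k\<bar>) \<le> ennreal \<bar>a - b\<bar> + l1_dist s t" for n
  proof -
    have "(\<Sum>k<n. \<bar>insert_seq a s k - insert_seq b t k\<bar>) \<le> (\<Sum>k<Suc n. \<bar>insert_seq a s k - insert_seq b t k\<bar>)"
      by simp
    also have "\<dots> \<le> \<bar>a - b\<bar> + (\<Sum>k<Suc n. \<bar>s k - t k\<bar>)"
      using *[of n] by linarith
    finally have le: "(\<Sum>k<n. \<bar>insert_seq a s k - insert_seq b t k\<bar>) \<le> \<bar>a - b\<bar> + (\<Sum>k<Suc n. \<bar>s k - t k\<bar>)" .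
    have "(\<Sum>k<n. ennreal \<bar>insert_seq a s k - insert_seq b t k\<bar>) = ennreal (\<Sum>k<n. \<bar>insert_seq a s k - insert_seq b t k\<bar>)"
      by (rule sum_ennreal) simp
    also have "\<dots> \<le> ennreal (\<bar>a - b\<bar> + (\<Sum>k<Suc n. \<bar>s k - t k\<bar>))"
      by (rule ennreal_leI[OF le])
    also have "\<dots> = ennreal \<bar>a - b\<bar> + (\<Sum>k<Suc n. ennreal \<bar>s k - t k\<bar>)"
      by (subst ennreal_plus) (auto simp: sum_nonneg simp del: sum.lessThan_Suc)
    also have "\<dots> \<le> ennreal \<bar>a - b\<bar> + l1_dist s t"
      unfolding l1_dist_def by (intro add_left_mono sum_le_suminf) auto
    finally show ?thesis .
  qed
  then show ?thesis
    unfolding l1_dist_def[of "insert_seq a s"] suminf_eq_SUP by (intro SUP_least)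
qed

lemma l1_dist_insert_seq_self:
  assumes "decseq s" "\<And>k. 0 \<le> s k"
  shows "l1_dist s (insert_seq a s) \<le> ennreal \<bar>a\<bar>"
  using l1_dist_insert_seq[OF assms(1) assms(1), of 0 a] by (simp add: insert_seq_zero[OF assms] l1_dist_def)

text \<open>Total mass is the distance to the zero sequence, which is itself the result of inserting
  0 into zeros; nonexpansiveness does the rest.\<close>

lemma suminf_insert_seq_le:
  assumes s: "decseq s" "\<And>k. 0 \<le> s k" and a: "0 \<le> a"
  shows "(\<Sum>k. ennreal (insert_seq a s k)) \<le> ennreal a + (\<Sum>k. ennreal (s k))"
proof -
  have z: "insert_seq 0 (\<lambda>_. 0) = (\<lambda>_. 0)"
    by (rule insert_seq_zero) auto
  have "decseq (\<lambda>_. 0 :: real)" by (simp add: decseq_def)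
  from l1_dist_insert_seq[OF s(1) this, of a 0] show ?thesis
    unfolding z using s a insert_seq_nonneg[of s, OF s(2)] by (simp add: l1_dist_def)
qed

lemma insert_seq_in_seq_space:
  assumes x: "x \<in> seq_space" and ab: "0 \<le> a" "0 \<le> b" "a + b \<le> 1"
  shows "insert_seq a (\<lambda>k. b * x k) \<in> seq_space"
proof -
  have x': "decseq (\<lambda>k. b * x k)" "0 \<le> b * x k" for k
    using x ab by (auto simp: seq_space_iff decseq_def mult_left_mono)
  have "(\<Sum>k. ennreal (insert_seq a (\<lambda>k. b * x k) k)) \<le> ennreal a + (\<Sum>k. ennreal (b * x k))"
    by (rule suminf_insert_seq_le[OF x' ab(1)])
  also have "(\<Sum>k. ennreal (b * x k)) = ennreal b * (\<Sum>k. ennreal (x k))"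
    using ab by (simp add: ennreal_mult')
  also have "ennreal a + \<dots> \<le> ennreal a + ennreal b * 1"
    using x by (intro add_left_mono mult_left_mono) (auto simp: seq_space_iff)
  also have "\<dots> = ennreal (a + b)" using ab by (simp add: ennreal_plus)
  also have "\<dots> \<le> 1" using ab by (simp only: ennreal_le_1)
  finally show ?thesis
    unfolding seq_space_iff by (intro conjI allI decseq_insert_seq insert_seq_nonneg x')
qed

lemma measurable_insert_seq[measurable (raw)]:
  assumes [measurable]: "f \<in> borel_measurable M" "g \<in> M \<rightarrow>\<^sub>M real_seq"
  shows "(\<lambda>x. insert_seq (f x) (g x)) \<in> M \<rightarrow>\<^sub>M real_seq"
proof (rule measurable_PiM_single')
  fix k show "(\<lambda>x. insert_seq (f x) (g x) k) \<in> borel_measurable M"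
    by (cases k) simp_all
qed auto

section \<open>Decreasing sequences compared by counting entries above a level\<close>

lemma decseq_gt_iff_card:
  fixes x :: "nat \<Rightarrow> real"
  assumes "decseq x" "finite {k. x k > t}"
  shows "x k > t \<longleftrightarrow> k < card {k. x k > t}"
proof -
  define A where "A = {k. x k > t}"
  have down: "j \<in> A" if "i \<in> A" "j \<le> i" for i j
    using that assms(1) by (auto simp: A_def decseq_def intro: less_le_trans)
  have "A = {..<card A}"
  proof (cases "A = {}")
    case False
    have fin: "finite A" using assms by (simp add: A_def)
    have "A = {..Max A}"
      using Max_ge[OF fin] down[OF Max_in[OF fin False]] by auto
    then show ?thesis
      by (metis card_atMost lessThan_Suc_atMost)
  qed auto
  then have "k \<in> A \<longleftrightarrow> k \<in> {..<card A}" by blast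
  then show ?thesis by (simp add: A_def)
qed

text \<open>Counts above positive levels determine such a sequence, so later identities between
  rearranged sequences need no explicit permutations.\<close>

lemma decseq_eqI_card:
  fixes x y :: "nat \<Rightarrow> real"
  assumes x: "decseq x" "\<And>k. 0 \<le> x k" "\<And>t. t > 0 \<Longrightarrow> finite {k. x k > t}"
    and y: "decseq y" "\<And>k. 0 \<le> y k" "\<And>t. t > 0 \<Longrightarrow> finite {k. y k > t}"
    and eq: "\<And>t. t > 0 \<Longrightarrow> card {k. x k > t} = card {k. y k > t}"
  shows "x = y"
proof
  fix k
  have *: "x k > t \<longleftrightarrow> y k > t" if "t > 0" for t
    using decseq_gt_iff_card[OF x(1) x(3)[OF that], of k] decseq_gt_iff_card[OF y(1) y(3)[OF that], of k] eq[OF that]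
    by simp
  \<comment> \<open>If the two values differ, their midpoint is a positive level that separates
    them.\<close>
  show "x k = y k"
    using *[of "(x k + y k) / 2"] x(2)[of k] y(2)[of k] by (cases "x k = 0 \<and> y k = 0") (auto simp: field_simps)
qed

lemma insert_seq_gt_iff:
  assumes s: "decseq s" "finite {k. s k > t}"
  shows "insert_seq a s k > t \<longleftrightarrow> k < card {k. s k > t} + (if a > t then 1 else 0)"
proof (cases k)
  case 0
  then show ?thesis
    using decseq_gt_iff_card[OF s, of 0] by (auto simp: less_max_iff_disj)
next
  case (Suc j)
  then show ?thesis
    using decseq_gt_iff_card[OF s, of j] decseq_gt_iff_card[OF s, of "Suc j"]
    by (auto simp: less_max_iff_disj)
qed

lemma card_insert_seq:
  assumes s: "decseq s" "finite {k. s k > t}"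
  shows "finite {k. insert_seq a s k > t}"
    "card {k. insert_seq a s k > t} = card {k. s k > t} + (if a > t then 1 else 0)"
proof -
  have "{k. insert_seq a s k > t} = {..<card {k. s k > t} + (if a > t then 1 else 0)}"
    using insert_seq_gt_iff[OF s] by auto
  then show "finite {k. insert_seq a s k > t}"
    "card {k. insert_seq a s k > t} = card {k. s k > t} + (if a > t then 1 else 0)"
    by simp_all
qed

section \<open>Decreasing rearrangements\<close>

lemma LIMSEQ_zero_finite_gt:
  fixes x :: "nat \<Rightarrow> real"
  assumes "x \<longlonglongrightarrow> 0" "t > 0"
  shows "finite {k. x k > t}"
proof -
  have "eventually (\<lambda>k. x k < t) sequentially"
    using assms by (rule order_tendstoD)
  then obtain N where "\<And>k. k \<ge> N \<Longrightarrow> x k < t"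
    by (auto simp: eventually_at_top_linorder)
  then have "{k. x k > t} \<subseteq> {..<N}"
    by (auto simp: not_less[symmetric]) (meson less_asym not_less)
  then show ?thesis by (rule finite_subset) auto
qed

text \<open>The index \<open>i\<close> is sent to the number of its predecessors in the order by decreasing value, ties
  broken by the index itself.\<close>

lemma decr_rearrangement_exists:
  fixes x :: "nat \<Rightarrow> real"
  assumes pos: "\<And>i. 0 < x i" and lim: "x \<longlonglongrightarrow> 0"
  shows "\<exists>\<sigma>. bij \<sigma> \<and> decseq (x \<circ> \<sigma>)"
proof -
  define less where "less i j \<longleftrightarrow> x i > x j \<or> x i = x j \<and> i < j" for i j
  define P where "P j = {i. less i j}" for j
  define rank where "rank j = card (P j)" for j
  have fin: "finite (P j)" for j
  proof -
    have "P j \<subseteq> {i. x i > x j / 2}"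
      using pos[of j] by (auto simp: P_def less_def)
    then show ?thesis
      using LIMSEQ_zero_finite_gt[OF lim, of "x j / 2"] pos[of j] by (meson finite_subset half_gt_zero)
  qed
  have tr: "less i j \<Longrightarrow> less j k \<Longrightarrow> less i k" for i j k
    by (auto simp: less_def)
  have irr: "\<not> less i i" for i
    by (simp add: less_def)
  have tot: "i \<noteq> j \<Longrightarrow> less i j \<or> less j i" for i j
    by (auto simp: less_def)
  have mono: "less i j \<Longrightarrow> rank i < rank j" for i j
  proof -
    assume "less i j"
    then have "P i \<subseteq> P j" "i \<in> P j" "i \<notin> P i"
      using tr irr by (auto simp: P_def)
    then show ?thesis
      unfolding rank_def by (intro psubset_card_mono fin) blast
  qed
  have inj: "inj rank"
    using tot mono by (metis injI less_irrefl_nat)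
  \<comment> \<open>Ranks form an initial segment of the naturals: among the predecessors of an
    index of rank \<open>Suc n\<close>, the one of largest rank has rank exactly \<open>n\<close>.
    Being infinite by injectivity, the segment is everything.\<close>
  have down: "m \<in> range rank" if "n \<in> range rank" "m \<le> n" for m n
    using that
  proof (induction n arbitrary: m)
    case (Suc n)
    from Suc.prems obtain j where j: "rank j = Suc n" by auto
    have ne: "P j \<noteq> {}" using j by (auto simp: rank_def)
    define i where "i = (ARG_MAX rank i. i \<in> P j)"
    have i: "i \<in> P j" "\<And>k. k \<in> P j \<Longrightarrow> rank k \<le> rank i"
      using arg_max_natI[of "\<lambda>i. i \<in> P j" _ rank "Suc (rank j)"] arg_max_nat_le[of "\<lambda>i. i \<in> P j" _ rank "Suc (rank j)"] ne mono
      unfolding i_def P_def by (auto, (metis less_Suc_eq)+)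
    have "P j = insert i (P i)"
    proof
      show "P j \<subseteq> insert i (P i)"
        using i(2) tot mono by (fastforce simp: P_def)
      show "insert i (P i) \<subseteq> P j"
        using i(1) tr by (auto simp: P_def)
    qed
    moreover have "i \<notin> P i" by (simp add: P_def irr)
    ultimately have "rank j = Suc (rank i)"
      unfolding rank_def using fin[of i] by simp
    then have "rank i = n" using j by simp
    then show ?case
      using Suc by (cases "m = Suc n") auto
  qed auto
  have "surj rank"
  proof -
    have "infinite (range rank)"
      using inj range_inj_infinite by blast
    then show ?thesis
      using down by (metis (no_types, lifting) UNIV_eq_I infinite_nat_iff_unbounded less_imp_le)
  qed
  with inj have bij: "bij rank" by (simp add: bij_def)
  have "decseq (x \<circ> inv rank)"
    unfolding decseq_def comp_def
  proof (intro allI impI)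
    fix m n :: nat assume mn: "m \<le> n"
    define i j where "i = inv rank m" and "j = inv rank n"
    have "rank i = m" "rank j = n" using bij by (auto simp: i_def j_def bij_def surj_f_inv_f)
    then have "\<not> less j i" using mono[of j i] mn by auto
    then show "x (inv rank n) \<le> x (inv rank m)"
      by (auto simp: less_def i_def j_def)
  qed
  then show ?thesis
    using bij bij_imp_bij_inv by blast
qed

lemma bij_comp_card_gt:
  fixes x :: "nat \<Rightarrow> real"
  assumes "bij \<sigma>"
  shows "card {k. (x \<circ> \<sigma>) k > t} = card {k. x k > t}" "finite {k. (x \<circ> \<sigma>) k > t} \<longleftrightarrow> finite {k. x k > t}"
proof -
  have "bij_betw \<sigma> {k. (x \<circ> \<sigma>) k > t} {k. x k > t}"
    using bij_is_inj[OF assms] bij_is_surj[OF assms]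
    by (intro bij_betw_byWitness[where f' = "inv \<sigma>"]) (auto simp: surj_f_inv_f)
  then show "card {k. (x \<circ> \<sigma>) k > t} = card {k. x k > t}" "finite {k. (x \<circ> \<sigma>) k > t} \<longleftrightarrow> finite {k. x k > t}"
    by (auto simp: bij_betw_same_card bij_betw_finite)
qed

text \<open>Uniqueness in the definite description comes from the counts above each level, which
  every bijection preserves. Strict positivity gives each index finitely many predecessors; a zero
  entry could not be placed behind infinitely many positive ones.\<close>

lemma decr_rearrangement:
  fixes x :: "nat \<Rightarrow> real"
  assumes pos: "\<And>i. 0 < x i" and lim: "x \<longlonglongrightarrow> 0"
  shows "\<exists>\<sigma>. bij \<sigma> \<and> decr_rearrangement x = x \<circ> \<sigma>" "decseq (decr_rearrangement x)"
proof -
  obtain \<sigma> where \<sigma>: "bij \<sigma>" "decseq (x \<circ> \<sigma>)"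
    using decr_rearrangement_exists[OF assms] by blast
  have fin: "finite {k. x k > t}" if "t > 0" for t
    using LIMSEQ_zero_finite_gt[OF lim that] .
  have eq: "decr_rearrangement x = x \<circ> \<sigma>"
    unfolding decr_rearrangement_def
  proof (rule the_equality)
    fix y assume "decseq y \<and> (\<exists>\<tau>. bij \<tau> \<and> y = x \<circ> \<tau>)"
    then obtain \<tau> where \<tau>: "bij \<tau>" "decseq (x \<circ> \<tau>)" and y: "y = x \<circ> \<tau>" by auto
    show "y = x \<circ> \<sigma>"
      unfolding y
    proof (rule decseq_eqI_card)
      fix t :: real assume "t > 0"
      then show "finite {k. (x \<circ> \<tau>) k > t}" "finite {k. (x \<circ> \<sigma>) k > t}"
        "card {k. (x \<circ> \<tau>) k > t} = card {k. (x \<circ> \<sigma>) k > t}"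
        using bij_comp_card_gt[OF \<sigma>(1), of t x] bij_comp_card_gt[OF \<tau>(1), of t x] fin by auto
    qed (use \<tau> \<sigma> pos in \<open>auto intro: less_imp_le\<close>)
  qed (use \<sigma> in auto)
  show "\<exists>\<sigma>. bij \<sigma> \<and> decr_rearrangement x = x \<circ> \<sigma>"
    using eq \<sigma>(1) by blast
  show "decseq (decr_rearrangement x)"
    using eq \<sigma>(2) by simp
qed

lemma decr_rearrangement_card_gt:
  fixes x :: "nat \<Rightarrow> real"
  assumes "\<And>i. 0 < x i" "x \<longlonglongrightarrow> 0" "t > 0"
  shows "card {k. decr_rearrangement x k > t} = card {k. x k > t}" "finite {k. decr_rearrangement x k > t}"
    "0 < decr_rearrangement x k"
proof -
  obtain \<sigma> where \<sigma>: "bij \<sigma>" "decr_rearrangement x = x \<circ> \<sigma>"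
    using decr_rearrangement(1)[OF assms(1,2)] by blast
  show "card {k. decr_rearrangement x k > t} = card {k. x k > t}" "finite {k. decr_rearrangement x k > t}"
    "0 < decr_rearrangement x k"
    using bij_comp_card_gt[OF \<sigma>(1), of t x] LIMSEQ_zero_finite_gt[OF assms(2,3)] assms(1) unfolding \<sigma>(2) by auto
qed

text \<open>Prepending \<open>a\<close> raises the count above \<open>t\<close> by one exactly when
  \<open>a > t\<close>, and so does sorted insertion.\<close>

lemma decr_rearrangement_case_nat:
  fixes x :: "nat \<Rightarrow> real"
  assumes pos: "\<And>i. 0 < x i" and lim: "x \<longlonglongrightarrow> 0" and a: "0 < a"
  shows "decr_rearrangement (case_nat a x) = insert_seq a (decr_rearrangement x)"
proof (rule decseq_eqI_card)
  have pos': "0 < case_nat a x i" for i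
    using pos a by (auto split: nat.split)
  have lim': "case_nat a x \<longlonglongrightarrow> 0"
    using lim by (subst filterlim_sequentially_Suc[symmetric]) simp
  note d = decr_rearrangement(2)[OF pos lim]
  show "decseq (decr_rearrangement (case_nat a x))" "decseq (insert_seq a (decr_rearrangement x))"
    using decr_rearrangement(2)[OF pos' lim'] decseq_insert_seq[OF d] by auto
  show "0 \<le> decr_rearrangement (case_nat a x) k" for k
    using decr_rearrangement_card_gt(3)[OF pos' lim', of 1] by (simp add: less_imp_le)
  show "0 \<le> insert_seq a (decr_rearrangement x) k" for k
    using decr_rearrangement_card_gt(3)[OF pos lim, of 1] by (intro insert_seq_nonneg) (simp add: less_imp_le)
  fix t :: real assume t: "t > 0"
  note r = decr_rearrangement_card_gt[OF pos lim t] and r' = decr_rearrangement_card_gt[OF pos' lim' t]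
  show "finite {k. decr_rearrangement (case_nat a x) k > t}" by (rule r')
  show "finite {k. insert_seq a (decr_rearrangement x) k > t}"
    by (rule card_insert_seq(1)[OF d r(2)])
  have "{k. case_nat a x k > t} = (if a > t then {0} else {}) \<union> Suc ` {k. x k > t}"
  proof (rule Set.set_eqI)
    fix k show "k \<in> {k. case_nat a x k > t} \<longleftrightarrow> k \<in> (if a > t then {0} else {}) \<union> Suc ` {k. x k > t}"
      by (cases k) auto
  qed
  then have eq: "{k. case_nat a x k > t} = (if a > t then {0} else {}) \<union> Suc ` {k. x k > t}" .
  have cS: "card (Suc ` {k. x k > t}) = card {k. x k > t}"
    by (rule card_image) (rule inj_Suc)
  have fS: "finite (Suc ` {k. x k > t})"
    by (intro finite_imageI LIMSEQ_zero_finite_gt[OF lim t])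
  have "card {k. case_nat a x k > t} = card {k. x k > t} + (if a > t then 1 else 0)"
  proof (cases "a > t")
    case True
    have "card (insert 0 (Suc ` {k. x k > t})) = Suc (card {k. x k > t})"
      unfolding cS[symmetric] by (rule card_insert_disjoint[OF fS]) (rule zero_notin_Suc_image)
    then show ?thesis
      unfolding eq if_P[OF True] by (simp only: Un_insert_left Un_empty_left Suc_eq_plus1)
  next
    case False
    show ?thesis
      unfolding eq if_not_P[OF False] by (simp only: Un_empty_left cS add_0_right)
  qed
  then show "card {k. decr_rearrangement (case_nat a x) k > t} = card {k. insert_seq a (decr_rearrangement x) k > t}"
    by (metis r'(1) card_insert_seq(2)[OF d r(2)] r(1))
qed

lemma decr_rearrangement_scale:
  fixes x :: "nat \<Rightarrow> real"
  assumes pos: "\<And>i. 0 < x i" and lim: "x \<longlonglongrightarrow> 0" and c: "0 < c"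
  shows "decr_rearrangement (\<lambda>k. c * x k) = (\<lambda>k. c * decr_rearrangement x k)"
proof (rule decseq_eqI_card)
  have pos': "0 < c * x i" for i
    using pos c by auto
  have lim': "(\<lambda>k. c * x k) \<longlonglongrightarrow> 0"
    using tendsto_mult_left[OF lim, of c] by simp
  note d = decr_rearrangement(2)[OF pos lim]
  show "decseq (decr_rearrangement (\<lambda>k. c * x k))" "decseq (\<lambda>k. c * decr_rearrangement x k)"
    using decr_rearrangement(2)[OF pos' lim'] d c by (auto simp: decseq_def)
  show "0 \<le> decr_rearrangement (\<lambda>k. c * x k) k" for k
    using decr_rearrangement_card_gt(3)[OF pos' lim', of 1] by (simp add: less_imp_le)
  show "0 \<le> c * decr_rearrangement x k" for k
    using decr_rearrangement_card_gt(3)[OF pos lim, of 1] c by (simp add: less_imp_le)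
  fix t :: real assume t: "t > 0"
  have eq: "{k. c * z k > t} = {k. z k > t / c}" for z :: "nat \<Rightarrow> real"
    using c by (auto simp: field_simps)
  have "t / c > 0" using t c by simp
  note r = decr_rearrangement_card_gt[OF pos lim this] and r' = decr_rearrangement_card_gt[OF pos' lim' t]
  show "finite {k. decr_rearrangement (\<lambda>k. c * x k) k > t}" "finite {k. c * decr_rearrangement x k > t}"
    using r'(2) r(2) by (auto simp: eq)
  show "card {k. decr_rearrangement (\<lambda>k. c * x k) k > t} = card {k. c * decr_rearrangement x k > t}"
    unfolding r'(1) eq r(1) ..
qed

section \<open>The Poisson-Dirichlet law\<close>

lemma space_unif01 [simp]: "space unif01 = {0<..<1}"
  by (simp add: unif01_def space_restrict_space)

lemma measurable_unif01I [measurable (raw)]: "f \<in> borel_measurable borel \<Longrightarrow> f \<in> borel_measurable unif01"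
  unfolding unif01_def by (rule measurable_restrict_space1) simp

lemma prob_space_unif01: "prob_space unif01"
  unfolding unif01_def by (rule prob_space_restrict_space) auto

interpretation unif01: prob_space unif01
  by (rule prob_space_unif01)

interpretation unif01_seq: sequence_space unif01
  by unfold_locales

lemma nn_integral_unif01: "(\<integral>\<^sup>+u. f u \<partial>unif01) = (\<integral>\<^sup>+u. f u * indicator {0<..<1} u \<partial>lborel)"
  unfolding unif01_def by (rule nn_integral_restrict_space) auto

abbreviation unif01_stream :: "(nat \<Rightarrow> real) measure" where
  "unif01_stream \<equiv> \<Pi>\<^sub>M i\<in>(UNIV :: nat set). unif01"

lemma space_unif01_stream: "u \<in> space unif01_stream \<longleftrightarrow> (\<forall>i. 0 < u i \<and> u i < 1)"
  by (auto simp: space_PiM PiE_def Pi_def)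

lemma stick_breaking_pos: "(\<And>i. 0 < u i \<and> u i < 1) \<Longrightarrow> 0 < stick_breaking u k"
  unfolding stick_breaking_def by (intro mult_pos_pos prod_pos) auto

lemma sum_stick_breaking: "(\<Sum>k<n. stick_breaking u k) = 1 - (\<Prod>i<n. 1 - u i)"
  by (induction n) (simp_all add: stick_breaking_def algebra_simps)

lemma stick_breaking_summable:
  assumes "\<And>i. 0 < u i \<and> u i < 1"
  shows "summable (stick_breaking u)" "suminf (stick_breaking u) \<le> 1" "stick_breaking u \<longlonglongrightarrow> 0"
proof -
  have "(\<Prod>i<n. 1 - u i) \<ge> 0" for n
    using assms by (intro prod_nonneg) (auto intro: less_imp_le)
  then have le: "(\<Sum>k<n. stick_breaking u k) \<le> 1" for n
    by (simp add: sum_stick_breaking)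
  then show s: "summable (stick_breaking u)"
    using stick_breaking_pos[OF assms] by (intro summableI_nonneg_bounded) (auto intro: less_imp_le)
  then show "suminf (stick_breaking u) \<le> 1"
    using le by (intro suminf_le_const)
  show "stick_breaking u \<longlonglongrightarrow> 0"
    using s by (rule summable_LIMSEQ_zero)
qed

text \<open>Self-similarity: after the first break, the remaining stick of length
  \<open>1 - a\<close> is broken in the same way.\<close>

lemma stick_breaking_case_nat:
  "stick_breaking (case_nat a w) = case_nat a (\<lambda>k. (1 - a) * stick_breaking w k)"
proof
  fix k
  show "stick_breaking (case_nat a w) k = case_nat a (\<lambda>k. (1 - a) * stick_breaking w k) k"
    by (cases k) (simp_all add: stick_breaking_def prod.lessThan_Suc_shift del: prod.lessThan_Suc)
qed

lemma decr_rearrangement_in_seq_space: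
  assumes "\<And>i. 0 < x i" "summable x" "suminf x \<le> 1"
  shows "decr_rearrangement x \<in> seq_space"
proof -
  obtain \<sigma> where \<sigma>: "bij \<sigma>" "decr_rearrangement x = x \<circ> \<sigma>"
    using decr_rearrangement(1)[OF assms(1) summable_LIMSEQ_zero[OF assms(2)]] by blast
  have "(x has_sum suminf x) UNIV"
    using assms by (intro sums_nonneg_imp_has_sum summable_sums) (auto intro: less_imp_le)
  then have "((\<lambda>k. x (\<sigma> k)) has_sum suminf x) UNIV"
    using has_sum_reindex_bij_betw[OF \<sigma>(1), of x "suminf x"] by simp
  then have "(x \<circ> \<sigma>) summable_on UNIV" "infsum (x \<circ> \<sigma>) UNIV = suminf x"
    by (auto simp: comp_def summable_on_def infsumI)
  moreover have "decseq (x \<circ> \<sigma>)"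
    using decr_rearrangement(2)[OF assms(1) summable_LIMSEQ_zero[OF assms(2)]] \<sigma> by simp
  ultimately show ?thesis
    using assms(1,3) unfolding \<sigma>(2) seq_space_def by (auto simp: decseq_Suc_iff intro: less_imp_le)
qed

definition pd_seq :: "(nat \<Rightarrow> real) \<Rightarrow> nat \<Rightarrow> real" where
  "pd_seq u = decr_rearrangement (stick_breaking u)"

lemma pd_seq_in_seq_space: "(\<And>i. 0 < u i \<and> u i < 1) \<Longrightarrow> pd_seq u \<in> seq_space"
  unfolding pd_seq_def
  by (intro decr_rearrangement_in_seq_space stick_breaking_pos stick_breaking_summable)

lemma pd_seq_properties:
  assumes u: "\<And>i. 0 < u i \<and> u i < 1"
  shows "decseq (pd_seq u)" "0 < pd_seq u k"
    "t > 0 \<Longrightarrow> t < pd_seq u k \<longleftrightarrow> k < card {i. t < stick_breaking u i}"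
proof -
  have pos: "\<And>i. 0 < stick_breaking u i"
    by (rule stick_breaking_pos[OF u])
  note s = pos stick_breaking_summable(3)[OF u]
  note card = decr_rearrangement_card_gt[where x = "stick_breaking u", OF s]
  show d: "decseq (pd_seq u)"
    unfolding pd_seq_def by (rule decr_rearrangement(2)[where x = "stick_breaking u", OF s])
  show "0 < pd_seq u k"
    unfolding pd_seq_def by (rule card(3)[of 1]) simp
  show "t < pd_seq u k \<longleftrightarrow> k < card {i. t < stick_breaking u i}" if "t > 0"
    using decseq_gt_iff_card[OF d, of t k] card(1,2)[OF that] by (simp add: pd_seq_def)
qed

lemma pd_seq_case_nat:
  assumes a: "0 < a" "a < 1" and w: "\<And>i. 0 < w i \<and> w i < 1"
  shows "pd_seq (case_nat a w) = insert_seq a (\<lambda>k. (1 - a) * pd_seq w k)"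
proof -
  have pos: "\<And>i. 0 < stick_breaking w i"
    by (rule stick_breaking_pos[OF w])
  note s = pos stick_breaking_summable(3)[OF w]
  have "0 < (1 - a) * stick_breaking w k" for k
    using a s(1) by (intro mult_pos_pos) auto
  moreover have "(\<lambda>k. (1 - a) * stick_breaking w k) \<longlonglongrightarrow> 0"
    using tendsto_mult_left[OF s(2), of "1 - a"] by simp
  ultimately have "pd_seq (case_nat a w) = insert_seq a (decr_rearrangement (\<lambda>k. (1 - a) * stick_breaking w k))"
    unfolding pd_seq_def stick_breaking_case_nat using a by (intro decr_rearrangement_case_nat)
  also have "decr_rearrangement (\<lambda>k. (1 - a) * stick_breaking w k) = (\<lambda>k. (1 - a) * pd_seq w k)"
    unfolding pd_seq_def using a s by (intro decr_rearrangement_scale) auto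
  finally show ?thesis .
qed

lemma measurable_stick_breaking: "(\<lambda>u. stick_breaking u k) \<in> borel_measurable unif01_stream"
proof -
  have [measurable]: "(\<lambda>u. u i) \<in> borel_measurable unif01_stream" for i
    by (rule measurable_compose[OF measurable_component_singleton]) auto
  show ?thesis
    unfolding stick_breaking_def by measurable
qed

text \<open>Rearrangement is a definite description, so measurability goes through counts: for
  \<open>t > 0\<close>, entry \<open>k\<close> exceeds \<open>t\<close> iff some set of
  \<open>k + 1\<close> indices has all its sticks above \<open>t\<close>, and there are countably
  many such sets.\<close>

lemma measurable_pd_seq: "pd_seq \<in> unif01_stream \<rightarrow>\<^sub>M seq_borel"
proof (rule measurable_seq_borelI)
  show "pd_seq u \<in> seq_space" if "u \<in> space unif01_stream" for u
    using that by (intro pd_seq_in_seq_space) (simp add: space_unif01_stream)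
  show "pd_seq \<in> unif01_stream \<rightarrow>\<^sub>M real_seq"
  proof (rule measurable_PiM_single')
    fix k :: nat
    show "(\<lambda>u. pd_seq u k) \<in> borel_measurable unif01_stream"
      unfolding borel_measurable_iff_greater
    proof
      fix t :: real
      show "{u \<in> space unif01_stream. t < pd_seq u k} \<in> sets unif01_stream"
      proof (cases "t > 0")
        case t: True
        have "t < pd_seq u k \<longleftrightarrow> (\<exists>A\<in>{A. finite A \<and> card A = Suc k}. \<forall>i\<in>A. t < stick_breaking u i)"
          if "u \<in> space unif01_stream" for u
        proof -
          have u: "0 < u i \<and> u i < 1" for i using that by (simp add: space_unif01_stream)
          define X where "X = {i. t < stick_breaking u i}"
          have X: "finite X"
            unfolding X_def by (rule LIMSEQ_zero_finite_gt[OF stick_breaking_summable(3)[OF u] t])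
          have "t < pd_seq u k \<longleftrightarrow> k < card X"
            unfolding X_def by (rule pd_seq_properties(3)[OF u t])
          also have "\<dots> \<longleftrightarrow> (\<exists>A. finite A \<and> card A = Suc k \<and> A \<subseteq> X)"
          proof
            assume "k < card X"
            then obtain A where "A \<subseteq> X" "card A = Suc k"
              by (metis Suc_leI obtain_subset_with_card_n)
            then show "\<exists>A. finite A \<and> card A = Suc k \<and> A \<subseteq> X"
              using X finite_subset by blast
          next
            assume "\<exists>A. finite A \<and> card A = Suc k \<and> A \<subseteq> X"
            then show "k < card X"
              using card_mono[OF X] by (metis Suc_le_eq)
          qed
          finally show ?thesis by (auto simp: X_def)
        qed
        then have "{u \<in> space unif01_stream. t < pd_seq u k} =
          (\<Union>A\<in>{A. finite A \<and> card A = Suc k}. {u \<in> space unif01_stream. \<forall>i\<in>A. t < stick_breaking u i})"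
          by blast
        also have "\<dots> \<in> sets unif01_stream"
        proof (rule sets.countable_UN'')
          have "{A :: nat set. finite A \<and> card A = Suc k} \<subseteq> {A. finite A}" by auto
          then show "countable {A :: nat set. finite A \<and> card A = Suc k}"
            using countable_Collect_finite countable_subset by blast
          fix A :: "nat set" assume "A \<in> {A. finite A \<and> card A = Suc k}"
          then have "finite A" by simp
          then show "{u \<in> space unif01_stream. \<forall>i\<in>A. t < stick_breaking u i} \<in> sets unif01_stream"
            using measurable_stick_breaking by (intro sets.sets_Collect_finite_All) (auto simp: borel_measurable_iff_greater)
        qed
        finally show ?thesis .
      next
        case False
        have "t < pd_seq u k" if "u \<in> space unif01_stream" for u
        proof -
          have u: "0 < u i \<and> u i < 1" for i using that by (simp add: space_unif01_stream)
          show ?thesis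
            using pd_seq_properties(2)[where u = u and k = k, OF u] False by linarith
        qed
        then have "{u \<in> space unif01_stream. t < pd_seq u k} = space unif01_stream" by auto
        then show ?thesis by simp
      qed
    qed
  qed auto
qed

section \<open>The Poisson-Dirichlet law and its attenuation\<close>

lemma poisson_dirichlet_eq: "poisson_dirichlet = distr unif01_stream seq_borel pd_seq"
  by (simp add: poisson_dirichlet_def pd_seq_def[abs_def])

lemma prob_space_poisson_dirichlet: "prob_space poisson_dirichlet"
  unfolding poisson_dirichlet_eq by (rule unif01_seq.prob_space_distr[OF measurable_pd_seq])

lemma sets_poisson_dirichlet [measurable_cong, simp]: "sets poisson_dirichlet = sets seq_borel"
  by (simp add: poisson_dirichlet_def)

lemma space_poisson_dirichlet [simp]: "space poisson_dirichlet = seq_space"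
  by (simp add: poisson_dirichlet_def)

interpretation poisson_dirichlet: prob_space poisson_dirichlet
  by (rule prob_space_poisson_dirichlet)

lemma measurable_scale_seq:
  assumes [measurable]: "f \<in> borel_measurable M" "g \<in> M \<rightarrow>\<^sub>M real_seq"
  shows "(\<lambda>x k. f x * g x k) \<in> M \<rightarrow>\<^sub>M real_seq"
  by (rule measurable_PiM_single') auto

lemma measurable_seq_borel_id: "(\<lambda>x. x) \<in> seq_borel \<rightarrow>\<^sub>M real_seq"
  by (rule measurable_seq_borelD) simp

text \<open>Splitting off the first uniform variable gives the self-similarity of the law: a uniform
  point \<open>a\<close> is inserted into an independent copy scaled by
  \<open>1 - a\<close>.\<close>

lemma nn_integral_poisson_dirichlet_insert:
  assumes f: "f \<in> borel_measurable seq_borel"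
  shows "(\<integral>\<^sup>+x. f x \<partial>poisson_dirichlet) =
    (\<integral>\<^sup>+a. \<integral>\<^sup>+x. f (insert_seq a (\<lambda>k. (1 - a) * x k)) \<partial>poisson_dirichlet \<partial>unif01)"
proof -
  have [measurable]: "(\<lambda>(s, \<omega>). case_nat s \<omega>) \<in> unif01 \<Otimes>\<^sub>M unif01_stream \<rightarrow>\<^sub>M unif01_stream"
  proof (rule measurable_PiM_single')
    fix i show "(\<lambda>p. (case p of (s, \<omega>) \<Rightarrow> case_nat s \<omega>) i) \<in> unif01 \<Otimes>\<^sub>M unif01_stream \<rightarrow>\<^sub>M unif01"
      by (cases i) (simp_all add: case_prod_beta)
  qed (auto simp: space_pair_measure space_PiM PiE_def Pi_def split: nat.split)
  have fpd: "(\<lambda>u. f (pd_seq u)) \<in> borel_measurable unif01_stream"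
    using measurable_compose[OF measurable_pd_seq f] .
  have "(\<integral>\<^sup>+x. f x \<partial>poisson_dirichlet) = (\<integral>\<^sup>+u. f (pd_seq u) \<partial>unif01_stream)"
    unfolding poisson_dirichlet_eq by (rule nn_integral_distr[OF measurable_pd_seq]) (use f in simp)
  also have "\<dots> = (\<integral>\<^sup>+u. f (pd_seq u) \<partial>distr (unif01 \<Otimes>\<^sub>M unif01_stream) unif01_stream (\<lambda>(s, \<omega>). case_nat s \<omega>))"
    by (simp only: unif01_seq.PiM_iter)
  also have "\<dots> = (\<integral>\<^sup>+p. f (pd_seq (case_nat (fst p) (snd p))) \<partial>(unif01 \<Otimes>\<^sub>M unif01_stream))"
    by (subst nn_integral_distr) (use fpd in \<open>auto simp: case_prod_beta\<close>)
  also have "\<dots> = (\<integral>\<^sup>+a. \<integral>\<^sup>+w. f (pd_seq (case_nat a w)) \<partial>unif01_stream \<partial>unif01)"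
  proof (subst unif01_seq.nn_integral_fst[symmetric])
    have "(\<lambda>(s, \<omega>). f (pd_seq (case_nat s \<omega>))) \<in> borel_measurable (unif01 \<Otimes>\<^sub>M unif01_stream)"
      using measurable_compose[OF \<open>(\<lambda>(s, \<omega>). case_nat s \<omega>) \<in> _\<close> fpd] by (simp add: case_prod_beta)
    then show "(\<lambda>p. f (pd_seq (case_nat (fst p) (snd p)))) \<in> borel_measurable (unif01 \<Otimes>\<^sub>M unif01_stream)"
      by (simp add: case_prod_beta)
  qed simp
  also have "\<dots> = (\<integral>\<^sup>+a. \<integral>\<^sup>+x. f (insert_seq a (\<lambda>k. (1 - a) * x k)) \<partial>poisson_dirichlet \<partial>unif01)"
  proof (rule nn_integral_cong)
    fix a assume "a \<in> space unif01"
    then have a: "0 < a" "a < 1" by auto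
    have m: "(\<lambda>x. insert_seq a (\<lambda>k. (1 - a) * x k)) \<in> seq_borel \<rightarrow>\<^sub>M seq_borel"
    proof (rule measurable_seq_borelI)
      show "(\<lambda>x. insert_seq a (\<lambda>k. (1 - a) * x k)) \<in> seq_borel \<rightarrow>\<^sub>M real_seq"
        by (intro measurable_insert_seq measurable_scale_seq measurable_seq_borel_id) auto
    qed (use a in \<open>auto intro!: insert_seq_in_seq_space\<close>)
    have "(\<integral>\<^sup>+x. f (insert_seq a (\<lambda>k. (1 - a) * x k)) \<partial>poisson_dirichlet) =
        (\<integral>\<^sup>+w. f (insert_seq a (\<lambda>k. (1 - a) * pd_seq w k)) \<partial>unif01_stream)"
      unfolding poisson_dirichlet_eq
      by (rule nn_integral_distr[OF measurable_pd_seq]) (use measurable_compose[OF m f] in simp)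
    also have "\<dots> = (\<integral>\<^sup>+w. f (pd_seq (case_nat a w)) \<partial>unif01_stream)"
      by (intro nn_integral_cong) (simp add: pd_seq_case_nat[OF a] space_unif01_stream)
    finally show "(\<integral>\<^sup>+w. f (pd_seq (case_nat a w)) \<partial>unif01_stream) =
      (\<integral>\<^sup>+x. f (insert_seq a (\<lambda>k. (1 - a) * x k)) \<partial>poisson_dirichlet)" by simp
  qed
  finally show ?thesis .
qed

lemma measurable_attenuation:
  "(\<lambda>(u, x) k. u * x k) \<in> unif01 \<Otimes>\<^sub>M poisson_dirichlet \<rightarrow>\<^sub>M seq_borel"
proof (rule measurable_seq_borelI)
  have "(\<lambda>p. snd p) \<in> unif01 \<Otimes>\<^sub>M poisson_dirichlet \<rightarrow>\<^sub>M seq_borel"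
    by (rule measurable_compose[OF measurable_snd]) (rule measurable_ident_sets, simp)
  then have "(\<lambda>p k. fst p * snd p k) \<in> unif01 \<Otimes>\<^sub>M poisson_dirichlet \<rightarrow>\<^sub>M real_seq"
    by (intro measurable_scale_seq measurable_seq_borelD measurable_compose[OF measurable_fst] measurable_unif01I) auto
  then show "(\<lambda>(u, x) k. u * x k) \<in> unif01 \<Otimes>\<^sub>M poisson_dirichlet \<rightarrow>\<^sub>M real_seq"
    by (simp add: case_prod_beta')
  fix p assume "p \<in> space (unif01 \<Otimes>\<^sub>M poisson_dirichlet)"
  then have p: "0 \<le> fst p" "fst p \<le> 1" "snd p \<in> seq_space"
    by (auto simp: space_pair_measure)
  have "(\<Sum>k. ennreal (fst p * snd p k)) = ennreal (fst p) * (\<Sum>k. ennreal (snd p k))"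
    using p by (simp add: ennreal_mult')
  also have "\<dots> \<le> 1 * 1"
    using p by (intro mult_mono) (auto simp: seq_space_iff)
  finally show "(case p of (u, x) \<Rightarrow> \<lambda>k. u * x k) \<in> seq_space"
    using p unfolding seq_space_iff by (auto simp: decseq_def case_prod_beta intro: mult_left_mono)
qed

lemma nn_integral_attenuation:
  assumes f: "f \<in> borel_measurable seq_borel"
  shows "(\<integral>\<^sup>+z. f z \<partial>attenuation poisson_dirichlet) =
    (\<integral>\<^sup>+v. \<integral>\<^sup>+x. f (\<lambda>k. v * x k) \<partial>poisson_dirichlet \<partial>unif01)"
proof -
  have "(\<integral>\<^sup>+z. f z \<partial>attenuation poisson_dirichlet) =
    (\<integral>\<^sup>+p. f ((\<lambda>(u, x) k. u * x k) p) \<partial>(unif01 \<Otimes>\<^sub>M poisson_dirichlet))"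
    unfolding attenuation_def by (rule nn_integral_distr[OF measurable_attenuation]) (use f in simp)
  also have "\<dots> = (\<integral>\<^sup>+v. \<integral>\<^sup>+x. f ((\<lambda>(u, x) k. u * x k) (v, x)) \<partial>poisson_dirichlet \<partial>unif01)"
    by (rule poisson_dirichlet.nn_integral_fst[symmetric])
      (rule measurable_compose[OF measurable_attenuation f])
  finally show ?thesis by simp
qed

section \<open>The fixed-point equation of the attenuated law\<close>

definition attenuated_pd :: "(nat \<Rightarrow> real) measure" where
  "attenuated_pd = attenuation poisson_dirichlet"

text \<open>Quantile function of Y: uniform on the half \<open>u < 1/2\<close>, the atom at 1 on the
  other.\<close>

definition size_biased_bound :: "real \<Rightarrow> real" where
  "size_biased_bound u = min (2 * u) 1"

text \<open>Quantile function of B, inverse to the distribution function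
  \<open>1 - (1 - b)^2\<close>.\<close>

definition size_biased_part :: "real \<Rightarrow> real" where
  "size_biased_part u = 1 - sqrt (1 - u)"

lemma nn_integral_unif01_closed: 
  "(\<integral>\<^sup>+u. f u \<partial>unif01) = (\<integral>\<^sup>+u. f u * indicator {0..1} u \<partial>lborel)"
proof -
  have "AE u in lborel. u \<noteq> 0 \<and> u \<noteq> (1::real)"
    using AE_lborel_singleton[of "0::real"] AE_lborel_singleton[of "1::real"] by auto
  then show ?thesis
    unfolding nn_integral_unif01 by (intro nn_integral_cong_AE) (auto simp: indicator_def)
qed

lemma ennreal_half_mult_2: "ennreal (1/2) * 2 = 1"
proof -
  have "ennreal (1/2) * ennreal 2 = ennreal (1/2 * 2)"
    by (rule ennreal_mult [symmetric]) auto
  also have "\<dots> = 1" by simp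
  finally show ?thesis by (simp only: ennreal_numeral)
qed

lemma nn_integral_size_biased_bound:
  fixes f :: "real \<Rightarrow> ennreal"
  assumes [measurable]: "f \<in> borel_measurable borel"
  shows "(\<integral>\<^sup>+u. f (size_biased_bound u) \<partial>unif01) = ennreal (1/2) * (\<integral>\<^sup>+y. f y \<partial>unif01) + ennreal (1/2) * f 1"
proof -
  have "(\<integral>\<^sup>+u. f (size_biased_bound u) \<partial>unif01) =
      (\<integral>\<^sup>+u. f (2 * u) * indicator {0<..<1/2} u + f 1 * indicator {1/2..<1} u \<partial>lborel)"
    unfolding nn_integral_unif01
    by (intro nn_integral_cong) (auto simp: size_biased_bound_def indicator_def min_def intro!: arg_cong[where f = f])
  also have "\<dots> = (\<integral>\<^sup>+u. f (2 * u) * indicator {0<..<1/2} u \<partial>lborel) + (\<integral>\<^sup>+u. f 1 * indicator {1/2..<1::real} u \<partial>lborel)"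
    by (intro nn_integral_add) auto
  also have "(\<integral>\<^sup>+u. f 1 * indicator {1/2..<1::real} u \<partial>lborel) = ennreal (1/2) * f 1"
    by (simp add: nn_integral_cmult_indicator mult.commute)
  also have "(\<integral>\<^sup>+u. f (2 * u) * indicator {0<..<1/2} u \<partial>lborel) = ennreal (1/2) * (\<integral>\<^sup>+y. f y \<partial>unif01)"
    unfolding nn_integral_unif01
    by (subst nn_integral_real_affine[where c = "1/2" and t = 0])
      (auto intro!: arg_cong2[where f = "(*)"] nn_integral_cong simp: indicator_def)
  finally show ?thesis .
qed

lemma nn_integral_size_biased_part:
  fixes f :: "real \<Rightarrow> ennreal"
  assumes f: "f \<in> borel_measurable borel"
  shows "(\<integral>\<^sup>+u. f (size_biased_part u) \<partial>unif01) = (\<integral>\<^sup>+b. f b * ennreal (2 * (1 - b)) \<partial>unif01)"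
proof -
  have [measurable]: "size_biased_part \<in> borel_measurable borel"
    unfolding size_biased_part_def[abs_def] by measurable
  have "(\<integral>\<^sup>+u. f (size_biased_part u) \<partial>unif01) =
      (\<integral>\<^sup>+u. f (size_biased_part u) * indicator {1 - (1 - 0)\<^sup>2..1 - (1 - 1)\<^sup>2} u \<partial>lborel)"
    unfolding nn_integral_unif01_closed by simp
  also have "\<dots> = (\<integral>\<^sup>+b. f (size_biased_part (1 - (1 - b)\<^sup>2)) * ennreal (2 * (1 - b)) * indicator {0..1} b \<partial>lborel)"
    using f by (intro nn_integral_substitution_aux)
      (auto intro!: derivative_eq_intros continuous_intros measurable_compose[OF _ f])
  also have "\<dots> = (\<integral>\<^sup>+b. f b * ennreal (2 * (1 - b)) \<partial>unif01)"
    unfolding nn_integral_unif01_closed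
    by (intro nn_integral_cong) (auto simp: indicator_def size_biased_part_def)
  finally show ?thesis .
qed

lemma nn_integral_inverse_square:
  assumes "0 < w" "w < 1"
  shows "(\<integral>\<^sup>+y. (if w < y \<and> y < 1 then ennreal (1 / y\<^sup>2) else 0) \<partial>lborel) = ennreal (1 / w - 1)"
proof -
  have "(\<integral>\<^sup>+y. (if w < y \<and> y < 1 then ennreal (1 / y\<^sup>2) else 0) \<partial>lborel) = (\<integral>\<^sup>+y. ennreal (1 / y\<^sup>2) * indicator {w..1} y \<partial>lborel)"
  proof -
    have "AE u in lborel. u \<noteq> w \<and> u \<noteq> (1::real)"
      using AE_lborel_singleton[of w] AE_lborel_singleton[of "1::real"] by auto
    then show ?thesis
      by (intro nn_integral_cong_AE) (auto simp: indicator_def)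
  qed
  also have "\<dots> = ennreal ((- 1 / 1) - (- 1 / w))"
    using assms by (intro nn_integral_FTC_Icc)
      (auto intro!: derivative_eq_intros simp: power2_eq_square)
  finally show ?thesis by simp
qed

text \<open>Both pairs \<open>(V U, V (1 - U))\<close> and \<open>(Y B, Y (1 - B) V)\<close> have density \<open>1 / (x + t)\<close> on the
  triangle \<open>x + t < 1\<close>.\<close>

lemma triangle_law_identity:
  fixes F :: "real \<Rightarrow> real \<Rightarrow> ennreal"
  assumes F[measurable]: "case_prod F \<in> borel_measurable (borel \<Otimes>\<^sub>M borel)"
  shows "(\<integral>\<^sup>+v. \<integral>\<^sup>+a. F (v * a) (v * (1 - a)) \<partial>unif01 \<partial>unif01) =
    (\<integral>\<^sup>+u1. \<integral>\<^sup>+u2. \<integral>\<^sup>+v. F (size_biased_bound u1 * size_biased_part u2)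
        (size_biased_bound u1 * (1 - size_biased_part u2) * v) \<partial>unif01 \<partial>unif01 \<partial>unif01)"
proof -
  \<comment> \<open>\<open>G v\<close> integrates \<open>F\<close> along the segment
    \<open>x + t = v\<close>, and \<open>H y\<close> is the right-hand side with the bound fixed at
    \<open>y\<close>. In these terms, the integral of \<open>G v / v\<close> has to equal the mean
    of the integral of \<open>H\<close> and of \<open>H 1\<close>.\<close>
  define G where "G v = (\<integral>\<^sup>+x. (if 0 < x \<and> x < v then F x (v - x) else 0) \<partial>lborel)" for v
  define H where "H y = (\<integral>\<^sup>+u2. \<integral>\<^sup>+v. F (y * size_biased_part u2) (y * (1 - size_biased_part u2) * v) \<partial>unif01 \<partial>unif01)" for y
  have [measurable]: "size_biased_part \<in> borel_measurable borel"
    unfolding size_biased_part_def[abs_def] by measurable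
  have [measurable]: "G \<in> borel_measurable borel"
    unfolding G_def[abs_def] by measurable
  have [measurable]: "H \<in> borel_measurable borel"
    unfolding H_def[abs_def] nn_integral_unif01 by measurable
  have a: "G v = ennreal v * (\<integral>\<^sup>+a. F (v * a) (v * (1 - a)) \<partial>unif01)" if "v > 0" for v
    unfolding G_def nn_integral_unif01 using that
    by (subst nn_integral_real_affine[where c = v and t = 0])
      (auto intro!: arg_cong2[where f = "(*)"] nn_integral_cong simp: indicator_def algebra_simps zero_less_mult_iff)
  \<comment> \<open>So \<open>H y\<close> is \<open>2 / y^2\<close> times the integral of
    \<open>G\<close> over \<open>(0, y)\<close>: with \<open>x = y * b\<close> and
    \<open>w = x + y * (1 - b) * v\<close>, the density \<open>2 * (1 - b)\<close> cancels against
    the Jacobian \<open>y^2 * (1 - b)\<close>.\<close>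
  have b: "ennreal (y\<^sup>2) * H y = 2 * (\<integral>\<^sup>+w. G w * indicator {0<..<y} w \<partial>lborel)" if y: "y > 0" for y
  proof -
    define K where "K x = (\<integral>\<^sup>+w. (if 0 < x \<and> x < w \<and> w < y then F x (w - x) else 0) \<partial>lborel)" for x
    have [measurable]: "K \<in> borel_measurable borel"
      unfolding K_def[abs_def] by measurable
    define \<phi> where "\<phi> b = (\<integral>\<^sup>+v. F (y * b) (y * (1 - b) * v) \<partial>unif01)" for b
    have [measurable]: "\<phi> \<in> borel_measurable borel"
      unfolding \<phi>_def[abs_def] nn_integral_unif01 by measurable
    have \<phi>: "ennreal (y * (1 - b)) * \<phi> b = (\<integral>\<^sup>+w. (if y * b < w \<and> w < y then F (y * b) (w - y * b) else 0) \<partial>lborel)" if "b < 1" for b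
    proof -
      define c where "c = y * (1 - b)"
      have c: "c > 0" using y that by (simp add: c_def)
      have y_eq: "y = y * b + c" by (simp add: c_def algebra_simps)
      have iff: "0 < c * v \<and> y * b + c * v < y \<longleftrightarrow> 0 < v \<and> v < 1" for v
      proof -
        have "y * b + c * v < y \<longleftrightarrow> c * v < c * 1" using y_eq by linarith
        then show ?thesis using c by (auto simp: zero_less_mult_iff)
      qed
      have "(\<integral>\<^sup>+w. (if y * b < w \<and> w < y then F (y * b) (w - y * b) else 0) \<partial>lborel) =
          ennreal c * (\<integral>\<^sup>+v. (if 0 < v \<and> v < 1 then F (y * b) (c * v) else 0) \<partial>lborel)"
        using c by (subst nn_integral_real_affine[where c = c and t = "y * b"]) (auto simp: iff cong: if_cong)
      also have "\<dots> = ennreal c * \<phi> b"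
        unfolding \<phi>_def nn_integral_unif01
        by (intro arg_cong2[where f = "(*)"] nn_integral_cong) (auto simp: indicator_def c_def)
      finally show ?thesis by (simp add: c_def)
    qed
    have "ennreal (y\<^sup>2) * H y = ennreal (y\<^sup>2) * (\<integral>\<^sup>+b. \<phi> b * ennreal (2 * (1 - b)) \<partial>unif01)"
      using nn_integral_size_biased_part[of \<phi>] by (simp add: H_def \<phi>_def)
    also have "\<dots> = (\<integral>\<^sup>+b. ennreal (y\<^sup>2) * (\<phi> b * ennreal (2 * (1 - b))) \<partial>unif01)"
      by (intro nn_integral_cmult [symmetric]) auto
    also have "\<dots> = (\<integral>\<^sup>+b. ennreal (2 * y) * (\<integral>\<^sup>+w. (if y * b < w \<and> w < y then F (y * b) (w - y * b) else 0) \<partial>lborel) \<partial>unif01)"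
    proof (rule nn_integral_cong)
      fix b assume "b \<in> space unif01"
      then have b: "0 < b" "b < 1" by auto
      have "ennreal (y\<^sup>2) * (\<phi> b * ennreal (2 * (1 - b))) = (ennreal (y\<^sup>2) * ennreal (2 * (1 - b))) * \<phi> b"
        by (simp add: mult_ac)
      also have "ennreal (y\<^sup>2) * ennreal (2 * (1 - b)) = ennreal (2 * y) * ennreal (y * (1 - b))"
        using y b by (simp add: power2_eq_square mult_ac flip: ennreal_mult)
      finally show "ennreal (y\<^sup>2) * (\<phi> b * ennreal (2 * (1 - b))) =
         ennreal (2 * y) * (\<integral>\<^sup>+w. (if y * b < w \<and> w < y then F (y * b) (w - y * b) else 0) \<partial>lborel)"
        by (simp add: mult.assoc \<phi>[OF b(2)])
    qed
    also have "\<dots> = 2 * (\<integral>\<^sup>+x. K x \<partial>lborel)"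
    proof -
      have "(\<integral>\<^sup>+b. ennreal (2 * y) * (\<integral>\<^sup>+w. (if y * b < w \<and> w < y then F (y * b) (w - y * b) else 0) \<partial>lborel) \<partial>unif01)
          = (\<integral>\<^sup>+b. ennreal (2 * y) * K (y * b) \<partial>lborel)"
        unfolding nn_integral_unif01
      proof (rule nn_integral_cong)
        fix b :: real
        have "K (y * b) = 0" if "\<not> (0 < b \<and> b < 1)"
        proof -
          have "\<not> (0 < y * b \<and> y * b < w \<and> w < y)" for w
          proof
            assume *: "0 < y * b \<and> y * b < w \<and> w < y"
            then have "y * b < y" by (elim conjE) (rule less_trans)
            then have "b < 1" using mult_less_cancel_left_pos[OF y, of b 1] by (simp only: mult_1_right)
            then show False using * that y by (auto simp: zero_less_mult_iff)
          qed
          then show ?thesis by (simp only: K_def if_False nn_integral_const mult_zero_left)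
        qed
        moreover have "K (y * b) = (\<integral>\<^sup>+w. (if y * b < w \<and> w < y then F (y * b) (w - y * b) else 0) \<partial>lborel)"
          if "0 < b" using y that by (simp add: K_def)
        ultimately show "ennreal (2 * y) * (\<integral>\<^sup>+w. (if y * b < w \<and> w < y then F (y * b) (w - y * b) else 0) \<partial>lborel) * indicator {0<..<1} b
            = ennreal (2 * y) * K (y * b)"
          by (cases "0 < b \<and> b < 1") auto
      qed
      also have "\<dots> = ennreal (2 * y) * (\<integral>\<^sup>+b. K (0 + y * b) \<partial>lborel)"
        by (subst nn_integral_cmult) auto
      also have "\<dots> = 2 * (ennreal \<bar>y\<bar> * (\<integral>\<^sup>+b. K (0 + y * b) \<partial>lborel))"
        using y by (simp add: ennreal_mult mult.assoc)
      also have "\<dots> = 2 * (\<integral>\<^sup>+x. K x \<partial>lborel)"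
        using y by (subst (2) nn_integral_real_affine[where c = y and t = 0]) auto
      finally show ?thesis .
    qed
    also have "(\<integral>\<^sup>+x. K x \<partial>lborel) = (\<integral>\<^sup>+w. (\<integral>\<^sup>+x. (if 0 < x \<and> x < w \<and> w < y then F x (w - x) else 0) \<partial>lborel) \<partial>lborel)"
      unfolding K_def by (rule lborel_pair.Fubini') measurable
    also have "\<dots> = (\<integral>\<^sup>+w. G w * indicator {0<..<y} w \<partial>lborel)"
    proof (rule nn_integral_cong)
      fix w :: real
      show "(\<integral>\<^sup>+x. (if 0 < x \<and> x < w \<and> w < y then F x (w - x) else 0) \<partial>lborel) = G w * indicator {0<..<y} w"
      proof (cases "0 < w \<and> w < y")
        case True
        then show ?thesis by (simp add: G_def)
      next
        case False
        then have "\<not> (0 < x \<and> x < w \<and> w < y)" for x by auto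
        then have "(\<integral>\<^sup>+x. (if 0 < x \<and> x < w \<and> w < y then F x (w - x) else 0) \<partial>lborel) = 0"
          by (simp only: if_False nn_integral_const mult_zero_left)
        then show ?thesis using False by auto
      qed
    qed
    finally show ?thesis .
  qed
  have "(\<integral>\<^sup>+v. \<integral>\<^sup>+a. F (v * a) (v * (1 - a)) \<partial>unif01 \<partial>unif01) = (\<integral>\<^sup>+v. G v * ennreal (1 / v) \<partial>unif01)"
  proof (rule nn_integral_cong)
    fix v assume "v \<in> space unif01"
    then have v: "v > 0" by simp
    then have "ennreal v * ennreal (1 / v) = 1"
      by (simp flip: ennreal_mult)
    then show "(\<integral>\<^sup>+a. F (v * a) (v * (1 - a)) \<partial>unif01) = G v * ennreal (1 / v)"
      unfolding a[OF v] by (simp add: mult_ac) (simp add: mult.assoc[symmetric])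
  qed
  \<comment> \<open>Splitting \<open>1 / v\<close> as \<open>(1 / v - 1) + 1\<close> separates the
    two halves of Y: the first part is the integral of \<open>1 / y^2\<close> over
    \<open>(v, 1)\<close> and belongs to the uniform half, the second to the atom at 1.\<close>
  also have "\<dots> = (\<integral>\<^sup>+v. G v * ennreal (1 / v - 1) + G v \<partial>unif01)"
    by (intro nn_integral_cong) (simp add: distrib_left_numeral flip: distrib_left ennreal_plus ennreal_1, simp add: distrib_left[of "G _" _ 1, simplified, symmetric] flip: ennreal_plus ennreal_1)
  also have "\<dots> = (\<integral>\<^sup>+v. G v * ennreal (1 / v - 1) \<partial>unif01) + (\<integral>\<^sup>+v. G v \<partial>unif01)"
    by (intro nn_integral_add) auto
  also have "(\<integral>\<^sup>+v. G v \<partial>unif01) = ennreal (1/2) * H 1"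
  proof -
    have "H 1 = 2 * (\<integral>\<^sup>+v. G v \<partial>unif01)" using b[of 1] by (simp add: nn_integral_unif01)
    moreover have "ennreal (1/2) * 2 = 1" by (rule ennreal_half_mult_2)
    ultimately show ?thesis by (simp add: mult.assoc[symmetric])
  qed
  also have "(\<integral>\<^sup>+v. G v * ennreal (1 / v - 1) \<partial>unif01) = ennreal (1/2) * (\<integral>\<^sup>+y. H y \<partial>unif01)"
  proof -
    have "(\<integral>\<^sup>+v. G v * ennreal (1 / v - 1) \<partial>unif01) =
      (\<integral>\<^sup>+v. G v * (\<integral>\<^sup>+y. (if v < y \<and> y < 1 then ennreal (1 / y\<^sup>2) else 0) \<partial>lborel) \<partial>unif01)"
      by (intro nn_integral_cong) (simp add: nn_integral_inverse_square)
    also have "\<dots> = (\<integral>\<^sup>+v. \<integral>\<^sup>+y. G v * indicator {0<..<1} v * ((if v < y \<and> y < 1 then ennreal (1 / y\<^sup>2) else 0)) \<partial>lborel \<partial>lborel)"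
      unfolding nn_integral_unif01
      by (intro nn_integral_cong) (simp add: nn_integral_cmult[symmetric] mult_ac)
    also have "\<dots> = (\<integral>\<^sup>+y. \<integral>\<^sup>+v. G v * indicator {0<..<1} v * ((if v < y \<and> y < 1 then ennreal (1 / y\<^sup>2) else 0)) \<partial>lborel \<partial>lborel)"
      by (subst lborel_pair.Fubini') auto
    also have "\<dots> = (\<integral>\<^sup>+y. \<integral>\<^sup>+v. ennreal (1 / y\<^sup>2) * (G v * indicator {0<..<y} v) \<partial>lborel \<partial>unif01)"
      unfolding nn_integral_unif01
    proof (rule nn_integral_cong)
      fix y :: real
      have "(\<integral>\<^sup>+v. G v * indicator {0<..<1} v * (if v < y \<and> y < 1 then ennreal (1 / y\<^sup>2) else 0) \<partial>lborel) =
        (\<integral>\<^sup>+v. ennreal (1 / y\<^sup>2) * (G v * indicator {0<..<y} v) * indicator {0<..<1} y \<partial>lborel)"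
        by (intro nn_integral_cong) (auto simp: indicator_def mult_ac)
      also have "\<dots> = (\<integral>\<^sup>+v. ennreal (1 / y\<^sup>2) * (G v * indicator {0<..<y} v) \<partial>lborel) * indicator {0<..<1} y"
        by (intro nn_integral_multc) auto
      finally show "(\<integral>\<^sup>+v. G v * indicator {0<..<1} v * (if v < y \<and> y < 1 then ennreal (1 / y\<^sup>2) else 0) \<partial>lborel) =
        (\<integral>\<^sup>+v. ennreal (1 / y\<^sup>2) * (G v * indicator {0<..<y} v) \<partial>lborel) * indicator {0<..<1} y" .
    qed
    also have "\<dots> = (\<integral>\<^sup>+y. ennreal (1/2) * H y \<partial>unif01)"
    proof (rule nn_integral_cong)
      fix y assume "y \<in> space unif01"
      then have y: "0 < y" by simp
      have "(\<integral>\<^sup>+v. ennreal (1 / y\<^sup>2) * (G v * indicator {0<..<y} v) \<partial>lborel) = ennreal (1 / y\<^sup>2) * (\<integral>\<^sup>+v. G v * indicator {0<..<y} v \<partial>lborel)"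
        by (intro nn_integral_cmult) auto
      also have "\<dots> = ennreal (1/2) * 2 * ennreal (1 / y\<^sup>2) * (\<integral>\<^sup>+v. G v * indicator {0<..<y} v \<partial>lborel)"
      proof -
        have "ennreal (1/2) * 2 = 1" by (rule ennreal_half_mult_2)
        then show ?thesis by simp
      qed
      also have "\<dots> = ennreal (1/2) * (ennreal (1 / y\<^sup>2) * (2 * (\<integral>\<^sup>+v. G v * indicator {0<..<y} v \<partial>lborel)))"
        by (simp add: mult_ac)
      also have "\<dots> = ennreal (1/2) * (ennreal (1 / y\<^sup>2) * ennreal (y\<^sup>2) * H y)"
        by (simp add: b[OF y, symmetric] mult.assoc)
      also have "ennreal (1 / y\<^sup>2) * ennreal (y\<^sup>2) = 1"
        using y by (simp flip: ennreal_mult)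
      finally show "(\<integral>\<^sup>+v. ennreal (1 / y\<^sup>2) * (G v * indicator {0<..<y} v) \<partial>lborel) = ennreal (1/2) * H y"
        by simp
    qed
    also have "\<dots> = ennreal (1/2) * (\<integral>\<^sup>+y. H y \<partial>unif01)"
      by (intro nn_integral_cmult) auto
    finally show ?thesis .
  qed
  also have "ennreal (1/2) * (\<integral>\<^sup>+y. H y \<partial>unif01) + ennreal (1/2) * H 1 = (\<integral>\<^sup>+u1. H (size_biased_bound u1) \<partial>unif01)"
    by (rule nn_integral_size_biased_bound [symmetric]) simp
  finally show ?thesis by (simp only: H_def)
qed


lemma prob_space_attenuated_pd: "prob_space attenuated_pd"
proof -
  interpret pair_prob_space unif01 poisson_dirichlet ..
  show ?thesis
    unfolding attenuated_pd_def attenuation_def by (rule prob_space_distr[OF measurable_attenuation])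
qed

lemma sets_attenuated_pd [measurable_cong, simp]: "sets attenuated_pd = sets seq_borel"
  and space_attenuated_pd [simp]: "space attenuated_pd = seq_space"
  by (simp_all add: attenuated_pd_def attenuation_def)

lemma sets_seq_space: "seq_space \<in> sets real_seq"
proof -
  have coord: "(\<lambda>x. x i) \<in> borel_measurable real_seq" for i
    by (rule measurable_component_singleton) simp
  have "seq_space = {x \<in> space real_seq. (\<forall>i. 0 \<le> x i) \<and> (\<forall>i. x (Suc i) \<le> x i) \<and> (\<Sum>i. ennreal (x i)) \<le> 1}"
    by (auto simp: seq_space_iff decseq_Suc_iff space_PiM)
  also have "\<dots> \<in> sets real_seq"
    by (intro sets.sets_Collect_conj sets.sets_Collect_countable_All borel_measurable_le coord
        borel_measurable_const borel_measurable_suminf_order measurable_compose[OF coord measurable_ennreal])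
  finally show ?thesis .
qed

text \<open>\<open>triangle_law_identity\<close> wants an integrand on the whole plane, where
  insertion may leave \<open>seq_space\<close>; cutting off by the indicator gives a measurable
  extension.\<close>

lemma borel_measurable_extend_seq_space:
  fixes f :: "(nat \<Rightarrow> real) \<Rightarrow> ennreal"
  assumes "f \<in> borel_measurable seq_borel"
  shows "(\<lambda>x. f x * indicator seq_space x) \<in> borel_measurable real_seq"
proof -
  have "f \<in> borel_measurable (restrict_space real_seq seq_space)"
    using assms measurable_cong_sets[OF sets_seq_borel refl] by blast
  then show ?thesis
    by (subst (asm) borel_measurable_restrict_space_iff_ennreal) (use sets_seq_space in \<open>auto simp: space_PiM\<close>)
qed

text \<open>The last inequality, equivalent to \<open>sqrt (1 - u) <= 1 - u / 2\<close>, is the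
  contraction of one step: as \<open>u\<close> has mean \<open>1/2\<close>, what is left over has
  mean at most \<open>3/4\<close>.\<close>

lemma size_biased_bounds:
  assumes "0 < u" "u < 1"
  shows "0 < size_biased_bound u" "size_biased_bound u \<le> 1"
    "0 < size_biased_part u" "size_biased_part u < 1" "u / 2 \<le> size_biased_part u"
proof -
  show "0 < size_biased_bound u" "size_biased_bound u \<le> 1"
    using assms by (auto simp: size_biased_bound_def)
  show "0 < size_biased_part u" "size_biased_part u < 1"
    using assms by (auto simp: size_biased_part_def)
  have "sqrt (1 - u) \<le> sqrt ((1 - u / 2)\<^sup>2)"
    by (intro real_sqrt_le_mono) (simp add: power2_eq_square algebra_simps)
  then show "u / 2 \<le> size_biased_part u"
    using assms by (simp add: size_biased_part_def)
qed

text \<open>With V, U uniform and X Poisson-Dirichlet, the attenuated sequence is the point V U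
  inserted into V (1 - U) X. The triangle law turns the pair (V U, V (1 - U)) into (Y B, Y (1 - B)
  V), and V X is again attenuated.\<close>

lemma nn_integral_attenuated_pd_insert:
  assumes f: "f \<in> borel_measurable seq_borel"
  shows "(\<integral>\<^sup>+z. f z \<partial>attenuated_pd) =
    (\<integral>\<^sup>+u1. \<integral>\<^sup>+u2. \<integral>\<^sup>+z. f (insert_seq (size_biased_bound u1 * size_biased_part u2)
        (\<lambda>k. size_biased_bound u1 * (1 - size_biased_part u2) * z k)) \<partial>attenuated_pd \<partial>unif01 \<partial>unif01)"
proof -
  define g where "g x = f x * indicator seq_space x" for x
  have [measurable]: "g \<in> borel_measurable real_seq"
    unfolding g_def[abs_def] by (rule borel_measurable_extend_seq_space[OF f])
  have gf: "g x = f x" if "x \<in> seq_space" for x using that by (simp add: g_def)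
  define F where "F x t = (\<integral>\<^sup>+p. g (insert_seq x (\<lambda>k. t * p k)) \<partial>poisson_dirichlet)" for x t
  have id: "(\<lambda>x. x) \<in> poisson_dirichlet \<rightarrow>\<^sub>M real_seq"
    using measurable_seq_borel_id measurable_cong_sets[OF sets_poisson_dirichlet refl] by blast
  have [measurable]: "case_prod F \<in> borel_measurable (borel \<Otimes>\<^sub>M borel)"
  proof -
    have "(\<lambda>(q, p). g (insert_seq (fst q) (\<lambda>k. snd q * p k))) \<in> borel_measurable ((borel \<Otimes>\<^sub>M borel) \<Otimes>\<^sub>M poisson_dirichlet)"
      unfolding case_prod_beta
      by (intro measurable_compose[OF _ \<open>g \<in> _\<close>] measurable_insert_seq measurable_scale_seq measurable_compose[OF measurable_snd id]) auto
    then have "(\<lambda>q. \<integral>\<^sup>+p. g (insert_seq (fst q) (\<lambda>k. snd q * p k)) \<partial>poisson_dirichlet) \<in> borel_measurable (borel \<Otimes>\<^sub>M borel)"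
      by (intro poisson_dirichlet.borel_measurable_nn_integral)
    then show ?thesis
      unfolding F_def[abs_def] by (simp add: case_prod_beta')
  qed
  have scale_m: "(\<lambda>x. f (\<lambda>k. v * x k)) \<in> borel_measurable seq_borel" if "0 < v" "v < 1" for v
  proof -
    have "(\<lambda>x. (v, x)) \<in> seq_borel \<rightarrow>\<^sub>M unif01 \<Otimes>\<^sub>M poisson_dirichlet"
      using that by (intro measurable_Pair measurable_const measurable_ident_sets) auto
    from measurable_compose[OF this measurable_compose[OF measurable_attenuation f]] show ?thesis by simp
  qed
  have "(\<integral>\<^sup>+z. f z \<partial>attenuated_pd) = (\<integral>\<^sup>+v. \<integral>\<^sup>+x. f (\<lambda>k. v * x k) \<partial>poisson_dirichlet \<partial>unif01)"
    unfolding attenuated_pd_def by (rule nn_integral_attenuation[OF f])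
  also have "\<dots> = (\<integral>\<^sup>+v. \<integral>\<^sup>+a. F (v * a) (v * (1 - a)) \<partial>unif01 \<partial>unif01)"
  proof (rule nn_integral_cong)
    fix v assume "v \<in> space unif01"
    then have v: "0 < v" "v < 1" by auto
    have "(\<integral>\<^sup>+x. f (\<lambda>k. v * x k) \<partial>poisson_dirichlet) =
       (\<integral>\<^sup>+a. \<integral>\<^sup>+x. f (\<lambda>k. v * insert_seq a (\<lambda>k. (1 - a) * x k) k) \<partial>poisson_dirichlet \<partial>unif01)"
      by (rule nn_integral_poisson_dirichlet_insert[OF scale_m[OF v]])
    also have "\<dots> = (\<integral>\<^sup>+a. F (v * a) (v * (1 - a)) \<partial>unif01)"
      unfolding F_def
    proof (intro nn_integral_cong)
      fix a x assume "a \<in> space unif01" "x \<in> space poisson_dirichlet"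
      then have a: "0 < a" "a < 1" and x: "x \<in> seq_space" by auto
      have eq: "(\<lambda>k. v * insert_seq a (\<lambda>k. (1 - a) * x k) k) = insert_seq (v * a) (\<lambda>k. v * (1 - a) * x k)"
        using insert_seq_scale[of v a "\<lambda>k. (1 - a) * x k"] v by (simp add: mult.assoc)
      have "v * a + v * (1 - a) \<le> 1" using v by (simp add: algebra_simps)
      then have "insert_seq (v * a) (\<lambda>k. v * (1 - a) * x k) \<in> seq_space"
        using v a by (intro insert_seq_in_seq_space x) auto
      then show "f (\<lambda>k. v * insert_seq a (\<lambda>k. (1 - a) * x k) k) = g (insert_seq (v * a) (\<lambda>k. v * (1 - a) * x k))"
        by (simp add: gf eq)
    qed
    finally show "(\<integral>\<^sup>+x. f (\<lambda>k. v * x k) \<partial>poisson_dirichlet) = (\<integral>\<^sup>+a. F (v * a) (v * (1 - a)) \<partial>unif01)" .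
  qed
  also have "\<dots> = (\<integral>\<^sup>+u1. \<integral>\<^sup>+u2. \<integral>\<^sup>+v. F (size_biased_bound u1 * size_biased_part u2)
        (size_biased_bound u1 * (1 - size_biased_part u2) * v) \<partial>unif01 \<partial>unif01 \<partial>unif01)"
    by (rule triangle_law_identity) measurable
  also have "\<dots> = (\<integral>\<^sup>+u1. \<integral>\<^sup>+u2. \<integral>\<^sup>+z. f (insert_seq (size_biased_bound u1 * size_biased_part u2)
        (\<lambda>k. size_biased_bound u1 * (1 - size_biased_part u2) * z k)) \<partial>attenuated_pd \<partial>unif01 \<partial>unif01)"
  proof (intro nn_integral_cong)
    fix u1 u2 assume "u1 \<in> space unif01" "u2 \<in> space unif01"
    then have u: "0 < u1" "u1 < 1" "0 < u2" "u2 < 1" by auto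
    define x t where "x = size_biased_bound u1 * size_biased_part u2"
      and "t = size_biased_bound u1 * (1 - size_biased_part u2)"
    note b = size_biased_bounds[OF u(1,2)] size_biased_bounds[OF u(3,4)]
    have xt: "0 \<le> x" "0 \<le> t" "x + t \<le> 1"
      using b by (auto simp: x_def t_def algebra_simps)
    have ins: "insert_seq x (\<lambda>k. t * z k) \<in> seq_space" if "z \<in> seq_space" for z
      using that xt by (rule insert_seq_in_seq_space)
    have m: "(\<lambda>z. f (insert_seq x (\<lambda>k. t * z k))) \<in> borel_measurable seq_borel"
    proof (rule measurable_compose[OF _ f])
      show "(\<lambda>z. insert_seq x (\<lambda>k. t * z k)) \<in> seq_borel \<rightarrow>\<^sub>M seq_borel"
        using ins by (intro measurable_seq_borelI measurable_insert_seq measurable_scale_seq measurable_seq_borel_id) auto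
    qed
    have "(\<integral>\<^sup>+z. f (insert_seq x (\<lambda>k. t * z k)) \<partial>attenuated_pd) =
       (\<integral>\<^sup>+v. \<integral>\<^sup>+p. f (insert_seq x (\<lambda>k. t * (v * p k))) \<partial>poisson_dirichlet \<partial>unif01)"
      unfolding attenuated_pd_def by (rule nn_integral_attenuation[OF m])
    also have "\<dots> = (\<integral>\<^sup>+v. F x (t * v) \<partial>unif01)"
      unfolding F_def
    proof (intro nn_integral_cong)
      fix v p assume "v \<in> space unif01" "p \<in> space poisson_dirichlet"
      then have vp: "0 < v" "v < 1" "p \<in> seq_space" by auto
      have "t * v \<le> t" using vp xt by (simp add: mult_left_le)
      then have "insert_seq x (\<lambda>k. (t * v) * p k) \<in> seq_space"
        using vp xt by (intro insert_seq_in_seq_space) auto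
      then show "f (insert_seq x (\<lambda>k. t * (v * p k))) = g (insert_seq x (\<lambda>k. t * v * p k))"
        by (simp add: gf mult.assoc)
    qed
    finally show "(\<integral>\<^sup>+v. F (size_biased_bound u1 * size_biased_part u2) (size_biased_bound u1 * (1 - size_biased_part u2) * v) \<partial>unif01) =
        (\<integral>\<^sup>+z. f (insert_seq (size_biased_bound u1 * size_biased_part u2)
        (\<lambda>k. size_biased_bound u1 * (1 - size_biased_part u2) * z k)) \<partial>attenuated_pd)"
      by (simp add: x_def t_def)
  qed
  finally show ?thesis .
qed

section \<open>Quantile couplings\<close>

definition quantile :: "(nat \<Rightarrow> real) \<Rightarrow> real \<Rightarrow> nat" where
  "quantile c u = (LEAST j. u \<le> c j)"

lemma measurable_quantile [measurable]: "quantile c \<in> borel \<rightarrow>\<^sub>M count_space UNIV"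
  unfolding quantile_def[abs_def] by measurable

lemma quantile_le_iff:
  assumes "mono c" "c n = 1" "u < 1"
  shows "quantile c u \<le> j \<longleftrightarrow> u \<le> c j"
proof
  have ex: "u \<le> c (quantile c u)"
    unfolding quantile_def by (rule LeastI[of _ n]) (use assms in simp)
  assume "quantile c u \<le> j"
  then show "u \<le> c j"
    using ex monoD[OF assms(1)] order.trans by blast
qed (simp add: quantile_def Least_le)

lemma quantile_bounds:
  assumes "mono c" "c 0 = 0" "c n = 1" "0 < u" "u < 1"
  shows "1 \<le> quantile c u" "quantile c u \<le> n"
  using quantile_le_iff[OF assms(1,3,5), of 0] quantile_le_iff[OF assms(1,3,5), of n] assms by auto

lemma nn_integral_quantile:
  fixes \<phi> :: "nat \<Rightarrow> ennreal"
  assumes c: "mono c" "c 0 = 0" "c n = 1"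
  shows "(\<integral>\<^sup>+u. \<phi> (quantile c u) \<partial>unif01) = (\<Sum>j=1..n. ennreal (c j - c (j - 1)) * \<phi> j)"
proof -
  have "(\<integral>\<^sup>+u. \<phi> (quantile c u) \<partial>unif01) = (\<integral>\<^sup>+u. (\<Sum>j=1..n. \<phi> j * indicator {c (j - 1)<..c j} u) \<partial>unif01)"
  proof (rule nn_integral_cong)
    fix u assume "u \<in> space unif01"
    then have u: "0 < u" "u < 1" by auto
    note q = quantile_bounds[OF c u]
    \<comment> \<open>The quantile equals \<open>j\<close> exactly on the cell between consecutive
      values of \<open>c\<close>, so \<open>j\<close> is taken with probability
      \<open>c j - c (j - 1)\<close>.\<close>
    have iff: "u \<in> {c (j - 1)<..c j} \<longleftrightarrow> j = quantile c u" if "1 \<le> j" for j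
      using quantile_le_iff[OF c(1,3) u(2), of j] quantile_le_iff[OF c(1,3) u(2), of "j - 1"] that by auto
    have "(\<Sum>j=1..n. \<phi> j * indicator {c (j - 1)<..c j} u) = (\<Sum>j=1..n. if j = quantile c u then \<phi> j else 0)"
    proof (intro sum.cong refl)
      fix j assume "j \<in> {1..n}"
      then show "\<phi> j * indicator {c (j - 1)<..c j} u = (if j = quantile c u then \<phi> j else 0)"
        using iff[of j] by (simp add: indicator_def del: greaterThanAtMost_iff)
    qed
    also have "\<dots> = \<phi> (quantile c u)"
      using q by simp
    finally show "\<phi> (quantile c u) = (\<Sum>j=1..n. \<phi> j * indicator {c (j - 1)<..c j} u)" by simp
  qed
  also have "\<dots> = (\<Sum>j=1..n. \<phi> j * (\<integral>\<^sup>+u. indicator {c (j - 1)<..c j} u \<partial>unif01))"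
    by (subst nn_integral_sum) (auto intro!: sum.cong nn_integral_cmult)
  also have "\<dots> = (\<Sum>j=1..n. ennreal (c j - c (j - 1)) * \<phi> j)"
  proof (intro sum.cong refl)
    fix j assume j: "j \<in> {1..n}"
    have le: "0 \<le> c (j - 1)" "c (j - 1) \<le> c j" "c j \<le> 1"
      using monoD[OF c(1), of 0 "j - 1"] monoD[OF c(1), of "j - 1" j] monoD[OF c(1), of j n] c j by auto
    have "(\<integral>\<^sup>+u. indicator {c (j - 1)<..c j} u \<partial>unif01) = (\<integral>\<^sup>+u. indicator {c (j - 1)<..c j} u \<partial>lborel)"
      unfolding nn_integral_unif01_closed using le by (intro nn_integral_cong) (auto simp: indicator_def)
    also have "\<dots> = ennreal (c j - c (j - 1))"
      using le by simp
    finally show "\<phi> j * (\<integral>\<^sup>+u. indicator {c (j - 1)<..c j} u \<partial>unif01) = ennreal (c j - c (j - 1)) * \<phi> j"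
      by (simp add: mult.commute)
  qed
  finally show ?thesis .
qed

text \<open>\<open>|X u - Y u|\<close> is the length of the set of levels \<open>t\<close> between
  the two values. After exchanging the integrals, the \<open>u\<close> contributing at level
  \<open>t\<close> lie between \<open>F t\<close> and \<open>G t\<close>. Only levels
  \<open>t < L\<close> enter, so an atom at \<open>L\<close> does no harm.\<close>

lemma quantile_coupling_cost:
  fixes X Y F G :: "real \<Rightarrow> real"
  assumes [measurable]: "X \<in> borel_measurable borel" "Y \<in> borel_measurable borel"
    and X: "\<And>u. 0 < u \<Longrightarrow> u < 1 \<Longrightarrow> 0 \<le> X u \<and> X u \<le> L"
    and Y: "\<And>u. 0 < u \<Longrightarrow> u < 1 \<Longrightarrow> 0 \<le> Y u \<and> Y u \<le> L"
    and F: "\<And>u t. 0 < u \<Longrightarrow> u < 1 \<Longrightarrow> 0 \<le> t \<Longrightarrow> t < L \<Longrightarrow> X u \<le> t \<longleftrightarrow> u \<le> F t"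
    and G: "\<And>u t. 0 < u \<Longrightarrow> u < 1 \<Longrightarrow> 0 \<le> t \<Longrightarrow> t < L \<Longrightarrow> Y u \<le> t \<longleftrightarrow> u \<le> G t"
    and e: "\<And>t. 0 \<le> t \<Longrightarrow> t < L \<Longrightarrow> \<bar>F t - G t\<bar> \<le> e"
    and L: "0 \<le> L"
  shows "(\<integral>\<^sup>+u. ennreal \<bar>X u - Y u\<bar> \<partial>unif01) \<le> ennreal (L * e)"
proof -
  define A :: "real \<Rightarrow> real \<Rightarrow> ennreal" where
    "A u t = (if 0 \<le> t \<and> t < L \<and> (X u \<le> t \<and> t < Y u \<or> Y u \<le> t \<and> t < X u) then 1 else 0)" for u t
  have [measurable]: "X \<in> borel_measurable unif01" "Y \<in> borel_measurable unif01"
    by (intro measurable_unif01I assms(1,2))+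
  have [measurable]: "case_prod A \<in> borel_measurable (unif01 \<Otimes>\<^sub>M lborel)"
    unfolding A_def[abs_def] by measurable
  interpret pair_sigma_finite unif01 lborel ..
  have "(\<integral>\<^sup>+u. ennreal \<bar>X u - Y u\<bar> \<partial>unif01) = (\<integral>\<^sup>+u. \<integral>\<^sup>+t. A u t \<partial>lborel \<partial>unif01)"
  proof (rule nn_integral_cong)
    fix u assume "u \<in> space unif01"
    then have u: "0 < u" "u < 1" by auto
    have "(\<integral>\<^sup>+t. A u t \<partial>lborel) = (\<integral>\<^sup>+t. indicator {min (X u) (Y u)..<max (X u) (Y u)} t \<partial>lborel)"
      using X[OF u] Y[OF u] by (intro nn_integral_cong) (auto simp: A_def indicator_def)
    also have "\<dots> = ennreal (max (X u) (Y u) - min (X u) (Y u))"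
      by simp
    also have "max (X u) (Y u) - min (X u) (Y u) = \<bar>X u - Y u\<bar>" by simp
    finally show "ennreal \<bar>X u - Y u\<bar> = (\<integral>\<^sup>+t. A u t \<partial>lborel)" by simp
  qed
  also have "\<dots> = (\<integral>\<^sup>+t. \<integral>\<^sup>+u. A u t \<partial>unif01 \<partial>lborel)"
    by (rule Fubini'[symmetric]) measurable
  also have "\<dots> \<le> (\<integral>\<^sup>+t. ennreal e * indicator {0..<L} t \<partial>lborel)"
  proof (rule nn_integral_mono)
    fix t :: real
    show "(\<integral>\<^sup>+u. A u t \<partial>unif01) \<le> ennreal e * indicator {0..<L} t"
    proof (cases "0 \<le> t \<and> t < L")
      case True
      then have t: "0 \<le> t" "t < L" by auto
      have "(\<integral>\<^sup>+u. A u t \<partial>unif01) \<le> (\<integral>\<^sup>+u. indicator {min (F t) (G t)<..max (F t) (G t)} u \<partial>lborel)"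
        unfolding nn_integral_unif01
      proof (rule nn_integral_mono)
        fix u :: real
        show "A u t * indicator {0<..<1} u \<le> indicator {min (F t) (G t)<..max (F t) (G t)} u"
          using F[of u t] G[of u t] t by (auto simp: A_def indicator_def)
      qed
      also have "\<dots> = ennreal (max (F t) (G t) - min (F t) (G t))" by simp
      also have "max (F t) (G t) - min (F t) (G t) = \<bar>F t - G t\<bar>" by simp
      also have "ennreal \<bar>F t - G t\<bar> \<le> ennreal e" by (rule ennreal_leI[OF e[OF t]])
      finally show ?thesis using True by simp
    next
      case False
      then have "A u t = 0" for u by (auto simp: A_def)
      then show ?thesis by simp
    qed
  qed
  also have "\<dots> = ennreal e * ennreal L"
    using L by (subst nn_integral_cmult_indicator) auto
  also have "\<dots> = ennreal (L * e)"
    using L by (simp add: ennreal_mult' mult.commute)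
  finally show ?thesis .
qed

lemma ln_le_iff_nat_floor:
  assumes "j \<ge> 1"
  shows "ln (real j) \<le> t \<longleftrightarrow> j \<le> nat \<lfloor>exp t\<rfloor>"
proof -
  have "ln (real j) \<le> t \<longleftrightarrow> real j \<le> exp t"
    using assms ln_le_cancel_iff[of "real j" "exp t"] by simp
  also have "\<dots> \<longleftrightarrow> j \<le> nat \<lfloor>exp t\<rfloor>"
    using assms by (simp add: le_nat_iff le_floor_iff)
  finally show ?thesis .
qed

lemma nat_floor_exp_bounds:
  assumes "0 \<le> t"
  shows "1 \<le> nat \<lfloor>exp t\<rfloor>" "ln (real (nat \<lfloor>exp t\<rfloor>)) \<le> t" "t \<le> ln (real (nat \<lfloor>exp t\<rfloor>)) + 1"
  using ln_floor_bounds[of "exp t"] assms by auto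

lemma nat_floor_exp_less:
  assumes "t < ln (real n)" "n > 0"
  shows "nat \<lfloor>exp t\<rfloor> < n"
proof -
  have "exp t < exp (ln (real n))" using assms(1) by simp
  then have "exp t < real n" using assms(2) by simp
  then have "\<lfloor>exp t\<rfloor> < int n" by (simp add: floor_less_iff)
  then show ?thesis using assms(2) by linarith
qed

section \<open>Splitting a harmonic sample\<close>

lemma harm_eq_0_iff [simp]: "harm n = (0 :: real) \<longleftrightarrow> n = 0"
  using harm_pos_iff[of n, where 'a = real] by (cases "n = 0") (auto simp: harm_def)

lemma ennreal_mult_collect:
  assumes "a * b = c" "0 \<le> a" "0 \<le> b"
  shows "ennreal a * (ennreal b * x) = ennreal c * x"
  using assms by (auto simp: ennreal_mult mult.assoc)

lemma sum_atLeast1_split: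
  fixes f :: "nat \<Rightarrow> 'a :: comm_monoid_add"
  shows "k \<ge> 1 \<Longrightarrow> (\<Sum>h=1..k. f h) = f 1 + (\<Sum>h=2..k. f h)"
  using sum.atLeast_Suc_atMost[of 1 k f] by (simp add: numeral_2_eq_2)

lemma divisor_cdf_diff:
  assumes "d \<ge> 1"
  shows "divisor_cdf k d - divisor_cdf k (d - 1) = mangoldt d / real d * harm (k div d) / log_harm k"
proof -
  obtain e where "d = Suc e" using assms by (cases d) auto
  then show ?thesis by (simp add: divisor_cdf_def add_divide_distrib)
qed

lemma divisor_cdf_props:
  assumes "k \<ge> 2"
  shows "mono (divisor_cdf k)" "divisor_cdf k 0 = 0" "divisor_cdf k k = 1"
proof -
  have "divisor_cdf k d \<le> divisor_cdf k (Suc d)" for d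
    using divisor_cdf_diff[of "Suc d" k] mangoldt_nonneg[of "Suc d"] log_harm_nonneg[of k]
      harm_nonneg[of "k div Suc d", where 'a = real]
    by (simp add: algebra_simps)
  then show "mono (divisor_cdf k)"
    by (simp add: mono_iff_le_Suc)
  show "divisor_cdf k 0 = 0" by (simp add: divisor_cdf_def)
  show "divisor_cdf k k = 1"
    using log_harm_pos[OF assms] by (simp only: divisor_cdf_def log_harm_conv_mangoldt[symmetric]) simp
qed

text \<open>The weights are made for their tail sums: from \<open>h\<close> to \<open>n\<close> they
  telescope to \<open>1 / ln h\<close>, the factor that turns \<open>ln h / h\<close> into
  \<open>1 / h\<close>.\<close>

definition bound_weight :: "nat \<Rightarrow> nat \<Rightarrow> real" where
  "bound_weight n j = (if j < n then 1 / ln (real j) - 1 / ln (real (Suc j)) else 1 / ln (real n))"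

text \<open>The number 1 has weight \<open>ln 1 = 0\<close> in the size-biased samples with
  \<open>k >= 2\<close>, so it is produced by the bound 1 alone, which takes its full mass
  \<open>1 / harm n\<close>.\<close>

lemma bound_cdf_diff:
  assumes "n \<ge> 2"
  shows "bound_cdf n 1 - bound_cdf n 0 = 1 / harm n"
    "2 \<le> j \<Longrightarrow> j \<le> n \<Longrightarrow> bound_cdf n j - bound_cdf n (j - 1) = log_harm j * bound_weight n j / harm n"
proof -
  have h: "harm n > (0::real)" using assms by simp
  show "bound_cdf n 1 - bound_cdf n 0 = 1 / harm n"
    using assms by (simp add: bound_cdf_def harm_def log_harm_def)
  assume j: "2 \<le> j" "j \<le> n"
  then obtain i where i: "j = Suc i" "i \<ge> 1" by (cases j) auto
  define a where "a = ln (real j)"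
  have a: "a > 0" using j by (simp add: a_def)
  \<comment> \<open>Both terms gain \<open>1 / j\<close> on passing from \<open>i\<close> to
    \<open>j\<close>, because \<open>a = ln j\<close>. Consecutive values of
    \<open>bound_cdf\<close> are thus expressed by the same \<open>harm j\<close> and
    \<open>log_harm j\<close>.\<close>
  have "harm i - log_harm i / a = harm j - log_harm j / a"
    using a by (simp add: i harm_Suc log_harm_Suc inverse_eq_divide add_divide_distrib a_def[unfolded i])
  then have 1: "bound_cdf n (j - 1) = (harm j - log_harm j / a) / harm n"
    using j i by (simp add: bound_cdf_def a_def)
  show "bound_cdf n j - bound_cdf n (j - 1) = log_harm j * bound_weight n j / harm n"
  proof (cases "j < n")
    case True
    then show ?thesis
      unfolding 1 by (simp add: bound_cdf_def bound_weight_def a_def right_diff_distrib diff_divide_distrib)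
  next
    case False
    then have "j = n" using j by simp
    then show ?thesis
      unfolding 1 using h by (simp add: bound_cdf_def bound_weight_def a_def diff_divide_distrib)
  qed
qed

lemma bound_weight_nonneg: "2 \<le> j \<Longrightarrow> j \<le> n \<Longrightarrow> 0 \<le> bound_weight n j"
  unfolding bound_weight_def by (auto intro!: divide_left_mono mult_pos_pos)

lemma sum_bound_weight:
  assumes "2 \<le> h" "h \<le> n"
  shows "(\<Sum>k=h..n. bound_weight n k) = 1 / ln (real h)"
proof -
  have "(\<Sum>k=h..n. bound_weight n k) = (\<Sum>k=h..<n. bound_weight n k) + bound_weight n n"
    using assms by (subst sum.last_plus) (auto simp: atLeastLessThanSuc_atLeastAtMost add.commute)
  also have "(\<Sum>k=h..<n. bound_weight n k) = (\<Sum>k=h..<n. - 1 / ln (real (Suc k)) - (- 1 / ln (real k)))"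
    by (intro sum.cong) (auto simp: bound_weight_def)
  also have "\<dots> = - 1 / ln (real n) - (- 1 / ln (real h))"
    using assms by (subst sum_Suc_diff') auto
  finally show ?thesis by (simp add: bound_weight_def)
qed

lemma bound_cdf_props:
  assumes "n \<ge> 2"
  shows "mono (bound_cdf n)" "bound_cdf n 0 = 0" "bound_cdf n n = 1"
proof -
  have "bound_cdf n j \<le> bound_cdf n (Suc j)" for j
  proof -
    consider "j = 0" | "1 \<le> j" "Suc j \<le> n" | "n \<le> j" by linarith
    then show ?thesis
    proof cases
      case 1
      then show ?thesis
        using bound_cdf_diff(1)[OF assms] harm_nonneg[of n, where 'a = real]
        by (metis One_nat_def diff_ge_0_iff_ge divide_nonneg_nonneg zero_le_one)
    next
      case 2
      have "0 \<le> log_harm (Suc j) * bound_weight n (Suc j) / harm n"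
        using 2 by (intro divide_nonneg_nonneg mult_nonneg_nonneg log_harm_nonneg bound_weight_nonneg harm_nonneg) auto
      then show ?thesis
        using bound_cdf_diff(2)[OF assms, of "Suc j"] 2 by simp
    next
      case 3
      then show ?thesis by (simp add: bound_cdf_def)
    qed
  qed
  then show "mono (bound_cdf n)" by (simp add: mono_iff_le_Suc)
  show "bound_cdf n 0 = 0" using assms by (simp add: bound_cdf_def log_harm_def harm_def)
  show "bound_cdf n n = 1" by (simp add: bound_cdf_def)
qed

section \<open>Samples driven by uniform variables, and their distance to the limit\<close>

definition bound_sample :: "nat \<Rightarrow> real \<Rightarrow> nat" where
  "bound_sample n = quantile (bound_cdf n)"

text \<open>For \<open>k = 1\<close> the distribution function degenerates to 0 since
  \<open>log_harm 1 = 0\<close>; the only divisor is then put in by hand.\<close>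

definition divisor_sample :: "nat \<Rightarrow> real \<Rightarrow> nat" where
  "divisor_sample k u = (if k \<le> 1 then 1 else quantile (divisor_cdf k) u)"

lemma measurable_samples [measurable]:
  "bound_sample n \<in> borel \<rightarrow>\<^sub>M count_space UNIV"
  "divisor_sample k \<in> borel \<rightarrow>\<^sub>M count_space UNIV"
  unfolding bound_sample_def divisor_sample_def[abs_def] by measurable

lemma bound_sample_bounds:
  assumes "n \<ge> 2" "0 < u" "u < 1"
  shows "1 \<le> bound_sample n u" "bound_sample n u \<le> n"
  unfolding bound_sample_def using quantile_bounds[OF bound_cdf_props[OF assms(1)] assms(2,3)] by auto

lemma divisor_sample_bounds:
  assumes "k \<ge> 1" "0 < u" "u < 1"
  shows "1 \<le> divisor_sample k u" "divisor_sample k u \<le> k"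
  unfolding divisor_sample_def using quantile_bounds[OF divisor_cdf_props[of k] assms(2,3)] assms(1) by auto

text \<open>A uniform error O(1 / L) between distribution functions, integrated over the levels in
  \<open>[0, L]\<close>, costs O(1) whatever \<open>n\<close> is. The real level \<open>t\<close>
  corresponds to the integer part of \<open>exp t\<close>.\<close>

lemma bound_sample_cost:
  assumes n: "n \<ge> 2"
  shows "(\<integral>\<^sup>+u. ennreal \<bar>ln (real (bound_sample n u)) - ln (real n) * size_biased_bound u\<bar> \<partial>unif01) \<le> ennreal 20"
proof -
  define L where "L = ln (real n)"
  have L: "L > 0" using n by (simp add: L_def)
  have "(\<integral>\<^sup>+u. ennreal \<bar>ln (real (bound_sample n u)) - L * size_biased_bound u\<bar> \<partial>unif01) \<le> ennreal (L * (20 / L))"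
  proof (rule quantile_coupling_cost[where F = "\<lambda>t. bound_cdf n (nat \<lfloor>exp t\<rfloor>)" and G = "\<lambda>t. t / (2 * L)"])
    show "(\<lambda>u. ln (real (bound_sample n u))) \<in> borel_measurable borel" by measurable
    show "(\<lambda>u. L * size_biased_bound u) \<in> borel_measurable borel"
      unfolding size_biased_bound_def by measurable
    fix u :: real assume u: "0 < u" "u < 1"
    note b = bound_sample_bounds[OF n u]
    show "0 \<le> ln (real (bound_sample n u)) \<and> ln (real (bound_sample n u)) \<le> L"
      using b by (auto simp: L_def)
    show "0 \<le> L * size_biased_bound u \<and> L * size_biased_bound u \<le> L"
      using L size_biased_bounds(1,2)[OF u] by (auto simp: mult_left_le less_imp_le)
    fix t assume t: "0 \<le> t" "t < L"
    show "ln (real (bound_sample n u)) \<le> t \<longleftrightarrow> u \<le> bound_cdf n (nat \<lfloor>exp t\<rfloor>)"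
      unfolding ln_le_iff_nat_floor[OF b(1)] unfolding bound_sample_def
      by (rule quantile_le_iff[OF bound_cdf_props(1,3)[OF n] u(2)])
    have "size_biased_bound u \<le> t / L \<longleftrightarrow> 2 * u \<le> t / L"
      using t L by (auto simp: size_biased_bound_def min_le_iff_disj)
    then show "L * size_biased_bound u \<le> t \<longleftrightarrow> u \<le> t / (2 * L)"
      using L by (simp add: field_simps)
  next
    fix t assume t: "0 \<le> t" "t < L"
    show "\<bar>bound_cdf n (nat \<lfloor>exp t\<rfloor>) - t / (2 * L)\<bar> \<le> 20 / L"
      unfolding L_def using t n nat_floor_exp_bounds[OF t(1)] nat_floor_exp_less[of t n]
      by (intro bound_cdf_approx) (auto simp: L_def)
  qed (use L in auto)
  then show ?thesis using L by (simp add: L_def)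
qed

lemma divisor_sample_cost:
  assumes k: "k \<ge> 1"
  shows "(\<integral>\<^sup>+u. ennreal \<bar>ln (real (divisor_sample k u)) - ln (real k) * size_biased_part u\<bar> \<partial>unif01) \<le> ennreal 128"
proof (cases "k = 1")
  case False
  with k have k: "k \<ge> 2" by simp
  define L where "L = ln (real k)"
  have L: "L > 0" using k by (simp add: L_def)
  have "(\<integral>\<^sup>+u. ennreal \<bar>ln (real (divisor_sample k u)) - L * size_biased_part u\<bar> \<partial>unif01) \<le> ennreal (L * (128 / L))"
  proof (rule quantile_coupling_cost[where F = "\<lambda>t. divisor_cdf k (nat \<lfloor>exp t\<rfloor>)" and G = "\<lambda>t. 1 - (1 - t / L)\<^sup>2"])
    show "(\<lambda>u. ln (real (divisor_sample k u))) \<in> borel_measurable borel" by measurable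
    show "(\<lambda>u. L * size_biased_part u) \<in> borel_measurable borel"
      unfolding size_biased_part_def by measurable
    fix u :: real assume u: "0 < u" "u < 1"
    have "k \<ge> 1" using k by simp
    note b = divisor_sample_bounds[OF this u]
    show "0 \<le> ln (real (divisor_sample k u)) \<and> ln (real (divisor_sample k u)) \<le> L"
      using b by (auto simp: L_def)
    show "0 \<le> L * size_biased_part u \<and> L * size_biased_part u \<le> L"
      using L size_biased_bounds(3,4)[OF u] by (auto simp: mult_left_le less_imp_le)
    fix t assume t: "0 \<le> t" "t < L"
    show "ln (real (divisor_sample k u)) \<le> t \<longleftrightarrow> u \<le> divisor_cdf k (nat \<lfloor>exp t\<rfloor>)"
      unfolding ln_le_iff_nat_floor[OF b(1)]
      using quantile_le_iff[OF divisor_cdf_props(1,3)[OF k] u(2)] k by (simp add: divisor_sample_def)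
    have "L * size_biased_part u \<le> t \<longleftrightarrow> 1 - t / L \<le> sqrt (1 - u)"
      using L by (simp add: size_biased_part_def field_simps)
    also have "\<dots> \<longleftrightarrow> sqrt ((1 - t / L)\<^sup>2) \<le> sqrt (1 - u)"
      using t L by simp
    also have "\<dots> \<longleftrightarrow> u \<le> 1 - (1 - t / L)\<^sup>2"
      by (subst real_sqrt_le_iff) linarith
    finally show "L * size_biased_part u \<le> t \<longleftrightarrow> u \<le> 1 - (1 - t / L)\<^sup>2" .
  next
    fix t assume t: "0 \<le> t" "t < L"
    show "\<bar>divisor_cdf k (nat \<lfloor>exp t\<rfloor>) - (1 - (1 - t / L)\<^sup>2)\<bar> \<le> 128 / L"
      unfolding L_def using t k nat_floor_exp_bounds[OF t(1)] nat_floor_exp_less[of t k]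
      by (intro divisor_cdf_approx) (auto simp: L_def)
  qed (use L in auto)
  then show ?thesis using L by (simp add: L_def)
qed (simp add: divisor_sample_def)

definition harm_expectation :: "nat \<Rightarrow> (nat \<Rightarrow> ennreal) \<Rightarrow> ennreal" where
  "harm_expectation n \<phi> = (\<Sum>m=1..n. ennreal (1 / (harm n * real m)) * \<phi> m)"

text \<open>The factor \<open>harm (k div d)\<close> in the law of \<open>d\<close> cancels the
  normaliser of the harmonic sample on \<open>{1..k div d}\<close>. What remains depends only on
  \<open>h = d * m\<close>, except for \<open>mangoldt d\<close>, whose sum over the divisors of
  \<open>h\<close> is \<open>ln h\<close>.\<close>

lemma harm_expectation_divisor_sample:
  assumes k: "k \<ge> 2"
  shows "(\<integral>\<^sup>+u. harm_expectation (k div divisor_sample k u) (\<lambda>m. \<phi> (divisor_sample k u * m)) \<partial>unif01) =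
    (\<Sum>h=1..k. ennreal (ln (real h) / (log_harm k * real h)) * \<phi> h)"
proof -
  have S: "log_harm k > 0" by (rule log_harm_pos[OF k])
  have "(\<integral>\<^sup>+u. harm_expectation (k div divisor_sample k u) (\<lambda>m. \<phi> (divisor_sample k u * m)) \<partial>unif01) =
     (\<Sum>d=1..k. ennreal (divisor_cdf k d - divisor_cdf k (d - 1)) * harm_expectation (k div d) (\<lambda>m. \<phi> (d * m)))"
    using k nn_integral_quantile[OF divisor_cdf_props[OF k], of "\<lambda>d. harm_expectation (k div d) (\<lambda>m. \<phi> (d * m))"]
    by (simp add: divisor_sample_def)
  also have "\<dots> = (\<Sum>d=1..k. \<Sum>m=1..k div d. ennreal (mangoldt d / (log_harm k * real (d * m))) * \<phi> (d * m))"
  proof (intro sum.cong refl)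
    fix d assume d: "d \<in> {1..k}"
    have "k div d > 0" using d by (simp add: div_greater_zero_iff)
    then have h: "harm (k div d) > (0 :: real)" by simp
    have "ennreal (divisor_cdf k d - divisor_cdf k (d - 1)) * harm_expectation (k div d) (\<lambda>m. \<phi> (d * m)) =
      (\<Sum>m=1..k div d. ennreal (mangoldt d / real d * harm (k div d) / log_harm k) * (ennreal (1 / (harm (k div d) * real m)) * \<phi> (d * m)))"
      using d by (subst divisor_cdf_diff) (auto simp: harm_expectation_def sum_distrib_left)
    also have "\<dots> = (\<Sum>m=1..k div d. ennreal (mangoldt d / (log_harm k * real (d * m))) * \<phi> (d * m))"
    proof (intro sum.cong refl)
      fix m
      have "mangoldt d / real d * harm (k div d) / log_harm k * (1 / (harm (k div d) * real m)) = mangoldt d / (log_harm k * real (d * m))"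
        using \<open>k div d > 0\<close> by (simp add: mult_ac)
      then show "ennreal (mangoldt d / real d * harm (k div d) / log_harm k) * (ennreal (1 / (harm (k div d) * real m)) * \<phi> (d * m)) =
         ennreal (mangoldt d / (log_harm k * real (d * m))) * \<phi> (d * m)"
        using S by (intro ennreal_mult_collect) (auto simp: mangoldt_nonneg harm_nonneg)
    qed
    finally show "ennreal (divisor_cdf k d - divisor_cdf k (d - 1)) * harm_expectation (k div d) (\<lambda>m. \<phi> (d * m)) = \<dots>" .
  qed
  also have "\<dots> = (\<Sum>h=1..k. \<Sum>d | d dvd h. ennreal (mangoldt d / (log_harm k * real (d * (h div d)))) * \<phi> (d * (h div d)))"
    by (rule sum_dvd_swap [symmetric])
  also have "\<dots> = (\<Sum>h=1..k. ennreal (ln (real h) / (log_harm k * real h)) * \<phi> h)"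
  proof (intro sum.cong refl)
    fix h assume h: "h \<in> {1..k}"
    have "(\<Sum>d | d dvd h. ennreal (mangoldt d / (log_harm k * real (d * (h div d)))) * \<phi> (d * (h div d))) =
      (\<Sum>d | d dvd h. ennreal (mangoldt d / (log_harm k * real h))) * \<phi> h"
      unfolding sum_distrib_right by (intro sum.cong) auto
    also have "(\<Sum>d | d dvd h. ennreal (mangoldt d / (log_harm k * real h))) = ennreal (\<Sum>d | d dvd h. mangoldt d / (log_harm k * real h))"
      using S by (intro sum_ennreal) (auto simp: mangoldt_nonneg)
    also have "(\<Sum>d | d dvd h. mangoldt d / (log_harm k * real h)) = ln (real h) / (log_harm k * real h)"
      using h by (simp add: mangoldt_sum flip: sum_divide_distrib)
    finally show "(\<Sum>d | d dvd h. ennreal (mangoldt d / (log_harm k * real (d * (h div d)))) * \<phi> (d * (h div d))) =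
      ennreal (ln (real h) / (log_harm k * real h)) * \<phi> h" .
  qed
  finally show ?thesis .
qed

text \<open>Given a bound \<open>k >= 2\<close>, the product is size-biased on
  \<open>{1..k}\<close>. The mass of \<open>k\<close> contains the factor \<open>log_harm k\<close>,
  which cancels the normaliser, and the remaining weights of the bounds \<open>k >= h\<close> sum to
  \<open>1 / ln h\<close>. The value \<open>h = 1\<close>, where \<open>ln h\<close> vanishes, is
  treated apart.\<close>

lemma harm_expectation_split:
  assumes n: "n \<ge> 2"
  shows "(\<integral>\<^sup>+u1. \<integral>\<^sup>+u2. harm_expectation (bound_sample n u1 div divisor_sample (bound_sample n u1) u2)
      (\<lambda>m. \<phi> (divisor_sample (bound_sample n u1) u2 * m)) \<partial>unif01 \<partial>unif01) = harm_expectation n \<phi>"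
proof -
  define \<Psi> where "\<Psi> k = (\<integral>\<^sup>+u. harm_expectation (k div divisor_sample k u) (\<lambda>m. \<phi> (divisor_sample k u * m)) \<partial>unif01)" for k
  have h: "harm n > (0::real)" using n by simp
  have \<Psi>1: "\<Psi> 1 = \<phi> 1"
    using unif01.emeasure_space_1 by (simp add: \<Psi>_def divisor_sample_def harm_expectation_def harm_def)
  have "(\<integral>\<^sup>+u. \<Psi> (bound_sample n u) \<partial>unif01) = (\<Sum>k=1..n. ennreal (bound_cdf n k - bound_cdf n (k - 1)) * \<Psi> k)"
    unfolding bound_sample_def by (rule nn_integral_quantile[OF bound_cdf_props[OF n]])
  also have "\<dots> = ennreal (1 / harm n) * \<phi> 1 + (\<Sum>k=2..n. ennreal (bound_cdf n k - bound_cdf n (k - 1)) * \<Psi> k)"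
    using n \<Psi>1 bound_cdf_diff(1)[OF n] by (subst sum_atLeast1_split) simp_all
  also have "(\<Sum>k=2..n. ennreal (bound_cdf n k - bound_cdf n (k - 1)) * \<Psi> k) =
     (\<Sum>k=2..n. \<Sum>h=2..n. if h \<le> k then ennreal (bound_weight n k * (ln (real h) / (harm n * real h))) * \<phi> h else 0)"
  proof (intro sum.cong refl)
    fix k assume "k \<in> {2..n}"
    then have k: "2 \<le> k" "k \<le> n" by auto
    have S: "log_harm k > 0" by (rule log_harm_pos[OF k(1)])
    have "ennreal (bound_cdf n k - bound_cdf n (k - 1)) * \<Psi> k =
      (\<Sum>h=1..k. ennreal (log_harm k * bound_weight n k / harm n) * (ennreal (ln (real h) / (log_harm k * real h)) * \<phi> h))"
      unfolding \<Psi>_def harm_expectation_divisor_sample[OF k(1)] bound_cdf_diff(2)[OF n k] by (rule sum_distrib_left)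
    also have "\<dots> = (\<Sum>h=1..k. ennreal (bound_weight n k * (ln (real h) / (harm n * real h))) * \<phi> h)"
    proof (intro sum.cong refl)
      fix i assume "i \<in> {1..k}"
      have "log_harm k * bound_weight n k / harm n * (ln (real i) / (log_harm k * real i)) = bound_weight n k * (ln (real i) / (harm n * real i))"
        using S by simp
      then show "ennreal (log_harm k * bound_weight n k / harm n) * (ennreal (ln (real i) / (log_harm k * real i)) * \<phi> i) =
          ennreal (bound_weight n k * (ln (real i) / (harm n * real i))) * \<phi> i"
        using S bound_weight_nonneg[OF k] \<open>i \<in> {1..k}\<close>
        by (intro ennreal_mult_collect) (auto simp: harm_nonneg)
    qed
    also have "\<dots> = (\<Sum>h=2..k. ennreal (bound_weight n k * (ln (real h) / (harm n * real h))) * \<phi> h)"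
      using k by (subst sum_atLeast1_split) simp_all
    also have "\<dots> = (\<Sum>h=2..n. if h \<le> k then ennreal (bound_weight n k * (ln (real h) / (harm n * real h))) * \<phi> h else 0)"
      using k by (intro sum.mono_neutral_cong_left) auto
    finally show "ennreal (bound_cdf n k - bound_cdf n (k - 1)) * \<Psi> k = \<dots>" .
  qed
  also have "\<dots> = (\<Sum>h=2..n. \<Sum>k=2..n. if h \<le> k then ennreal (bound_weight n k * (ln (real h) / (harm n * real h))) * \<phi> h else 0)"
    by (rule sum.swap)
  also have "\<dots> = (\<Sum>h=2..n. ennreal (1 / (harm n * real h)) * \<phi> h)"
  proof (intro sum.cong refl)
    fix i assume "i \<in> {2..n}"
    then have i: "2 \<le> i" "i \<le> n" by auto
    have "(\<Sum>k=2..n. if i \<le> k then ennreal (bound_weight n k * (ln (real i) / (harm n * real i))) * \<phi> i else 0) =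
      (\<Sum>k=i..n. ennreal (bound_weight n k * (ln (real i) / (harm n * real i))) * \<phi> i)"
      using i by (intro sum.mono_neutral_cong_right) auto
    also have "\<dots> = (\<Sum>k=i..n. ennreal (bound_weight n k * (ln (real i) / (harm n * real i)))) * \<phi> i"
      by (rule sum_distrib_right [symmetric])
    also have "(\<Sum>k=i..n. ennreal (bound_weight n k * (ln (real i) / (harm n * real i)))) =
       ennreal (\<Sum>k=i..n. bound_weight n k * (ln (real i) / (harm n * real i)))"
      using i by (intro sum_ennreal mult_nonneg_nonneg bound_weight_nonneg) (auto simp: harm_nonneg)
    also have "(\<Sum>k=i..n. bound_weight n k * (ln (real i) / (harm n * real i))) = 1 / (harm n * real i)"
      unfolding sum_distrib_right[symmetric] sum_bound_weight[OF i] using i by simp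
    finally show "(\<Sum>k=2..n. if i \<le> k then ennreal (bound_weight n k * (ln (real i) / (harm n * real i))) * \<phi> i else 0) =
       ennreal (1 / (harm n * real i)) * \<phi> i" .
  qed
  also have "ennreal (1 / harm n) * \<phi> 1 + (\<Sum>h=2..n. ennreal (1 / (harm n * real h)) * \<phi> h) = harm_expectation n \<phi>"
    unfolding harm_expectation_def using n by (subst sum_atLeast1_split) simp_all
  finally show ?thesis by (simp only: \<Psi>_def)
qed

section \<open>The prime divisors of a product\<close>

definition log_primes :: "nat \<Rightarrow> nat \<Rightarrow> real" where
  "log_primes h k = ln (real (prime_div_seq h k))"

definition prime_list :: "nat \<Rightarrow> nat list" where
  "prime_list h = rev (sorted_list_of_set {p. prime p \<and> p dvd h})"

lemma finite_prime_divisors: "h > 0 \<Longrightarrow> finite {p :: nat. prime p \<and> p dvd h}"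
  by (rule finite_subset[OF _ finite_divisors_nat[of h]]) auto

lemma prime_list:
  assumes "h > 0"
  shows "set (prime_list h) = {p. prime p \<and> p dvd h}" "distinct (prime_list h)" "sorted (rev (prime_list h))"
  using finite_prime_divisors[OF assms] by (simp_all add: prime_list_def)

lemma log_primes_eq: "log_primes h k = (if k < length (prime_list h) then ln (real (prime_list h ! k)) else 0)"
  by (simp add: log_primes_def prime_div_seq_def prime_list_def Let_def)

lemma prime_list_nth_ge:
  assumes "h > 0" "k < length (prime_list h)"
  shows "prime_list h ! k \<ge> 2"
proof -
  have "prime_list h ! k \<in> set (prime_list h)" using assms(2) by simp
  then show ?thesis using prime_list(1)[OF assms(1)] prime_ge_2_nat by blast
qed

lemma log_primes_nonneg:
  assumes "h > 0"
  shows "0 \<le> log_primes h k"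
proof (cases "k < length (prime_list h)")
  case True
  from prime_list_nth_ge[OF assms True] show ?thesis by (simp add: log_primes_eq)
qed (simp add: log_primes_eq)

lemma decseq_log_primes:
  assumes h: "h > 0"
  shows "decseq (log_primes h)"
  unfolding decseq_Suc_iff
proof
  fix k
  show "log_primes h (Suc k) \<le> log_primes h k"
  proof (cases "Suc k < length (prime_list h)")
    case True
    have "prime_list h ! Suc k \<le> prime_list h ! k"
      using sorted_rev_nth_mono[OF prime_list(3)[OF h], of k "Suc k"] True by simp
    then show ?thesis
      using True prime_list_nth_ge[OF h True] by (simp add: log_primes_eq)
  next
    case False
    then have "log_primes h (Suc k) = 0" by (simp add: log_primes_eq)
    then show ?thesis using log_primes_nonneg[OF h, of k] by simp
  qed
qed

text \<open>Translates the sorted list of prime divisors into counts above a level, by which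
  insertions are recognised.\<close>

lemma card_log_primes_gt:
  assumes h: "h > 0" and t: "t > 0"
  shows "card {k. log_primes h k > t} = card {p. prime p \<and> p dvd h \<and> ln (real p) > t}"
    "finite {k. log_primes h k > t}"
proof -
  have eq: "{k. log_primes h k > t} = {k. k < length (prime_list h) \<and> ln (real (prime_list h ! k)) > t}"
    using t by (auto simp: log_primes_eq split: if_splits)
  then show "finite {k. log_primes h k > t}" by simp
  have "bij_betw ((!) (prime_list h)) {k. k < length (prime_list h) \<and> ln (real (prime_list h ! k)) > t}
      {p \<in> set (prime_list h). ln (real p) > t}"
    unfolding bij_betw_def
  proof
    show "inj_on ((!) (prime_list h)) {k. k < length (prime_list h) \<and> ln (real (prime_list h ! k)) > t}"
      using prime_list(2)[OF h] by (auto simp: inj_on_def nth_eq_iff_index_eq)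
    show "(!) (prime_list h) ` {k. k < length (prime_list h) \<and> ln (real (prime_list h ! k)) > t} = {p \<in> set (prime_list h). ln (real p) > t}"
      by (auto simp: in_set_conv_nth)
  qed
  from bij_betw_same_card[OF this]
  show "card {k. log_primes h k > t} = card {p. prime p \<and> p dvd h \<and> ln (real p) > t}"
    unfolding eq prime_list(1)[OF h] by (simp add: conj_assoc)
qed

lemma log_primes_eqI:
  assumes "{p. prime p \<and> p dvd h} = {p. prime p \<and> p dvd h'}"
  shows "log_primes h = log_primes h'"
  using assms by (simp add: fun_eq_iff log_primes_def prime_div_seq_def)

lemma prime_dvd_prime_power_mult:
  fixes p q :: nat
  assumes "prime p" "a > 0"
  shows "prime q \<and> q dvd p ^ a * h \<longleftrightarrow> prime q \<and> (q = p \<or> q dvd h)"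
  using assms by (auto simp: prime_dvd_mult_iff prime_dvd_power_iff primes_dvd_imp_eq)

lemma log_primes_mult_dvd:
  assumes "prime p" "a > 0" "p dvd h"
  shows "log_primes (p ^ a * h) = log_primes h"
  by (rule log_primes_eqI) (use assms in \<open>auto simp: prime_dvd_prime_power_mult\<close>)

text \<open>A new prime raises the count above a level by one exactly when \<open>ln p\<close>
  exceeds the level, as sorted insertion does.\<close>

lemma log_primes_mult_not_dvd:
  assumes p: "prime p" "a > 0" "\<not> p dvd h" and h: "h > 0"
  shows "log_primes (p ^ a * h) = insert_seq (ln (real p)) (log_primes h)"
proof -
  have ph: "p ^ a * h > 0" using p h prime_gt_0_nat by simp
  note d = decseq_log_primes[OF h]
  show ?thesis
  proof (rule decseq_eqI_card)
    show "decseq (log_primes (p ^ a * h))" "decseq (insert_seq (ln (real p)) (log_primes h))"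
      by (intro decseq_log_primes decseq_insert_seq ph h)+
    show "0 \<le> log_primes (p ^ a * h) k" "0 \<le> insert_seq (ln (real p)) (log_primes h) k" for k
      by (intro log_primes_nonneg insert_seq_nonneg ph h)+
    fix t :: real assume t: "t > 0"
    show "finite {k. log_primes (p ^ a * h) k > t}"
      by (rule card_log_primes_gt(2)[OF ph t])
    show "finite {k. insert_seq (ln (real p)) (log_primes h) k > t}"
      by (rule card_insert_seq(1)[OF d card_log_primes_gt(2)[OF h t]])
    have fin: "finite {q. prime q \<and> q dvd h \<and> ln (real q) > t}"
      by (rule finite_subset[OF _ finite_prime_divisors[OF h]]) auto
    have "{q. prime q \<and> q dvd p ^ a * h \<and> ln (real q) > t} =
        (if ln (real p) > t then insert p {q. prime q \<and> q dvd h \<and> ln (real q) > t} else {q. prime q \<and> q dvd h \<and> ln (real q) > t})"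
    proof (cases "ln (real p) > t")
      case True
      have "prime q \<and> q dvd p ^ a * h \<and> ln (real q) > t \<longleftrightarrow> q = p \<or> (prime q \<and> q dvd h \<and> ln (real q) > t)" for q
        using p(1) True prime_dvd_prime_power_mult[OF p(1,2), of q h] by blast
      then show ?thesis using True by auto
    next
      case False
      have "prime q \<and> q dvd p ^ a * h \<and> ln (real q) > t \<longleftrightarrow> prime q \<and> q dvd h \<and> ln (real q) > t" for q
        using False prime_dvd_prime_power_mult[OF p(1,2), of q h] by blast
      then show ?thesis using False by auto
    qed
    then have "card {q. prime q \<and> q dvd p ^ a * h \<and> ln (real q) > t} =
        card {q. prime q \<and> q dvd h \<and> ln (real q) > t} + (if ln (real p) > t then 1 else 0)"
      using fin p(3) by simp
    then show "card {k. log_primes (p ^ a * h) k > t} = card {k. insert_seq (ln (real p)) (log_primes h) k > t}"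
      by (simp only: card_log_primes_gt(1)[OF ph t] card_insert_seq(2)[OF d card_log_primes_gt(2)[OF h t]] card_log_primes_gt(1)[OF h t])
  qed
qed

section \<open>Repeated prime factors\<close>

definition log_radical :: "nat \<Rightarrow> real" where
  "log_radical h = (\<Sum>p | prime p \<and> p dvd h. ln (real p))"

definition log_excess :: "nat \<Rightarrow> real" where
  "log_excess h = ln (real h) - log_radical h"

text \<open>Prime divisors account for the radical, so proper prime powers remain; over these
  \<open>mangoldt d / d\<close> has a finite sum, which is why the excess has bounded mean.\<close>

lemma log_excess_conv_mangoldt:
  assumes "h > 0"
  shows "log_excess h = (\<Sum>d | d dvd h. if prime d then 0 else mangoldt d)"
proof -
  have "ln (real h) = (\<Sum>d | d dvd h. mangoldt d)"
    using assms by (simp add: mangoldt_sum)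
  moreover have "log_radical h = (\<Sum>d | d dvd h. if prime d then mangoldt d else 0)"
    unfolding log_radical_def using assms finite_divisors_nat[of h]
    by (intro sum.mono_neutral_cong_left) auto
  ultimately have "log_excess h = (\<Sum>d | d dvd h. mangoldt d - (if prime d then mangoldt d else 0))"
    by (simp add: log_excess_def sum_subtractf)
  also have "\<dots> = (\<Sum>d | d dvd h. if prime d then 0 else mangoldt d)"
    by (intro sum.cong) auto
  finally show ?thesis .
qed

lemma log_excess_nonneg: "h > 0 \<Longrightarrow> 0 \<le> log_excess h"
  by (simp add: log_excess_conv_mangoldt sum_nonneg mangoldt_nonneg)

lemma log_radical_nonneg: "0 \<le> log_radical h"
  unfolding log_radical_def by (intro sum_nonneg) (auto dest: prime_ge_1_nat)

lemma log_radical_le: "h > 0 \<Longrightarrow> log_radical h \<le> ln (real h)"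
  using log_excess_nonneg[of h] by (simp add: log_excess_def)

lemma suminf_log_primes:
  assumes h: "h > 0"
  shows "(\<Sum>k. ennreal (log_primes h k)) = ennreal (log_radical h)"
proof -
  have "(\<Sum>k. ennreal (log_primes h k)) = (\<Sum>k<length (prime_list h). ennreal (log_primes h k))"
    by (rule suminf_finite) (auto simp: log_primes_eq)
  also have "\<dots> = ennreal (\<Sum>k<length (prime_list h). log_primes h k)"
    by (rule sum_ennreal) (rule log_primes_nonneg[OF h])
  also have "(\<Sum>k<length (prime_list h). log_primes h k) = (\<Sum>k<length (prime_list h). ln (real (prime_list h ! k)))"
    by (intro sum.cong) (auto simp: log_primes_eq)
  also have "\<dots> = log_radical h"
    unfolding log_radical_def prime_list(1)[OF h, symmetric]
    by (intro sum.reindex_bij_betw[of "(!) (prime_list h)"] bij_betw_nth prime_list(2)[OF h]) auto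
  finally show ?thesis .
qed

lemma log_excess_prime_power_mult:
  assumes p: "prime p" "a > 0" and h: "h > 0"
  shows "log_excess (p ^ a * h) = log_excess h + real a * ln (real p) - (if p dvd h then 0 else ln (real p))"
proof -
  have ln: "ln (real (p ^ a * h)) = real a * ln (real p) + ln (real h)"
    using h prime_gt_0_nat[OF p(1)] by (simp add: ln_mult ln_realpow)
  have "{q. prime q \<and> q dvd p ^ a * h} = insert p {q. prime q \<and> q dvd h}"
    using p prime_dvd_prime_power_mult[OF p] by auto
  then have "log_radical (p ^ a * h) = log_radical h + (if p dvd h then 0 else ln (real p))"
    using p finite_prime_divisors[OF h] by (simp add: log_radical_def sum.insert_if add.commute)
  then show ?thesis
    unfolding log_excess_def ln by simp
qed

text \<open>The excess pays for the difference between a prime power \<open>d\<close> and the prime it contributes.\<close>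

lemma l1_dist_log_primes_mult:
  assumes d: "d = 1 \<or> primepow d" and h: "h > 0" and x: "0 \<le> x"
    and y: "decseq y" "\<And>k. 0 \<le> y k"
  shows "l1_dist (log_primes (d * h)) (insert_seq x y) + ennreal (log_excess h)
    \<le> ennreal \<bar>ln (real d) - x\<bar> + l1_dist (log_primes h) y + ennreal (log_excess (d * h))"
proof -
  have ins: "l1_dist (log_primes h) (insert_seq x y) \<le> l1_dist (log_primes h) y + ennreal x"
    using l1_dist_triangle[of "log_primes h" "insert_seq x y" y] l1_dist_insert_seq_self[OF y, of x] x
    by (auto intro: order.trans add_left_mono)
  have e0: "0 \<le> log_excess h" by (rule log_excess_nonneg[OF h])
  show ?thesis
  proof (cases "d = 1")
    case True
    have "l1_dist (log_primes h) (insert_seq x y) + ennreal (log_excess h)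
      \<le> l1_dist (log_primes h) y + ennreal x + ennreal (log_excess h)"
      by (intro add_right_mono ins)
    then show ?thesis using True x by (simp add: add_ac)
  next
    case False
    with d obtain p a where pa: "prime p" "a > 0" "d = p ^ a"
      by (auto simp: primepow_def)
    have lnp: "0 \<le> ln (real p)" using prime_ge_1_nat[OF pa(1)] by simp
    have lnd: "ln (real d) = real a * ln (real p)"
      using prime_gt_0_nat[OF pa(1)] by (simp add: pa(3) ln_realpow)
    show ?thesis
    proof (cases "p dvd h")
      \<comment> \<open>The prime occurs already, so the factor inserts nothing and \<open>x\<close>
        is pure loss. It is at most \<open>|ln d - x| + ln d\<close>, and the excess grows by just
        this \<open>ln d\<close>.\<close>
      case True
      have e: "log_excess (d * h) = ln (real d) + log_excess h"
        using log_excess_prime_power_mult[OF pa(1,2) h] True unfolding pa(3)[symmetric] by (simp add: lnd)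
      have lnd0: "0 \<le> ln (real d)" using lnp by (simp add: lnd)
      have "l1_dist (log_primes (d * h)) (insert_seq x y) + ennreal (log_excess h)
        \<le> (l1_dist (log_primes h) y + ennreal x) + ennreal (log_excess h)"
        using ins log_primes_mult_dvd[OF pa(1,2) True] by (simp add: pa(3) add_right_mono)
      also have "\<dots> \<le> (l1_dist (log_primes h) y + (ennreal \<bar>ln (real d) - x\<bar> + ennreal (ln (real d)))) + ennreal (log_excess h)"
        using lnd0 by (intro add_right_mono add_left_mono) (auto simp flip: ennreal_plus intro: ennreal_leI)
      also have "\<dots> = ennreal \<bar>ln (real d) - x\<bar> + l1_dist (log_primes h) y + (ennreal (ln (real d)) + ennreal (log_excess h))"
        by (simp add: add_ac)
      also have "ennreal (ln (real d)) + ennreal (log_excess h) = ennreal (log_excess (d * h))"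
        unfolding e using lnd0 e0 by (simp add: ennreal_plus)
      finally show ?thesis .
    next
      \<comment> \<open>Only \<open>ln p\<close> is inserted although \<open>x\<close> is compared
        with \<open>ln d\<close>; the surplus \<open>r\<close> of a higher power is the growth of
        the excess.\<close>
      case False
      define r where "r = ln (real d) - ln (real p)"
      have r: "0 \<le> r"
      proof -
        have "1 * ln (real p) \<le> real a * ln (real p)"
          using pa(2) lnp by (intro mult_right_mono) auto
        then show ?thesis by (simp add: r_def lnd)
      qed
      have e: "log_excess (d * h) = r + log_excess h"
        using log_excess_prime_power_mult[OF pa(1,2) h] False unfolding pa(3)[symmetric] by (simp add: lnd r_def)
      have "l1_dist (log_primes (d * h)) (insert_seq x y) + ennreal (log_excess h)
        \<le> (ennreal \<bar>ln (real p) - x\<bar> + l1_dist (log_primes h) y) + ennreal (log_excess h)"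
        using l1_dist_insert_seq[OF decseq_log_primes[OF h] y(1), of "ln (real p)" x]
          log_primes_mult_not_dvd[OF pa(1,2) False h] by (simp add: pa(3) add_right_mono)
      also have "\<dots> \<le> ((ennreal \<bar>ln (real d) - x\<bar> + ennreal r) + l1_dist (log_primes h) y) + ennreal (log_excess h)"
        using r by (intro add_right_mono) (auto simp: r_def simp flip: ennreal_plus intro: ennreal_leI)
      also have "\<dots> = ennreal \<bar>ln (real d) - x\<bar> + l1_dist (log_primes h) y + (ennreal r + ennreal (log_excess h))"
        by (simp add: add_ac)
      also have "ennreal r + ennreal (log_excess h) = ennreal (log_excess (d * h))"
        unfolding e using r e0 by (simp add: ennreal_plus)
      finally show ?thesis .
    qed
  qed
qed

text \<open>For each prime, the powers from the square on form a geometric series bounded by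
  \<open>2 / p^2\<close>, and \<open>ln p <= 2 * sqrt p\<close>. The resulting
  \<open>4 * p powr (-3/2)\<close> is summable over all naturals, so the bound does not depend on
  \<open>n\<close>.\<close>

lemma sum_higher_prime_powers:
  "(\<Sum>d=1..n. (if prime d then 0 else mangoldt d) / real d) \<le> (\<Sum>m. 4 * real m powr (-3/2))"
proof -
  define g :: "nat \<Rightarrow> real" where "g d = mangoldt d / real d" for d
  define I where "I = {p \<in> {2..n}. prime p} \<times> {2..n}"
  have "(\<Sum>d=1..n. (if prime d then 0 else mangoldt d) / real d) \<le> sum g ((\<lambda>(p, a). p ^ a) ` I)"
  proof -
    have "(\<Sum>d=1..n. (if prime d then 0 else mangoldt d) / real d) = (\<Sum>d\<in>{d \<in> {1..n}. primepow d \<and> \<not> prime d}. g d)"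
      by (rule sum.mono_neutral_cong_right) (auto simp: g_def mangoldt_def)
    also have "\<dots> \<le> sum g ((\<lambda>(p, a). p ^ a) ` I)"
    proof (rule sum_mono2)
      show "finite ((\<lambda>(p, a). p ^ a) ` I)" by (simp add: I_def)
      show "{d \<in> {1..n}. primepow d \<and> \<not> prime d} \<subseteq> (\<lambda>(p, a). p ^ a) ` I"
      proof
        fix d assume "d \<in> {d \<in> {1..n}. primepow d \<and> \<not> prime d}"
        then obtain p a where pa: "prime p" "a > 0" "d = p ^ a" "d \<le> n" "\<not> prime d"
          by (auto simp: primepow_def)
        have "a \<noteq> 1" using pa by auto
        then have "a \<ge> 2" using pa by linarith
        have p2: "2 \<le> p" using pa prime_ge_2_nat by blast
        have "a < p ^ a" using p2 by (simp add: less_exp order.strict_trans2[OF less_exp] power_mono)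
        moreover have "p \<le> p ^ a" using p2 pa(2) by (simp add: self_le_power)
        ultimately have "(p, a) \<in> I" using pa p2 \<open>a \<ge> 2\<close> by (auto simp: I_def)
        then show "d \<in> (\<lambda>(p, a). p ^ a) ` I" using pa(3) by force
      qed
    qed (auto simp: g_def mangoldt_nonneg)
    finally show ?thesis .
  qed
  also have "\<dots> \<le> (\<Sum>i\<in>I. g (case i of (p, a) \<Rightarrow> p ^ a))"
    using sum_image_le[of I g "\<lambda>(p, a). p ^ a"] by (simp add: I_def g_def mangoldt_nonneg comp_def)
  also have "\<dots> = (\<Sum>p\<in>{p \<in> {2..n}. prime p}. \<Sum>a=2..n. ln (real p) / real p ^ a)"
  proof -
    have "(\<Sum>i\<in>I. g (case i of (p, a) \<Rightarrow> p ^ a)) = (\<Sum>(p, a)\<in>I. g (p ^ a))"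
      by (simp add: case_prod_beta)
    also have "\<dots> = (\<Sum>p\<in>{p \<in> {2..n}. prime p}. \<Sum>a=2..n. g (p ^ a))"
      unfolding I_def by (rule sum.cartesian_product [symmetric])
    also have "\<dots> = (\<Sum>p\<in>{p \<in> {2..n}. prime p}. \<Sum>a=2..n. ln (real p) / real p ^ a)"
      by (intro sum.cong refl) (simp add: g_def)
    finally show ?thesis .
  qed
  also have "\<dots> \<le> (\<Sum>p\<in>{p \<in> {2..n}. prime p}. 4 * real p powr (-3/2))"
  proof (rule sum_mono)
    fix p assume "p \<in> {p \<in> {2..n}. prime p}"
    then have p: "p \<ge> 2" by simp
    define r where "r = 1 / real p"
    have r: "0 < r" "r \<le> 1/2" using p by (auto simp: r_def field_simps)
    \<comment> \<open>The subtracted term strengthens the induction; at \<open>m = 1\<close> the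
      estimate is an equality.\<close>
    have geo: "(\<Sum>a=2..m. r ^ a) \<le> 2 * r\<^sup>2 - 2 * r ^ Suc m" if "m \<ge> 1" for m
      using that
    proof (induction m rule: nat_induct_at_least)
      case base
      then show ?case by (simp add: power2_eq_square)
    next
      case (Suc m)
      have "2 * r ^ Suc (Suc m) \<le> r ^ Suc m"
        using r mult_right_mono[of "2 * r" 1 "r ^ Suc m"] by simp
      then show ?case using Suc by (simp add: numeral_2_eq_2)
    qed
    have "(\<Sum>a=2..n. r ^ a) \<le> 2 * r\<^sup>2"
    proof (cases "n \<ge> 1")
      case True
      have "0 \<le> r ^ Suc n" using r by simp
      then show ?thesis using geo[OF True] by linarith
    qed (simp)
    moreover have "ln (real p) \<le> 2 * sqrt (real p)"
    proof -
      have "ln (sqrt (real p)) \<le> sqrt (real p) - 1"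
        using p by (intro ln_le_minus_one) auto
      then show ?thesis using p by (simp add: ln_sqrt)
    qed
    ultimately have "ln (real p) * (\<Sum>a=2..n. r ^ a) \<le> (2 * sqrt (real p)) * (2 * r\<^sup>2)"
      using r p by (intro mult_mono) (auto intro!: sum_nonneg)
    also have "\<dots> = 4 * real p powr (-3/2)"
    proof -
      have "sqrt (real p) * r\<^sup>2 = real p powr (1/2) * real p powr (-2)"
        using p by (simp add: powr_half_sqrt r_def powr_minus powr_numeral field_simps)
      also have "\<dots> = real p powr (-3/2)"
        by (simp flip: powr_add)
      finally show ?thesis by simp
    qed
    finally show "(\<Sum>a=2..n. ln (real p) / real p ^ a) \<le> 4 * real p powr (-3/2)"
      by (simp add: r_def power_one_over sum_distrib_left field_simps)
  qed
  also have "\<dots> \<le> (\<Sum>m. 4 * real m powr (-3/2))"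
    by (intro sum_le_suminf summable_mult) (auto simp: summable_real_powr_iff)
  finally show ?thesis .
qed

definition excess_bound :: real where
  "excess_bound = (\<Sum>m. 4 * real m powr (-3/2))"

text \<open>A given \<open>d\<close> divides the sample with probability
  \<open>harm (n div d) / (d * harm n)\<close>, at most \<open>1 / d\<close>, so the mean is bounded
  by the sum over proper prime powers.\<close>

lemma harm_expectation_log_excess:
  assumes n: "n > 0"
  shows "harm_expectation n (\<lambda>h. ennreal (log_excess h)) \<le> ennreal excess_bound"
proof -
  define g :: "nat \<Rightarrow> real" where "g d = (if prime d then 0 else mangoldt d)" for d
  have g: "0 \<le> g d" for d by (simp add: g_def mangoldt_nonneg)
  have hn: "0 < (harm n :: real)" using n by simp
  have "harm_expectation n (\<lambda>h. ennreal (log_excess h)) = (\<Sum>h=1..n. ennreal (1 / (harm n * real h) * log_excess h))"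
    unfolding harm_expectation_def
    by (intro sum.cong) (auto simp: log_excess_nonneg harm_nonneg simp flip: ennreal_mult)
  also have "\<dots> = ennreal (\<Sum>h=1..n. 1 / (harm n * real h) * log_excess h)"
    by (intro sum_ennreal mult_nonneg_nonneg) (auto simp: harm_nonneg log_excess_nonneg)
  also have "(\<Sum>h=1..n. 1 / (harm n * real h) * log_excess h) = (\<Sum>h=1..n. \<Sum>d | d dvd h. g d / (harm n * real d * real (h div d)))"
  proof (intro sum.cong refl)
    fix h assume h: "h \<in> {1..n}"
    have "1 / (harm n * real h) * log_excess h = (\<Sum>d | d dvd h. g d / (harm n * real h))"
      using h by (simp add: log_excess_conv_mangoldt g_def sum_divide_distrib)
    also have "\<dots> = (\<Sum>d | d dvd h. g d / (harm n * real d * real (h div d)))"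
      by (intro sum.cong refl) (auto simp: mult.assoc simp flip: of_nat_mult)
    finally show "1 / (harm n * real h) * log_excess h = \<dots>" .
  qed
  also have "\<dots> = (\<Sum>d=1..n. \<Sum>j=1..n div d. g d / (harm n * real d * real j))"
    by (rule sum_dvd_swap)
  also have "\<dots> = (\<Sum>d=1..n. g d / real d * (harm (n div d) / harm n))"
    by (intro sum.cong refl) (simp add: harm_def[of "n div _"] sum_distrib_left sum_divide_distrib divide_simps mult_ac)
  also have "\<dots> \<le> (\<Sum>d=1..n. g d / real d * 1)"
  proof (intro sum_mono mult_left_mono)
    fix d
    have "harm (n div d) \<le> (harm n :: real)" by (intro harm_mono) simp
    then show "harm (n div d) / harm n \<le> (1::real)" using hn by (simp add: divide_le_eq)
  qed (simp add: g)
  also have "\<dots> \<le> excess_bound"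
    using sum_higher_prime_powers[of n] by (simp add: g_def excess_bound_def)
  finally show ?thesis by (simp add: ennreal_leI)
qed

lemma excess_bound_nonneg: "0 \<le> excess_bound"
  unfolding excess_bound_def
  by (intro suminf_nonneg summable_mult) (auto simp: summable_real_powr_iff)

text \<open>A quantile is only attained where the distribution function jumps, and here the jumps
  are multiples of \<open>mangoldt d\<close>.\<close>

lemma primepow_divisor_sample:
  assumes k: "k \<ge> 2" and u: "0 < u" "u < 1"
  shows "primepow (divisor_sample k u)"
proof -
  define d where "d = divisor_sample k u"
  have dq: "d = quantile (divisor_cdf k) u" using k by (simp add: d_def divisor_sample_def)
  note c = divisor_cdf_props[OF k]
  have d1: "1 \<le> d" using quantile_bounds[OF c u] by (simp add: dq)
  have "\<not> u \<le> divisor_cdf k (d - 1)" "u \<le> divisor_cdf k d"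
    using quantile_le_iff[OF c(1,3) u(2), of "d - 1"] quantile_le_iff[OF c(1,3) u(2), of d] d1
    unfolding dq by auto
  then have "divisor_cdf k d - divisor_cdf k (d - 1) \<noteq> 0" by linarith
  then have "mangoldt d \<noteq> (0::real)"
    unfolding divisor_cdf_diff[OF d1] by auto
  then show ?thesis by (auto simp: mangoldt_def d_def split: if_splits)
qed

section \<open>Couplings of harmonic samples with the attenuated Poisson-Dirichlet law\<close>

lemma nn_integral_harmonic_sample: "(\<integral>\<^sup>+h. \<phi> h \<partial>harmonic_sample n) = harm_expectation n \<phi>"
  unfolding harmonic_sample_def harm_expectation_def
  by (subst nn_integral_point_measure_finite) auto

lemma space_harmonic_sample [simp]: "space (harmonic_sample n) = {1..n}"
  by (simp add: harmonic_sample_def space_point_measure)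

lemma harm_expectation_const:
  assumes "n > 0"
  shows "harm_expectation n (\<lambda>_. c) = c"
proof -
  have "(\<Sum>m=1..n. ennreal (1 / (harm n * real m))) = ennreal (\<Sum>m=1..n. 1 / (harm n * real m))"
    by (intro sum_ennreal) (auto simp: harm_nonneg)
  also have "(\<Sum>m=1..n. 1 / (harm n * real m)) = (\<Sum>m=1..n. inverse (real m)) / harm n"
    by (simp add: sum_divide_distrib inverse_eq_divide mult.commute)
  also have "\<dots> = 1"
    unfolding harm_def[symmetric] using assms by simp
  finally show ?thesis
    by (simp add: harm_expectation_def flip: sum_distrib_right)
qed

lemma harm_expectation_mono:
  "(\<And>m. 1 \<le> m \<Longrightarrow> m \<le> n \<Longrightarrow> \<phi> m \<le> \<psi> m) \<Longrightarrow> harm_expectation n \<phi> \<le> harm_expectation n \<psi>"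
  unfolding harm_expectation_def by (intro sum_mono mult_left_mono) auto

lemma harm_expectation_cong:
  "(\<And>m. 1 \<le> m \<Longrightarrow> m \<le> n \<Longrightarrow> \<phi> m = \<psi> m) \<Longrightarrow> harm_expectation n \<phi> = harm_expectation n \<psi>"
  unfolding harm_expectation_def by (intro sum.cong) auto

lemma prob_space_harmonic_sample:
  assumes "n > 0"
  shows "prob_space (harmonic_sample n)"
proof
  have "emeasure (harmonic_sample n) (space (harmonic_sample n)) = (\<integral>\<^sup>+h. 1 \<partial>harmonic_sample n)"
    by simp
  then show "emeasure (harmonic_sample n) (space (harmonic_sample n)) = 1"
    unfolding nn_integral_harmonic_sample harm_expectation_const[OF assms] .
qed

abbreviation sample_pair :: "(nat \<times> (nat \<Rightarrow> real)) measure" where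
  "sample_pair \<equiv> count_space UNIV \<Otimes>\<^sub>M seq_borel"

text \<open>The first component is the number itself and not its prime sequence, since the effect of
  a factor \<open>p ^ a\<close> depends on whether \<open>p\<close> divides the number. Marginals
  are stated by integrals, the form in which mixtures are computed.\<close>

definition harm_coupling :: "nat \<Rightarrow> (nat \<times> (nat \<Rightarrow> real)) measure \<Rightarrow> bool" where
  "harm_coupling n \<pi> \<longleftrightarrow> prob_space \<pi> \<and> sets \<pi> = sets sample_pair \<and>
    (\<forall>\<phi>. (\<integral>\<^sup>+w. \<phi> (fst w) \<partial>\<pi>) = harm_expectation n \<phi>) \<and>
    (\<forall>f\<in>borel_measurable seq_borel. (\<integral>\<^sup>+w. f (snd w) \<partial>\<pi>) = (\<integral>\<^sup>+z. f z \<partial>attenuated_pd))"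

text \<open>Distances are taken before division by \<open>ln n\<close>: on this scale each step has
  mean error O(1), and costs for different \<open>n\<close> can be added.\<close>

definition coupling_cost :: "nat \<Rightarrow> (nat \<times> (nat \<Rightarrow> real)) measure \<Rightarrow> ennreal" where
  "coupling_cost n \<pi> = (\<integral>\<^sup>+w. l1_dist (log_primes (fst w)) (\<lambda>k. ln (real n) * snd w k) \<partial>\<pi>)"

lemma measurable_log_primes: "f \<in> M \<rightarrow>\<^sub>M count_space UNIV \<Longrightarrow> (\<lambda>x. log_primes (f x)) \<in> M \<rightarrow>\<^sub>M real_seq"
  by (rule measurable_compose[of f M "count_space UNIV"]) (auto simp: space_PiM)

lemma harm_couplingD:
  assumes "harm_coupling n \<pi>"
  shows "prob_space \<pi>" "sets \<pi> = sets sample_pair" "space \<pi> = UNIV \<times> seq_space"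
    "(\<integral>\<^sup>+w. \<phi> (fst w) \<partial>\<pi>) = harm_expectation n \<phi>"
    "f \<in> borel_measurable seq_borel \<Longrightarrow> (\<integral>\<^sup>+w. f (snd w) \<partial>\<pi>) = (\<integral>\<^sup>+z. f z \<partial>attenuated_pd)"
    "fst \<in> \<pi> \<rightarrow>\<^sub>M count_space UNIV" "snd \<in> \<pi> \<rightarrow>\<^sub>M seq_borel"
proof -
  show s: "sets \<pi> = sets sample_pair" using assms by (simp add: harm_coupling_def)
  show "space \<pi> = UNIV \<times> seq_space"
    using sets_eq_imp_space_eq[OF s] by (simp add: space_pair_measure)
  show "fst \<in> \<pi> \<rightarrow>\<^sub>M count_space UNIV" "snd \<in> \<pi> \<rightarrow>\<^sub>M seq_borel"
    unfolding measurable_cong_sets[OF s refl] by auto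
qed (use assms in \<open>auto simp: harm_coupling_def\<close>)

lemma harm_coupling_AE:
  assumes "harm_coupling n \<pi>"
  shows "AE w in \<pi>. 1 \<le> fst w \<and> fst w \<le> n"
proof -
  note m = harm_couplingD(6)[OF assms]
  have "(\<integral>\<^sup>+w. indicator (- {1..n}) (fst w) \<partial>\<pi>) = harm_expectation n (indicator (- {1..n}))"
    by (rule harm_couplingD(4)[OF assms])
  also have "\<dots> = harm_expectation n (\<lambda>_. 0)"
    by (rule harm_expectation_cong) auto
  also have "\<dots> = 0" by (simp add: harm_expectation_def)
  finally have "AE w in \<pi>. indicator (- {1..n}) (fst w) = (0 :: ennreal)"
    by (subst (asm) nn_integral_0_iff_AE) (auto intro: measurable_compose[OF m])
  then show ?thesis by eventually_elim (auto simp: indicator_def split: if_splits)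
qed

lemma measurable_l1_dist_log_primes:
  assumes "f \<in> M \<rightarrow>\<^sub>M count_space UNIV" "g \<in> M \<rightarrow>\<^sub>M seq_borel"
  shows "(\<lambda>w. l1_dist (log_primes (f w)) (\<lambda>k. c * g w k)) \<in> borel_measurable M"
  by (intro measurable_l1_dist measurable_log_primes measurable_scale_seq measurable_seq_borelD assms) simp

lemma l1_dist_zero_seq_space:
  assumes "z \<in> seq_space" "0 \<le> c"
  shows "l1_dist (\<lambda>_. 0) (\<lambda>k. c * z k) \<le> ennreal c"
  using l1_dist_scale_diff[OF assms(1), of 0 c] assms(2) by simp

text \<open>Both sequences have total mass at most \<open>ln n\<close> almost surely, whatever the
  coupling. This starts the induction.\<close>

lemma coupling_cost_trivial:
  assumes c: "harm_coupling n \<pi>" and n: "n > 0"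
  shows "coupling_cost n \<pi> \<le> ennreal (2 * ln (real n))"
proof -
  interpret prob_space \<pi> using harm_couplingD(1)[OF c] .
  note m = harm_couplingD(6)[OF c]
  have "coupling_cost n \<pi> \<le> (\<integral>\<^sup>+w. ennreal (ln (real (fst w))) + ennreal (ln (real n)) \<partial>\<pi>)"
    unfolding coupling_cost_def
  proof (rule nn_integral_mono_AE)
    show "AE w in \<pi>. l1_dist (log_primes (fst w)) (\<lambda>k. ln (real n) * snd w k) \<le> ennreal (ln (real (fst w))) + ennreal (ln (real n))"
      using harm_coupling_AE[OF c] AE_space
    proof eventually_elim
      fix w assume w: "1 \<le> fst w \<and> fst w \<le> n" "w \<in> space \<pi>"
      have abs: "\<bar>log_primes (fst w) k - 0\<bar> = log_primes (fst w) k" for k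
        using log_primes_nonneg[of "fst w" k] w by simp
      have "l1_dist (log_primes (fst w)) (\<lambda>_. 0) = ennreal (log_radical (fst w))"
        unfolding l1_dist_def abs by (rule suminf_log_primes) (use w in simp)
      also have "\<dots> \<le> ennreal (ln (real (fst w)))"
        using w by (intro ennreal_leI log_radical_le) auto
      finally have 1: "l1_dist (log_primes (fst w)) (\<lambda>_. 0) \<le> ennreal (ln (real (fst w)))" .
      have "snd w \<in> seq_space"
        using w(2) unfolding harm_couplingD(3)[OF c] by (simp add: mem_Times_iff)
      then have 2: "l1_dist (\<lambda>_. 0) (\<lambda>k. ln (real n) * snd w k) \<le> ennreal (ln (real n))"
        by (rule l1_dist_zero_seq_space) (use n in simp)
      show "l1_dist (log_primes (fst w)) (\<lambda>k. ln (real n) * snd w k) \<le> ennreal (ln (real (fst w))) + ennreal (ln (real n))"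
        by (rule order.trans[OF l1_dist_triangle add_mono[OF 1 2]])
    qed
  qed
  also have "\<dots> = (\<integral>\<^sup>+w. ennreal (ln (real (fst w))) \<partial>\<pi>) + ennreal (ln (real n))"
    by (subst nn_integral_add) (auto intro: measurable_compose[OF m] simp: emeasure_space_1)
  also have "\<dots> \<le> ennreal (ln (real n)) + ennreal (ln (real n))"
  proof (rule add_right_mono)
    have "(\<integral>\<^sup>+w. ennreal (ln (real (fst w))) \<partial>\<pi>) = harm_expectation n (\<lambda>h. ennreal (ln (real h)))"
      by (rule harm_couplingD(4)[OF c])
    also have "\<dots> \<le> harm_expectation n (\<lambda>_. ennreal (ln (real n)))"
      by (intro harm_expectation_mono ennreal_leI) auto
    also have "\<dots> = ennreal (ln (real n))" by (rule harm_expectation_const[OF n])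
    finally show "(\<integral>\<^sup>+w. ennreal (ln (real (fst w))) \<partial>\<pi>) \<le> ennreal (ln (real n))" .
  qed
  also have "\<dots> = ennreal (2 * ln (real n))"
    using n by (simp flip: ennreal_plus)
  finally show ?thesis .
qed

lemma harm_coupling_exists:
  assumes n: "n > 0"
  shows "\<exists>\<pi>. harm_coupling n \<pi>"
proof -
  define H where "H = distr (harmonic_sample n) (count_space UNIV) (\<lambda>h. h)"
  have id: "(\<lambda>h. h) \<in> harmonic_sample n \<rightarrow>\<^sub>M count_space UNIV"
    by (simp add: harmonic_sample_def measurable_point_measure_eq1)
  interpret H: prob_space H
    unfolding H_def by (rule prob_space.prob_space_distr[OF prob_space_harmonic_sample[OF n] id])
  interpret Z: prob_space attenuated_pd by (rule prob_space_attenuated_pd)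
  interpret P: pair_prob_space H attenuated_pd ..
  have Z1: "emeasure attenuated_pd seq_space = 1"
    using Z.emeasure_space_1 by simp
  have s: "sets (H \<Otimes>\<^sub>M attenuated_pd) = sets sample_pair"
    by (intro sets_pair_measure_cong) (simp_all add: H_def)
  have HI: "(\<integral>\<^sup>+h. \<phi> h \<partial>H) = harm_expectation n \<phi>" for \<phi>
    unfolding H_def by (subst nn_integral_distr[OF id]) (auto simp: nn_integral_harmonic_sample)
  have mH: "\<phi> \<in> borel_measurable H" for \<phi> :: "nat \<Rightarrow> ennreal"
    by (simp add: H_def)
  have "harm_coupling n (H \<Otimes>\<^sub>M attenuated_pd)"
    unfolding harm_coupling_def
  proof (intro conjI allI ballI s)
    show "prob_space (H \<Otimes>\<^sub>M attenuated_pd)" by unfold_locales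
    fix \<phi> :: "nat \<Rightarrow> ennreal"
    have "(\<integral>\<^sup>+w. \<phi> (fst w) \<partial>(H \<Otimes>\<^sub>M attenuated_pd)) = (\<integral>\<^sup>+h. \<integral>\<^sup>+z. \<phi> (fst (h, z)) \<partial>attenuated_pd \<partial>H)"
      by (rule Z.nn_integral_fst[symmetric]) (rule measurable_compose[OF measurable_fst mH])
    then show "(\<integral>\<^sup>+w. \<phi> (fst w) \<partial>(H \<Otimes>\<^sub>M attenuated_pd)) = harm_expectation n \<phi>"
      by (simp add: HI Z1)
  next
    fix f :: "(nat \<Rightarrow> real) \<Rightarrow> ennreal" assume "f \<in> borel_measurable seq_borel"
    then have f: "f \<in> borel_measurable attenuated_pd" by simp
    have "(\<integral>\<^sup>+w. f (snd w) \<partial>(H \<Otimes>\<^sub>M attenuated_pd)) = (\<integral>\<^sup>+h. \<integral>\<^sup>+z. f (snd (h, z)) \<partial>attenuated_pd \<partial>H)"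
      by (rule Z.nn_integral_fst[symmetric]) (rule measurable_compose[OF measurable_snd f])
    then show "(\<integral>\<^sup>+w. f (snd w) \<partial>(H \<Otimes>\<^sub>M attenuated_pd)) = (\<integral>\<^sup>+z. f z \<partial>attenuated_pd)"
      by (simp add: H.emeasure_space_1)
  qed
  then show ?thesis by blast
qed

section \<open>One random step\<close>

abbreviation unif_pair :: "(real \<times> real) measure" where
  "unif_pair \<equiv> unif01 \<Otimes>\<^sub>M unif01"

interpretation unif_pair: pair_prob_space unif01 unif01 ..

lemma nn_integral_unif_pair:
  "f \<in> borel_measurable unif_pair \<Longrightarrow> (\<integral>\<^sup>+u. f u \<partial>unif_pair) = (\<integral>\<^sup>+u1. \<integral>\<^sup>+u2. f (u1, u2) \<partial>unif01 \<partial>unif01)"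
  by (rule unif01.nn_integral_fst[symmetric])

lemma space_unif_pair: "u \<in> space unif_pair \<longleftrightarrow> 0 < fst u \<and> fst u < 1 \<and> 0 < snd u \<and> snd u < 1"
  by (cases u) (auto simp: space_pair_measure)

lemma measurable_unif01_count_space:
  "f \<in> borel \<rightarrow>\<^sub>M count_space UNIV \<Longrightarrow> f \<in> unif01 \<rightarrow>\<^sub>M count_space UNIV"
  unfolding unif01_def by (rule measurable_restrict_space1) simp

definition pair_bound :: "nat \<Rightarrow> real \<times> real \<Rightarrow> nat" where
  "pair_bound n u = bound_sample n (fst u)"

definition pair_divisor :: "nat \<Rightarrow> real \<times> real \<Rightarrow> nat" where
  "pair_divisor n u = divisor_sample (pair_bound n u) (snd u)"

definition pair_quotient :: "nat \<Rightarrow> real \<times> real \<Rightarrow> nat" where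
  "pair_quotient n u = pair_bound n u div pair_divisor n u"

definition pair_point :: "real \<times> real \<Rightarrow> real" where
  "pair_point u = size_biased_bound (fst u) * size_biased_part (snd u)"

definition pair_rest :: "real \<times> real \<Rightarrow> real" where
  "pair_rest u = size_biased_bound (fst u) * (1 - size_biased_part (snd u))"

lemma measurable_size_biased [measurable]:
  "size_biased_bound \<in> borel_measurable borel" "size_biased_part \<in> borel_measurable borel"
  unfolding size_biased_bound_def[abs_def] size_biased_part_def[abs_def] by measurable

lemma measurable_size_biased_pair:
  "(\<lambda>u. size_biased_bound (fst u)) \<in> borel_measurable unif_pair"
  "(\<lambda>u. size_biased_part (snd u)) \<in> borel_measurable unif_pair"
  by (intro measurable_compose[OF measurable_fst] measurable_compose[OF measurable_snd] measurable_unif01I measurable_size_biased)+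

lemma measurable_pair_point: "pair_point \<in> borel_measurable unif_pair"
  and measurable_pair_rest: "pair_rest \<in> borel_measurable unif_pair"
  unfolding pair_point_def[abs_def] pair_rest_def[abs_def]
  by (intro borel_measurable_times borel_measurable_diff borel_measurable_const measurable_size_biased_pair)+

lemma measurable_pair_bound: "pair_bound n \<in> unif_pair \<rightarrow>\<^sub>M count_space UNIV"
  unfolding pair_bound_def[abs_def]
  by (rule measurable_compose[OF measurable_fst]) (intro measurable_unif01_count_space measurable_samples)

lemma measurable_pair_divisor: "pair_divisor n \<in> unif_pair \<rightarrow>\<^sub>M count_space UNIV"
  unfolding pair_divisor_def[abs_def]
proof (rule measurable_compose_countable[OF _ measurable_pair_bound])
  fix i
  show "(\<lambda>u. divisor_sample i (snd u)) \<in> unif_pair \<rightarrow>\<^sub>M count_space UNIV"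
    by (rule measurable_compose[OF measurable_snd]) (intro measurable_unif01_count_space measurable_samples)
qed

lemma measurable_count_space_pair:
  fixes f g :: "'a \<Rightarrow> nat"
  assumes "f \<in> M \<rightarrow>\<^sub>M count_space UNIV" "g \<in> M \<rightarrow>\<^sub>M count_space UNIV" "\<And>i j. h i j \<in> space N"
  shows "(\<lambda>x. h (f x) (g x)) \<in> M \<rightarrow>\<^sub>M N"
proof (rule measurable_compose_countable[OF _ assms(1)])
  fix i
  show "(\<lambda>x. h i (g x)) \<in> M \<rightarrow>\<^sub>M N"
    by (rule measurable_compose[OF assms(2)]) (use assms(3) in auto)
qed

lemma measurable_pair_quotient: "pair_quotient n \<in> unif_pair \<rightarrow>\<^sub>M count_space UNIV"
  unfolding pair_quotient_def[abs_def]
  by (rule measurable_count_space_pair[OF measurable_pair_bound measurable_pair_divisor]) simp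

text \<open>The strict bound on the quotient makes the recursion well-founded: if the bound is at
  least 2, the divisor is a prime power and exceeds 1; if the bound is 1, the quotient is at most 1,
  hence below \<open>n\<close>.\<close>

lemma pair_bounds:
  assumes n: "n \<ge> 2" and u: "u \<in> space unif_pair"
  shows "1 \<le> pair_bound n u" "pair_bound n u \<le> n" "1 \<le> pair_divisor n u" "pair_divisor n u \<le> pair_bound n u"
    "1 \<le> pair_quotient n u" "pair_quotient n u < n" "pair_divisor n u = 1 \<or> primepow (pair_divisor n u)"
proof -
  note u' = u[unfolded space_unif_pair]
  show K: "1 \<le> pair_bound n u" "pair_bound n u \<le> n"
    unfolding pair_bound_def using bound_sample_bounds[OF n] u' by auto
  show D: "1 \<le> pair_divisor n u" "pair_divisor n u \<le> pair_bound n u"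
    unfolding pair_divisor_def using divisor_sample_bounds[OF K(1)] u' by auto
  then show "1 \<le> pair_quotient n u"
    unfolding pair_quotient_def by (simp add: Suc_le_eq div_greater_zero_iff)
  have *: "primepow (pair_divisor n u)" if "pair_bound n u \<ge> 2"
    unfolding pair_divisor_def using primepow_divisor_sample[OF that] u' by auto
  show "pair_divisor n u = 1 \<or> primepow (pair_divisor n u)"
    using * D K by (cases "pair_bound n u \<ge> 2") auto
  show "pair_quotient n u < n"
  proof (cases "pair_bound n u \<ge> 2")
    case True
    then have "pair_divisor n u > 1" using primepow_gt_Suc_0[OF *] by simp
    then have "pair_quotient n u < pair_bound n u"
      unfolding pair_quotient_def using K(1) by (intro div_less_dividend) auto
    then show ?thesis using K by simp
  next
    case False
    then have "pair_quotient n u \<le> 1" using K unfolding pair_quotient_def by (metis Suc_1 div_le_dividend le_antisym not_less_eq_eq One_nat_def)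
    then show ?thesis using n by simp
  qed
qed

lemma pair_point_rest_bounds:
  assumes "u \<in> space unif_pair"
  shows "0 \<le> pair_point u" "0 \<le> pair_rest u" "pair_point u + pair_rest u \<le> 1" "pair_rest u \<le> 1 - snd u / 2"
proof -
  note u = assms[unfolded space_unif_pair]
  define y b where "y = size_biased_bound (fst u)" and "b = size_biased_part (snd u)"
  have y: "0 < y" "y \<le> 1" and b: "0 < b" "b < 1" "snd u / 2 \<le> b"
    using size_biased_bounds[of "fst u"] size_biased_bounds[of "snd u"] u by (auto simp: y_def b_def)
  show "0 \<le> pair_point u" "0 \<le> pair_rest u"
    using y b by (auto simp: pair_point_def pair_rest_def y_def b_def)
  have "y * b + y * (1 - b) = y" by (simp add: algebra_simps)
  then show "pair_point u + pair_rest u \<le> 1"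
    using y by (simp add: pair_point_def pair_rest_def y_def b_def)
  have "y * (1 - b) \<le> 1 * (1 - b)" using y b by (intro mult_right_mono) auto
  also have "\<dots> \<le> 1 - snd u / 2" using b(3) by simp
  finally show "pair_rest u \<le> 1 - snd u / 2"
    by (simp only: pair_rest_def y_def b_def)
qed

section \<open>Gluing the couplings of the quotients\<close>

definition glue_map :: "nat \<Rightarrow> real \<times> real \<Rightarrow> nat \<times> (nat \<Rightarrow> real) \<Rightarrow> nat \<times> (nat \<Rightarrow> real)" where
  "glue_map n u w = (pair_divisor n u * fst w, insert_seq (pair_point u) (\<lambda>k. pair_rest u * snd w k))"

text \<open>The same uniform pair drives the number and the sequence; given it, a coupling for the
  quotient is drawn and mapped by \<open>glue_map\<close>. The kernel is measurable since the drawn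
  coupling depends on \<open>u\<close> only through a natural number and the map is jointly
  measurable. The last conjunct allows the outer integral to be iterated later.\<close>

lemma glue_couplings:
  assumes n: "n \<ge> 2" and c: "\<And>k. 1 \<le> k \<Longrightarrow> k < n \<Longrightarrow> harm_coupling k (\<pi> k)"
  shows "\<exists>\<rho>. prob_space \<rho> \<and> sets \<rho> = sets sample_pair \<and> (\<forall>f\<in>borel_measurable sample_pair.
    (\<integral>\<^sup>+w. f w \<partial>\<rho>) =
      (\<integral>\<^sup>+u. \<integral>\<^sup>+w. f (glue_map n u w) \<partial>\<pi> (pair_quotient n u) \<partial>unif_pair) \<and>
    (\<lambda>u. \<integral>\<^sup>+w. f (glue_map n u w) \<partial>\<pi> (pair_quotient n u)) \<in> borel_measurable unif_pair)"
proof -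
  \<comment> \<open>Extension by \<open>\<pi> 1\<close> outside \<open>{1..<n}\<close> gives a
    probability measure at every index, as a kernel requires; quotients never leave that
    range.\<close>
  define \<pi>' where "\<pi>' k = (if 1 \<le> k \<and> k < n then \<pi> k else \<pi> 1)" for k
  have \<pi>': "\<pi>' k \<in> space (prob_algebra sample_pair)" for k
    using c[of k] c[of 1] n harm_couplingD(1,2) by (auto simp: \<pi>'_def space_prob_algebra)
  have \<pi>m: "(\<lambda>u. \<pi>' (pair_quotient n u)) \<in> unif_pair \<rightarrow>\<^sub>M prob_algebra sample_pair"
    by (rule measurable_compose[OF measurable_pair_quotient]) (use \<pi>' in auto)
  have T: "(\<lambda>(u, w). glue_map n u w) \<in> unif_pair \<Otimes>\<^sub>M sample_pair \<rightarrow>\<^sub>M sample_pair"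
    unfolding glue_map_def case_prod_beta
  proof (rule measurable_Pair)
    show "(\<lambda>p. pair_divisor n (fst p) * fst (snd p)) \<in> unif_pair \<Otimes>\<^sub>M sample_pair \<rightarrow>\<^sub>M count_space UNIV"
      by (rule measurable_count_space_pair[OF measurable_compose[OF measurable_fst measurable_pair_divisor] measurable_compose[OF measurable_snd measurable_fst]]) simp
    show "(\<lambda>p. insert_seq (pair_point (fst p)) (\<lambda>k. pair_rest (fst p) * snd (snd p) k)) \<in> unif_pair \<Otimes>\<^sub>M sample_pair \<rightarrow>\<^sub>M seq_borel"
    proof (rule measurable_seq_borelI)
      show "(\<lambda>p. insert_seq (pair_point (fst p)) (\<lambda>k. pair_rest (fst p) * snd (snd p) k)) \<in> unif_pair \<Otimes>\<^sub>M sample_pair \<rightarrow>\<^sub>M real_seq"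
        by (intro measurable_insert_seq measurable_scale_seq measurable_seq_borelD
            measurable_compose[OF measurable_fst measurable_pair_point] measurable_compose[OF measurable_fst measurable_pair_rest]
            measurable_compose[OF measurable_snd measurable_snd])
      fix p assume "p \<in> space (unif_pair \<Otimes>\<^sub>M sample_pair)"
      then have "fst p \<in> space unif_pair" "snd (snd p) \<in> seq_space"
        by (auto simp: space_pair_measure)
      then show "insert_seq (pair_point (fst p)) (\<lambda>k. pair_rest (fst p) * snd (snd p) k) \<in> seq_space"
        using pair_point_rest_bounds by (intro insert_seq_in_seq_space) auto
    qed
  qed
  define \<kappa> where "\<kappa> u = distr (\<pi>' (pair_quotient n u)) sample_pair (glue_map n u)" for u
  have \<kappa>: "\<kappa> \<in> unif_pair \<rightarrow>\<^sub>M prob_algebra sample_pair"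
    unfolding \<kappa>_def[abs_def] by (rule measurable_distr_prob_space2[OF \<pi>m T])
  then have \<kappa>': "\<kappa> \<in> unif_pair \<rightarrow>\<^sub>M subprob_algebra sample_pair"
    by (rule measurable_prob_algebraD)
  have up: "unif_pair \<in> space (prob_algebra unif_pair)"
    by (simp add: space_prob_algebra unif_pair.prob_space_axioms)
  define \<rho> where "\<rho> = unif_pair \<bind> \<kappa>"
  have inner: "(\<integral>\<^sup>+w. f w \<partial>\<kappa> u) = (\<integral>\<^sup>+w. f (glue_map n u w) \<partial>\<pi> (pair_quotient n u))"
    if f: "f \<in> borel_measurable sample_pair" and u: "u \<in> space unif_pair" for f u
  proof -
    have eq: "\<pi>' (pair_quotient n u) = \<pi> (pair_quotient n u)"
      using pair_bounds[OF n u] by (simp add: \<pi>'_def)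
    have "sets (\<pi>' (pair_quotient n u)) = sets sample_pair"
      using \<pi>' by (auto simp: space_prob_algebra)
    then have "glue_map n u \<in> \<pi>' (pair_quotient n u) \<rightarrow>\<^sub>M sample_pair"
      using measurable_compose[OF measurable_Pair1'[OF u] T] measurable_cong_sets by auto
    then show ?thesis
      unfolding \<kappa>_def using f by (subst nn_integral_distr) (auto simp: eq)
  qed
  show ?thesis
  proof (intro exI[of _ \<rho>] conjI ballI)
    show "prob_space \<rho>" unfolding \<rho>_def by (rule prob_space_bind'[OF up \<kappa>])
    show "sets \<rho> = sets sample_pair" unfolding \<rho>_def by (rule sets_bind'[OF up \<kappa>])
    fix f :: "nat \<times> (nat \<Rightarrow> real) \<Rightarrow> ennreal" assume f: "f \<in> borel_measurable sample_pair"
    have "(\<integral>\<^sup>+w. f w \<partial>\<rho>) = (\<integral>\<^sup>+u. \<integral>\<^sup>+w. f w \<partial>\<kappa> u \<partial>unif_pair)"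
      unfolding \<rho>_def by (rule nn_integral_bind[OF f \<kappa>'])
    also have "\<dots> = (\<integral>\<^sup>+u. \<integral>\<^sup>+w. f (glue_map n u w) \<partial>\<pi> (pair_quotient n u) \<partial>unif_pair)"
      by (rule nn_integral_cong) (rule inner[OF f])
    finally show "(\<integral>\<^sup>+w. f w \<partial>\<rho>) = (\<integral>\<^sup>+u. \<integral>\<^sup>+w. f (glue_map n u w) \<partial>\<pi> (pair_quotient n u) \<partial>unif_pair)"
      .
    have "(\<lambda>u. \<integral>\<^sup>+w. f w \<partial>\<kappa> u) \<in> borel_measurable unif_pair"
      by (rule measurable_compose[OF \<kappa>' nn_integral_measurable_subprob_algebra[OF f]])
    then show "(\<lambda>u. \<integral>\<^sup>+w. f (glue_map n u w) \<partial>\<pi> (pair_quotient n u)) \<in> borel_measurable unif_pair"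
      using inner[OF f] by (subst measurable_cong[symmetric]) auto
  qed
qed

lemma nn_integral_pair_quotient:
  assumes n: "n \<ge> 2"
  shows "(\<integral>\<^sup>+u. harm_expectation (pair_quotient n u) (\<lambda>m. \<phi> (pair_divisor n u * m)) \<partial>unif_pair) = harm_expectation n \<phi>"
    "(\<lambda>u. harm_expectation (pair_quotient n u) (\<lambda>m. \<phi> (pair_divisor n u * m))) \<in> borel_measurable unif_pair"
proof -
  show m: "(\<lambda>u. harm_expectation (pair_quotient n u) (\<lambda>m. \<phi> (pair_divisor n u * m))) \<in> borel_measurable unif_pair"
    by (rule measurable_count_space_pair[OF measurable_pair_quotient measurable_pair_divisor]) simp
  show "(\<integral>\<^sup>+u. harm_expectation (pair_quotient n u) (\<lambda>m. \<phi> (pair_divisor n u * m)) \<partial>unif_pair) = harm_expectation n \<phi>"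
    unfolding nn_integral_unif_pair[OF m]
    using harm_expectation_split[OF n, of \<phi>] by (simp add: pair_quotient_def pair_divisor_def pair_bound_def)
qed

lemma measurable_insert_seq_seq_borel:
  assumes "0 \<le> x" "0 \<le> y" "x + y \<le> 1"
  shows "(\<lambda>z. insert_seq x (\<lambda>k. y * z k)) \<in> seq_borel \<rightarrow>\<^sub>M seq_borel"
proof (rule measurable_seq_borelI)
  show "(\<lambda>z. insert_seq x (\<lambda>k. y * z k)) \<in> seq_borel \<rightarrow>\<^sub>M real_seq"
    by (intro measurable_insert_seq measurable_scale_seq measurable_seq_borel_id) auto
qed (use assms in \<open>auto intro: insert_seq_in_seq_space\<close>)

definition step_error :: "nat \<Rightarrow> real \<times> real \<Rightarrow> real" where
  "step_error n u = \<bar>ln (real (pair_divisor n u)) - ln (real n) * pair_point u\<bar> +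
     \<bar>ln (real (pair_quotient n u)) - ln (real n) * pair_rest u\<bar>"

lemma step_error_nonneg: "0 \<le> step_error n u"
  by (simp add: step_error_def)

lemma measurable_ln_nat: "f \<in> M \<rightarrow>\<^sub>M count_space UNIV \<Longrightarrow> (\<lambda>u. ln (real (f u :: nat))) \<in> borel_measurable M"
  by (rule measurable_compose[of f M "count_space UNIV"]) auto

lemma measurable_step_error: "step_error n \<in> borel_measurable unif_pair"
  unfolding step_error_def[abs_def]
  by (intro borel_measurable_add borel_measurable_abs borel_measurable_diff borel_measurable_times borel_measurable_const
      measurable_ln_nat measurable_pair_divisor measurable_pair_quotient measurable_pair_point measurable_pair_rest)

text \<open>The excess telescopes along the recursion, so that only the cost in excess of it, bounded by
  \<open>\<Psi>\<close>, has to be controlled.\<close>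

lemma glued_inner_cost:
  assumes n: "n \<ge> 2" and u: "u \<in> space unif_pair"
    and c: "harm_coupling (pair_quotient n u) \<pi>"
    and cost: "coupling_cost (pair_quotient n u) \<pi> \<le>
      ennreal (\<Psi> (pair_quotient n u)) + harm_expectation (pair_quotient n u) (\<lambda>h. ennreal (log_excess h))"
  shows "(\<integral>\<^sup>+w. l1_dist (log_primes (pair_divisor n u * fst w))
        (\<lambda>k. ln (real n) * insert_seq (pair_point u) (\<lambda>k. pair_rest u * snd w k) k) \<partial>\<pi>) \<le>
    ennreal (step_error n u) + ennreal (\<Psi> (pair_quotient n u)) +
    harm_expectation (pair_quotient n u) (\<lambda>m. ennreal (log_excess (pair_divisor n u * m)))"
proof -
  interpret prob_space \<pi> using harm_couplingD(1)[OF c] .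
  define L x y D k' where "L = ln (real n)" and "x = pair_point u" and "y = pair_rest u"
    and "D = pair_divisor n u" and "k' = pair_quotient n u"
  note defs = L_def x_def y_def D_def k'_def
  note c = c[folded k'_def]
  have L: "L \<ge> 0" using n by (simp add: L_def)
  have xy: "0 \<le> x" "0 \<le> y" "x + y \<le> 1" using pair_point_rest_bounds[OF u] by (auto simp: x_def y_def)
  have D: "D = 1 \<or> primepow D" "1 \<le> D" and k': "1 \<le> k'"
    using pair_bounds[OF n u] by (auto simp: D_def k'_def)
  define E where "E = harm_expectation k' (\<lambda>h. ennreal (log_excess h))"
  \<comment> \<open>The expected excess is added on both sides and cancelled at the end, which in
    \<open>ennreal\<close> requires it to be finite.\<close>
  have E_fin: "E \<noteq> \<top>"
    using harm_expectation_log_excess[of k'] k' unfolding E_def by (auto simp: top_unique)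
  note m = harm_couplingD(6,7)[OF c]
  have mh: "(\<lambda>w. \<phi> (fst w)) \<in> borel_measurable \<pi>" for \<phi> :: "nat \<Rightarrow> ennreal"
    by (rule measurable_compose[OF m(1)]) simp
  have mDh: "(\<lambda>w. D * fst w) \<in> \<pi> \<rightarrow>\<^sub>M count_space UNIV"
    by (rule measurable_compose[OF m(1)]) simp
  have m1: "(\<lambda>w. l1_dist (log_primes (D * fst w)) (\<lambda>k. L * insert_seq x (\<lambda>k. y * snd w k) k)) \<in> borel_measurable \<pi>"
    by (rule measurable_l1_dist_log_primes[OF mDh measurable_compose[OF m(2) measurable_insert_seq_seq_borel[OF xy]]])
  have m2: "(\<lambda>w. l1_dist (log_primes (fst w)) (\<lambda>k. ln (real k') * snd w k)) \<in> borel_measurable \<pi>"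
    by (rule measurable_l1_dist_log_primes[OF m])
  define J where "J = (\<integral>\<^sup>+w. l1_dist (log_primes (D * fst w)) (\<lambda>k. L * insert_seq x (\<lambda>k. y * snd w k) k) \<partial>\<pi>)"
  define R where "R = harm_expectation k' (\<lambda>m. ennreal (log_excess (D * m)))"
  have "J + E = (\<integral>\<^sup>+w. l1_dist (log_primes (D * fst w)) (\<lambda>k. L * insert_seq x (\<lambda>k. y * snd w k) k) + ennreal (log_excess (fst w)) \<partial>\<pi>)"
    unfolding J_def E_def harm_couplingD(4)[OF c, symmetric]
    by (rule nn_integral_add[symmetric, OF m1 mh])
  also have "\<dots> \<le> (\<integral>\<^sup>+w. (ennreal (step_error n u) + l1_dist (log_primes (fst w)) (\<lambda>k. ln (real k') * snd w k)) + ennreal (log_excess (D * fst w)) \<partial>\<pi>)"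
  proof (rule nn_integral_mono_AE)
    show "AE w in \<pi>. l1_dist (log_primes (D * fst w)) (\<lambda>k. L * insert_seq x (\<lambda>k. y * snd w k) k) + ennreal (log_excess (fst w)) \<le>
      (ennreal (step_error n u) + l1_dist (log_primes (fst w)) (\<lambda>k. ln (real k') * snd w k)) + ennreal (log_excess (D * fst w))"
      using harm_coupling_AE[OF c] AE_space
    proof eventually_elim
      fix w assume w1: "1 \<le> fst w \<and> fst w \<le> k'" and w2: "w \<in> space \<pi>"
      have z: "snd w \<in> seq_space"
        using w2 unfolding harm_couplingD(3)[OF c] by (simp add: mem_Times_iff)
      define z' where "z' = (\<lambda>k. (L * y) * snd w k)"
      have Ly: "0 \<le> L * y" using L xy by simp
      have z': "decseq z'" "\<And>k. 0 \<le> z' k"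
        using z Ly by (auto simp: z'_def seq_space_iff decseq_def mult_left_mono)
      have ins: "(\<lambda>k. L * insert_seq x (\<lambda>k. y * snd w k) k) = insert_seq (L * x) z'"
        using insert_seq_scale[OF L, of x "\<lambda>k. y * snd w k"] by (simp add: z'_def mult.assoc)
      \<comment> \<open>The coupling for the quotient works on the scale \<open>ln k'\<close>, while
        the step calls for \<open>L * y\<close>; the change of scale is the second part of
        \<open>step_error\<close>.\<close>
      have "l1_dist (log_primes (fst w)) z' \<le> l1_dist (log_primes (fst w)) (\<lambda>k. ln (real k') * snd w k) + ennreal \<bar>ln (real k') - L * y\<bar>"
        unfolding z'_def by (rule order.trans[OF l1_dist_triangle add_left_mono[OF l1_dist_scale_diff[OF z]]])
      note tri = this
      have "l1_dist (log_primes (D * fst w)) (insert_seq (L * x) z') + ennreal (log_excess (fst w))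
        \<le> ennreal \<bar>ln (real D) - L * x\<bar> + l1_dist (log_primes (fst w)) z' + ennreal (log_excess (D * fst w))"
        by (rule l1_dist_log_primes_mult[OF D(1) _ _ z']) (use w1 L xy in auto)
      also have "\<dots> \<le> ennreal \<bar>ln (real D) - L * x\<bar> + (l1_dist (log_primes (fst w)) (\<lambda>k. ln (real k') * snd w k) + ennreal \<bar>ln (real k') - L * y\<bar>) + ennreal (log_excess (D * fst w))"
        by (intro add_right_mono add_left_mono tri)
      also have "\<dots> = ((ennreal \<bar>ln (real D) - L * x\<bar> + ennreal \<bar>ln (real k') - L * y\<bar>) + l1_dist (log_primes (fst w)) (\<lambda>k. ln (real k') * snd w k)) + ennreal (log_excess (D * fst w))"
        by (simp only: add_ac)
      also have "ennreal \<bar>ln (real D) - L * x\<bar> + ennreal \<bar>ln (real k') - L * y\<bar> = ennreal (step_error n u)"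
        by (simp add: step_error_def defs ennreal_plus)
      finally show "l1_dist (log_primes (D * fst w)) (\<lambda>k. L * insert_seq x (\<lambda>k. y * snd w k) k) + ennreal (log_excess (fst w)) \<le>
        (ennreal (step_error n u) + l1_dist (log_primes (fst w)) (\<lambda>k. ln (real k') * snd w k)) + ennreal (log_excess (D * fst w))"
        unfolding ins .
    qed
  qed
  also have "\<dots> = (ennreal (step_error n u) + coupling_cost k' \<pi>) + R"
  proof -
    have "(\<integral>\<^sup>+w. (ennreal (step_error n u) + l1_dist (log_primes (fst w)) (\<lambda>k. ln (real k') * snd w k)) + ennreal (log_excess (D * fst w)) \<partial>\<pi>)
      = (\<integral>\<^sup>+w. ennreal (step_error n u) + l1_dist (log_primes (fst w)) (\<lambda>k. ln (real k') * snd w k) \<partial>\<pi>) + (\<integral>\<^sup>+w. ennreal (log_excess (D * fst w)) \<partial>\<pi>)"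
      by (intro nn_integral_add borel_measurable_add m2 mh[of "\<lambda>h. ennreal (log_excess (D * h))"]) simp
    also have "(\<integral>\<^sup>+w. ennreal (log_excess (D * fst w)) \<partial>\<pi>) = R"
      unfolding R_def by (rule harm_couplingD(4)[OF c])
    also have "(\<integral>\<^sup>+w. ennreal (step_error n u) + l1_dist (log_primes (fst w)) (\<lambda>k. ln (real k') * snd w k) \<partial>\<pi>) = ennreal (step_error n u) + coupling_cost k' \<pi>"
      unfolding coupling_cost_def using m2 by (subst nn_integral_add) (auto simp: emeasure_space_1)
    finally show ?thesis .
  qed
  also have "\<dots> \<le> (ennreal (step_error n u) + (ennreal (\<Psi> k') + E)) + R"
    using cost by (intro add_right_mono add_left_mono) (simp add: E_def k'_def)
  also have "\<dots> = (ennreal (step_error n u) + ennreal (\<Psi> k') + R) + E"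
    by (simp only: add_ac)
  finally have "J \<le> ennreal (step_error n u) + ennreal (\<Psi> k') + R"
    using E_fin by (simp only: add.commute[of _ E] ennreal_add_left_cancel_le) simp
  then show ?thesis by (simp only: J_def R_def defs)
qed

text \<open>The marginals are correct by the two exact recursions:
  \<open>harm_expectation_split\<close> for the number,
  \<open>nn_integral_attenuated_pd_insert\<close> for the sequence. In the cost, the excess of
  divisor times cofactor averages to the excess at \<open>n\<close>, so it does not accumulate over
  the steps.\<close>

lemma glued_coupling:
  assumes n: "n \<ge> 2" and c: "\<And>k. 1 \<le> k \<Longrightarrow> k < n \<Longrightarrow> harm_coupling k (\<pi> k)"
    and cost: "\<And>k. 1 \<le> k \<Longrightarrow> k < n \<Longrightarrow>
      coupling_cost k (\<pi> k) \<le> ennreal (\<Psi> k) + harm_expectation k (\<lambda>h. ennreal (log_excess h))"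
  obtains \<rho> where "harm_coupling n \<rho>"
    "coupling_cost n \<rho> \<le> (\<integral>\<^sup>+u. ennreal (step_error n u) + ennreal (\<Psi> (pair_quotient n u)) \<partial>unif_pair) +
      harm_expectation n (\<lambda>h. ennreal (log_excess h))"
proof -
  obtain \<rho> where \<rho>: "prob_space \<rho>" "sets \<rho> = sets sample_pair"
    "\<And>f. f \<in> borel_measurable sample_pair \<Longrightarrow> (\<integral>\<^sup>+w. f w \<partial>\<rho>) =
      (\<integral>\<^sup>+u. \<integral>\<^sup>+w. f (glue_map n u w) \<partial>\<pi> (pair_quotient n u) \<partial>unif_pair)"
    "\<And>f. f \<in> borel_measurable sample_pair \<Longrightarrow>
      (\<lambda>u. \<integral>\<^sup>+w. f (glue_map n u w) \<partial>\<pi> (pair_quotient n u)) \<in> borel_measurable unif_pair"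
    using glue_couplings[OF n c] by blast
  have cq: "harm_coupling (pair_quotient n u) (\<pi> (pair_quotient n u))" if "u \<in> space unif_pair" for u
    using pair_bounds[OF n that] by (intro c) auto
  have "harm_coupling n \<rho>"
    unfolding harm_coupling_def
  proof (intro conjI allI ballI \<rho>(1,2))
    fix \<phi> :: "nat \<Rightarrow> ennreal"
    have "(\<lambda>w. \<phi> (fst w)) \<in> borel_measurable sample_pair"
      by (rule measurable_compose[OF measurable_fst]) simp
    from \<rho>(3)[OF this] have "(\<integral>\<^sup>+w. \<phi> (fst w) \<partial>\<rho>) =
      (\<integral>\<^sup>+u. \<integral>\<^sup>+w. \<phi> (pair_divisor n u * fst w) \<partial>\<pi> (pair_quotient n u) \<partial>unif_pair)"
      by (simp add: glue_map_def)
    also have "\<dots> = (\<integral>\<^sup>+u. harm_expectation (pair_quotient n u) (\<lambda>m. \<phi> (pair_divisor n u * m)) \<partial>unif_pair)"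
      by (intro nn_integral_cong harm_couplingD(4)[OF cq])
    also have "\<dots> = harm_expectation n \<phi>"
      by (rule nn_integral_pair_quotient(1)[OF n])
    finally show "(\<integral>\<^sup>+w. \<phi> (fst w) \<partial>\<rho>) = harm_expectation n \<phi>" .
  next
    fix f :: "(nat \<Rightarrow> real) \<Rightarrow> ennreal" assume f: "f \<in> borel_measurable seq_borel"
    have mf: "(\<lambda>w. f (snd w)) \<in> borel_measurable sample_pair"
      by (rule measurable_compose[OF measurable_snd f])
    have inner: "(\<integral>\<^sup>+w. f (insert_seq (pair_point u) (\<lambda>k. pair_rest u * snd w k)) \<partial>\<pi> (pair_quotient n u)) =
      (\<integral>\<^sup>+z. f (insert_seq (pair_point u) (\<lambda>k. pair_rest u * z k)) \<partial>attenuated_pd)" if u: "u \<in> space unif_pair" for u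
      using pair_point_rest_bounds[OF u]
      by (intro harm_couplingD(5)[OF cq[OF u], of "\<lambda>z. f (insert_seq (pair_point u) (\<lambda>k. pair_rest u * z k))"]
          measurable_compose[OF measurable_insert_seq_seq_borel f])
    from \<rho>(3)[OF mf] have "(\<integral>\<^sup>+w. f (snd w) \<partial>\<rho>) =
      (\<integral>\<^sup>+u. \<integral>\<^sup>+w. f (insert_seq (pair_point u) (\<lambda>k. pair_rest u * snd w k)) \<partial>\<pi> (pair_quotient n u) \<partial>unif_pair)"
      by (simp add: glue_map_def)
    also have "\<dots> = (\<integral>\<^sup>+u. \<integral>\<^sup>+z. f (insert_seq (pair_point u) (\<lambda>k. pair_rest u * z k)) \<partial>attenuated_pd \<partial>unif_pair)"
      by (rule nn_integral_cong[OF inner])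
    also have "\<dots> = (\<integral>\<^sup>+u1. \<integral>\<^sup>+u2. \<integral>\<^sup>+z. f (insert_seq (pair_point (u1, u2)) (\<lambda>k. pair_rest (u1, u2) * z k)) \<partial>attenuated_pd \<partial>unif01 \<partial>unif01)"
    proof (rule nn_integral_unif_pair)
      show "(\<lambda>u. \<integral>\<^sup>+z. f (insert_seq (pair_point u) (\<lambda>k. pair_rest u * z k)) \<partial>attenuated_pd) \<in> borel_measurable unif_pair"
        using \<rho>(4)[OF mf] inner by (subst measurable_cong[symmetric]) (auto simp: glue_map_def)
    qed
    also have "\<dots> = (\<integral>\<^sup>+z. f z \<partial>attenuated_pd)"
      unfolding nn_integral_attenuated_pd_insert[OF f] by (simp add: pair_point_def pair_rest_def)
    finally show "(\<integral>\<^sup>+w. f (snd w) \<partial>\<rho>) = (\<integral>\<^sup>+z. f z \<partial>attenuated_pd)" .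
  qed
  moreover have "coupling_cost n \<rho> \<le> (\<integral>\<^sup>+u. ennreal (step_error n u) + ennreal (\<Psi> (pair_quotient n u)) \<partial>unif_pair) +
      harm_expectation n (\<lambda>h. ennreal (log_excess h))"
  proof -
    have mf: "(\<lambda>w. l1_dist (log_primes (fst w)) (\<lambda>k. ln (real n) * snd w k)) \<in> borel_measurable sample_pair"
      by (rule measurable_l1_dist_log_primes[OF measurable_fst measurable_snd])
    have "coupling_cost n \<rho> = (\<integral>\<^sup>+u. \<integral>\<^sup>+w. l1_dist (log_primes (pair_divisor n u * fst w))
        (\<lambda>k. ln (real n) * insert_seq (pair_point u) (\<lambda>k. pair_rest u * snd w k) k) \<partial>\<pi> (pair_quotient n u) \<partial>unif_pair)"
      unfolding coupling_cost_def \<rho>(3)[OF mf] by (simp add: glue_map_def)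
    also have "\<dots> \<le> (\<integral>\<^sup>+u. ennreal (step_error n u) + ennreal (\<Psi> (pair_quotient n u)) +
      harm_expectation (pair_quotient n u) (\<lambda>m. ennreal (log_excess (pair_divisor n u * m))) \<partial>unif_pair)"
      using pair_bounds[OF n] by (intro nn_integral_mono glued_inner_cost[OF n] cq cost) auto
    also have "\<dots> = (\<integral>\<^sup>+u. ennreal (step_error n u) + ennreal (\<Psi> (pair_quotient n u)) \<partial>unif_pair) +
       (\<integral>\<^sup>+u. harm_expectation (pair_quotient n u) (\<lambda>m. ennreal (log_excess (pair_divisor n u * m))) \<partial>unif_pair)"
      by (intro nn_integral_add borel_measurable_add nn_integral_pair_quotient(2)[OF n, of "\<lambda>m. ennreal (log_excess m)"]
          measurable_compose[OF measurable_step_error measurable_ennreal] measurable_compose[OF measurable_pair_quotient]) simp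
    finally show ?thesis
      unfolding nn_integral_pair_quotient(1)[OF n, where \<phi> = "\<lambda>m. ennreal (log_excess m)"] .
  qed
  ultimately show ?thesis by (rule that)
qed

section \<open>The mean error of a step and the resulting induction\<close>

text \<open>The error of the bound is shared between divisor and quotient in the proportions
  \<open>b\<close> and \<open>1 - b\<close>, so it counts once. The error of the divisor enters both
  terms and counts twice; integer division adds 1.\<close>

lemma step_error_le:
  assumes n: "n \<ge> 2" and u: "u \<in> space unif_pair"
  shows "step_error n u \<le> 1 +
    (2 * \<bar>ln (real (pair_divisor n u)) - ln (real (pair_bound n u)) * size_biased_part (snd u)\<bar> +
    \<bar>ln (real (pair_bound n u)) - ln (real n) * size_biased_bound (fst u)\<bar>)"
proof -
  define L y b K D k' where "L = ln (real n)" and "y = size_biased_bound (fst u)" and "b = size_biased_part (snd u)"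
    and "K = ln (real (pair_bound n u))" and "D = ln (real (pair_divisor n u))" and "k' = ln (real (pair_quotient n u))"
  note u' = u[unfolded space_unif_pair]
  have b: "0 < b" "b < 1" using size_biased_bounds(3,4)[of "snd u"] u' by (auto simp: b_def)
  note pb = pair_bounds[OF n u]
  have k': "\<bar>k' - (K - D)\<bar> \<le> 1"
    using ln_div_bounds[OF pb(3,4)] by (simp add: k'_def K_def D_def pair_quotient_def)
  have "D - L * (y * b) = (D - K * b) + (K - L * y) * b" by (simp add: algebra_simps)
  then have 1: "\<bar>D - L * (y * b)\<bar> \<le> \<bar>D - K * b\<bar> + \<bar>K - L * y\<bar> * b"
    using abs_triangle_ineq[of "D - K * b" "(K - L * y) * b"] b by (simp add: abs_mult)
  have eq: "k' - L * (y * (1 - b)) = (k' - (K - D)) + ((K * b - D) + (K - L * y) * (1 - b))" by (simp add: algebra_simps)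
  have "\<bar>(K * b - D) + (K - L * y) * (1 - b)\<bar> \<le> \<bar>K * b - D\<bar> + \<bar>(K - L * y) * (1 - b)\<bar>"
    by (rule abs_triangle_ineq)
  also have "\<dots> = \<bar>D - K * b\<bar> + \<bar>K - L * y\<bar> * (1 - b)"
    using b by (simp add: abs_mult abs_minus_commute)
  finally have 2: "\<bar>k' - L * (y * (1 - b))\<bar> \<le> 1 + (\<bar>D - K * b\<bar> + \<bar>K - L * y\<bar> * (1 - b))"
    unfolding eq by (intro order.trans[OF abs_triangle_ineq add_mono[OF k']])
  have 3: "\<bar>K - L * y\<bar> * b + \<bar>K - L * y\<bar> * (1 - b) = \<bar>K - L * y\<bar>" by (simp add: algebra_simps)
  have "A + B \<le> 1 + (2 * e + r)" if "A \<le> e + p" "B \<le> 1 + (e + q)" "p + q = r" for A B e p q r :: real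
    using that by linarith
  from this[OF 1 2 3]
  have "\<bar>D - L * (y * b)\<bar> + \<bar>k' - L * (y * (1 - b))\<bar> \<le> 1 + (2 * \<bar>D - K * b\<bar> + \<bar>K - L * y\<bar>)" .
  then show ?thesis
    by (simp only: step_error_def pair_point_def pair_rest_def L_def y_def b_def K_def D_def k'_def)
qed

lemma nn_integral_step_error:
  assumes n: "n \<ge> 2"
  shows "(\<integral>\<^sup>+u. ennreal (step_error n u) \<partial>unif_pair) \<le> ennreal 277"
proof -
  define f where "f u = \<bar>ln (real (pair_divisor n u)) - ln (real (pair_bound n u)) * size_biased_part (snd u)\<bar>" for u
  define g where "g u = \<bar>ln (real (pair_bound n u)) - ln (real n) * size_biased_bound (fst u)\<bar>" for u :: "real \<times> real"
  have f[measurable]: "f \<in> borel_measurable unif_pair"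
    unfolding f_def[abs_def]
    by (intro borel_measurable_abs borel_measurable_diff borel_measurable_times measurable_ln_nat
        measurable_pair_divisor measurable_pair_bound measurable_size_biased_pair)
  have g[measurable]: "g \<in> borel_measurable unif_pair"
    unfolding g_def[abs_def]
    by (intro borel_measurable_abs borel_measurable_diff borel_measurable_times borel_measurable_const measurable_ln_nat
        measurable_pair_bound measurable_size_biased_pair)
  have fi: "(\<integral>\<^sup>+u. ennreal (f u) \<partial>unif_pair) \<le> ennreal 128"
  proof -
    have "(\<integral>\<^sup>+u. ennreal (f u) \<partial>unif_pair) = (\<integral>\<^sup>+u1. \<integral>\<^sup>+u2. ennreal (f (u1, u2)) \<partial>unif01 \<partial>unif01)"
      by (intro nn_integral_unif_pair measurable_compose[OF f measurable_ennreal])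
    also have "\<dots> \<le> (\<integral>\<^sup>+u1. ennreal 128 \<partial>unif01)"
    proof (rule nn_integral_mono)
      fix u1 assume "u1 \<in> space unif01"
      then have "1 \<le> bound_sample n u1" using bound_sample_bounds[OF n] by simp
      from divisor_sample_cost[OF this]
      show "(\<integral>\<^sup>+u2. ennreal (f (u1, u2)) \<partial>unif01) \<le> ennreal 128"
        by (simp add: f_def pair_divisor_def pair_bound_def)
    qed
    also have "\<dots> = ennreal 128" using unif01.emeasure_space_1 by simp
    finally show ?thesis .
  qed
  have gi: "(\<integral>\<^sup>+u. ennreal (g u) \<partial>unif_pair) \<le> ennreal 20"
  proof -
    have "(\<integral>\<^sup>+u. ennreal (g u) \<partial>unif_pair) = (\<integral>\<^sup>+u1. \<integral>\<^sup>+u2. ennreal (g (u1, u2)) \<partial>unif01 \<partial>unif01)"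
      by (intro nn_integral_unif_pair measurable_compose[OF g measurable_ennreal])
    also have "\<dots> = (\<integral>\<^sup>+u1. ennreal \<bar>ln (real (bound_sample n u1)) - ln (real n) * size_biased_bound u1\<bar> \<partial>unif01)"
      using unif01.emeasure_space_1 by (simp add: g_def pair_bound_def)
    also have "\<dots> \<le> ennreal 20" by (rule bound_sample_cost[OF n])
    finally show ?thesis .
  qed
  have "(\<integral>\<^sup>+u. ennreal (step_error n u) \<partial>unif_pair) \<le> (\<integral>\<^sup>+u. 1 + (2 * ennreal (f u) + ennreal (g u)) \<partial>unif_pair)"
  proof (rule nn_integral_mono)
    fix u assume u: "u \<in> space unif_pair"
    have "ennreal (step_error n u) \<le> ennreal (1 + (2 * f u + g u))"
      using step_error_le[OF n u] unfolding f_def g_def by (rule ennreal_leI)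
    also have "\<dots> = 1 + (2 * ennreal (f u) + ennreal (g u))"
      by (simp add: f_def g_def ennreal_plus ennreal_mult)
    finally show "ennreal (step_error n u) \<le> 1 + (2 * ennreal (f u) + ennreal (g u))" .
  qed
  also have "\<dots> = 1 + (2 * (\<integral>\<^sup>+u. ennreal (f u) \<partial>unif_pair) + (\<integral>\<^sup>+u. ennreal (g u) \<partial>unif_pair))"
    using unif_pair.emeasure_space_1 by (simp add: nn_integral_add nn_integral_cmult)
  also have "\<dots> \<le> 1 + (2 * ennreal 128 + ennreal 20)"
    by (intro add_mono mult_left_mono fi gi) auto
  also have "\<dots> = ennreal 277"
    by (simp flip: ennreal_numeral ennreal_plus ennreal_mult ennreal_1)
  finally show ?thesis .
qed

lemma nn_integral_snd_unif_pair: "(\<integral>\<^sup>+u. ennreal (snd u) \<partial>unif_pair) = ennreal (1/2)"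
proof -
  have m: "(\<lambda>u. ennreal (snd u)) \<in> borel_measurable unif_pair"
    by (intro measurable_compose[OF measurable_snd] measurable_unif01I measurable_ennreal)
  have "(\<integral>\<^sup>+v. ennreal v \<partial>unif01) = ennreal (1\<^sup>2 / 2 - 0\<^sup>2 / 2)"
    unfolding nn_integral_unif01_closed
    by (intro nn_integral_FTC_Icc) (auto intro!: derivative_eq_intros)
  then show ?thesis
    unfolding nn_integral_unif_pair[OF m] using unif01.emeasure_space_1 by simp
qed

text \<open>On average the quotient has logarithm at most \<open>3/4 * ln n\<close> up to a constant, so for large \<open>n\<close> one
  step decreases \<open>ln (1 + ln n)\<close> by a constant, which pays for the step error.\<close>

definition cost_bound :: "nat \<Rightarrow> real" where
  "cost_bound k = 2216 * ln (1 + ln (real k)) + 4434"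

lemma cost_bound_nonneg: "k \<ge> 1 \<Longrightarrow> 0 \<le> cost_bound k"
  by (simp add: cost_bound_def)

lemma cost_bound_step:
  assumes L: "ln (real n) \<ge> 2217" and n: "n \<ge> 2"
  shows "(\<integral>\<^sup>+u. ennreal (step_error n u) + ennreal (cost_bound (pair_quotient n u)) \<partial>unif_pair) \<le> ennreal (cost_bound n)"
proof -
  define L where "L = ln (real n)"
  have L: "L \<ge> 2217" using assms by (simp add: L_def)
  \<comment> \<open>\<open>s\<close> collects the step error, once as a cost and once through its
    effect on \<open>ln k'\<close>; \<open>c * snd u\<close> is the gain from shrinking. With
    \<open>2216 = 8 * 277\<close>, the mean gain \<open>c / 2 = 554 * L / (1 + L)\<close> covers
    \<open>277 * s\<close> as soon as \<open>L >= 2217\<close>.\<close>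
  define c s where "c = 1108 * L / (1 + L)" and "s = 1 + 2216 / (1 + L)"
  have c: "0 \<le> c" and s: "0 \<le> s" using L by (auto simp: c_def s_def)
  define X where "X = (\<integral>\<^sup>+u. ennreal (step_error n u) + ennreal (cost_bound (pair_quotient n u)) \<partial>unif_pair)"
  have mse: "(\<lambda>u. ennreal (step_error n u)) \<in> borel_measurable unif_pair"
    by (rule measurable_compose[OF measurable_step_error measurable_ennreal])
  have mcb: "(\<lambda>u. ennreal (cost_bound (pair_quotient n u))) \<in> borel_measurable unif_pair"
    by (rule measurable_compose[OF measurable_pair_quotient]) simp
  have ms: "(\<lambda>u. ennreal (snd u)) \<in> borel_measurable unif_pair"
    by (intro measurable_compose[OF measurable_snd] measurable_unif01I measurable_ennreal)
  \<comment> \<open>To avoid subtraction in \<open>ennreal\<close>, the mean gain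
    \<open>c / 2\<close> is added on the left; it is cancelled at the end.\<close>
  have "X + ennreal c * ennreal (1/2) = (\<integral>\<^sup>+u. (ennreal (step_error n u) + ennreal (cost_bound (pair_quotient n u))) + ennreal c * ennreal (snd u) \<partial>unif_pair)"
    unfolding X_def nn_integral_snd_unif_pair[symmetric] nn_integral_cmult[OF ms, symmetric]
    by (rule nn_integral_add[symmetric]) (use mse mcb ms in measurable)
  also have "\<dots> \<le> (\<integral>\<^sup>+u. ennreal (cost_bound n) + ennreal s * ennreal (step_error n u) \<partial>unif_pair)"
  proof (rule nn_integral_mono)
    fix u assume u: "u \<in> space unif_pair"
    define k' where "k' = pair_quotient n u"
    define a where "a = step_error n u"
    have k': "1 \<le> k'" using pair_bounds[OF n u] by (simp add: k'_def)
    have a: "0 \<le> a" by (simp add: a_def step_error_nonneg)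
    have "ln (real k') \<le> L * pair_rest u + a"
      unfolding a_def step_error_def k'_def L_def by linarith
    also have "L * pair_rest u \<le> L * (1 - snd u / 2)"
      using L pair_point_rest_bounds(4)[OF u] by (intro mult_left_mono) auto
    finally have lnk: "ln (real k') - L \<le> a - L * snd u / 2" by (simp add: algebra_simps)
    have "0 \<le> ln (real k')" using k' by simp
    \<comment> \<open>Concavity: \<open>ln (1 + ln k')\<close> lies below the tangent of
      \<open>ln\<close> at \<open>1 + L\<close>, which makes the estimate linear in the step error
      and in \<open>snd u\<close>.\<close>
    then have "ln ((1 + ln (real k')) / (1 + L)) \<le> (1 + ln (real k')) / (1 + L) - 1"
      using L by (intro ln_le_minus_one) auto
    also have "\<dots> = (ln (real k') - L) / (1 + L)" using L by (simp add: field_simps)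
    also have "\<dots> \<le> (a - L * snd u / 2) / (1 + L)" using lnk L by (intro divide_right_mono) auto
    finally have "ln (1 + ln (real k')) \<le> ln (1 + L) + (a - L * snd u / 2) / (1 + L)"
      using L \<open>0 \<le> ln (real k')\<close> by (simp add: ln_div)
    then have "2216 * ln (1 + ln (real k')) \<le> 2216 * ln (1 + L) + 2216 * ((a - L * snd u / 2) / (1 + L))"
      by linarith
    moreover have "2216 * ((a - L * snd u / 2) / (1 + L)) = 2216 / (1 + L) * a - c * snd u"
    proof -
      have "2216 * ((a - L * snd u / 2) / (1 + L)) = (2216 * a - 1108 * (L * snd u)) / (1 + L)"
        by simp
      also have "\<dots> = 2216 * a / (1 + L) - 1108 * (L * snd u) / (1 + L)"
        by (rule diff_divide_distrib)
      also have "\<dots> = 2216 / (1 + L) * a - c * snd u"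
        by (simp add: c_def)
      finally show ?thesis .
    qed
    moreover have "s * a = a + 2216 / (1 + L) * a"
      by (simp add: s_def distrib_right)
    ultimately have "a + cost_bound k' + c * snd u \<le> cost_bound n + s * a"
      unfolding cost_bound_def L_def[symmetric] by linarith
    then have "ennreal (a + cost_bound k' + c * snd u) \<le> ennreal (cost_bound n + s * a)"
      by (rule ennreal_leI)
    moreover have "0 \<le> snd u" using u unfolding space_unif_pair by simp
    ultimately show "(ennreal (step_error n u) + ennreal (cost_bound (pair_quotient n u))) + ennreal c * ennreal (snd u) \<le> ennreal (cost_bound n) + ennreal s * ennreal (step_error n u)"
      using a c s cost_bound_nonneg[OF k'] cost_bound_nonneg[of n] n
      by (simp add: ennreal_plus ennreal_mult flip: a_def k'_def)
  qed
  also have "\<dots> = ennreal (cost_bound n) + ennreal s * (\<integral>\<^sup>+u. ennreal (step_error n u) \<partial>unif_pair)"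
  proof -
    have "(\<integral>\<^sup>+u. ennreal (cost_bound n) + ennreal s * ennreal (step_error n u) \<partial>unif_pair) =
      (\<integral>\<^sup>+u. ennreal (cost_bound n) \<partial>unif_pair) + (\<integral>\<^sup>+u. ennreal s * ennreal (step_error n u) \<partial>unif_pair)"
      by (rule nn_integral_add) (use mse in measurable)
    then show ?thesis
      unfolding nn_integral_cmult[OF mse] using unif_pair.emeasure_space_1 by simp
  qed
  also have "\<dots> \<le> ennreal (cost_bound n) + ennreal s * ennreal 277"
    by (intro add_left_mono mult_left_mono nn_integral_step_error[OF n]) simp
  also have "\<dots> \<le> ennreal (cost_bound n) + ennreal c * ennreal (1/2)"
  proof -
    have "s * 277 = (2217 + L) * 277 / (1 + L)"
      using L by (simp add: s_def field_simps)
    also have "\<dots> \<le> 554 * L / (1 + L)"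
      using L by (intro divide_right_mono) auto
    also have "554 * L = 1108 * L * (1/2)" by simp
    also have "1108 * L * (1/2) / (1 + L) = c * (1/2)"
      unfolding c_def by (rule times_divide_eq_left [symmetric])
    finally have "s * 277 \<le> c * (1/2)" .
    then have "ennreal (s * 277) \<le> ennreal (c * (1/2))" by (rule ennreal_leI)
    moreover have "ennreal (s * 277) = ennreal s * ennreal 277"
      by (rule ennreal_mult[OF s]) simp
    moreover have "ennreal (c * (1/2)) = ennreal c * ennreal (1/2)"
      by (rule ennreal_mult[OF c]) simp
    ultimately show ?thesis
      by (intro add_left_mono) (simp only:)
  qed
  finally have "X \<le> ennreal (cost_bound n)"
    using c by (simp only: add.commute[of _ "ennreal c * ennreal (1/2)"] ennreal_add_left_cancel_le) (auto simp: ennreal_mult_eq_top_iff)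
  then show ?thesis by (simp only: X_def)
qed

lemma coupling_with_cost_bound:
  assumes "n \<ge> 1"
  shows "\<exists>\<pi>. harm_coupling n \<pi> \<and> coupling_cost n \<pi> \<le> ennreal (cost_bound n) + harm_expectation n (\<lambda>h. ennreal (log_excess h))"
  using assms
proof (induction n rule: less_induct)
  case (less n)
  show ?case
  proof (cases "ln (real n) \<ge> 2217")
    \<comment> \<open>Below the threshold any coupling does; this is where the constant term
      \<open>4434 = 2 * 2217\<close> of \<open>cost_bound\<close> comes from.\<close>
    case False
    obtain \<pi> where \<pi>: "harm_coupling n \<pi>" using harm_coupling_exists[of n] less.prems by auto
    have "coupling_cost n \<pi> \<le> ennreal (2 * ln (real n))"
      using less.prems by (intro coupling_cost_trivial[OF \<pi>]) simp
    also have "\<dots> \<le> ennreal (cost_bound n)"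
    proof (rule ennreal_leI)
      have "0 \<le> ln (1 + ln (real n))" using less.prems by simp
      then show "2 * ln (real n) \<le> cost_bound n" using False by (simp add: cost_bound_def)
    qed
    also have "\<dots> \<le> ennreal (cost_bound n) + harm_expectation n (\<lambda>h. ennreal (log_excess h))"
      by simp
    finally show ?thesis using \<pi> by blast
  next
    case True
    have n: "n \<ge> 2"
    proof (rule ccontr)
      assume "\<not> n \<ge> 2"
      then have "n = 1" using less.prems by simp
      then show False using True by simp
    qed
    have "\<forall>k. \<exists>\<pi>. 1 \<le> k \<and> k < n \<longrightarrow> harm_coupling k \<pi> \<and>
      coupling_cost k \<pi> \<le> ennreal (cost_bound k) + harm_expectation k (\<lambda>h. ennreal (log_excess h))"
      using less.IH by blast
    then obtain \<pi> where \<pi>: "\<And>k. 1 \<le> k \<Longrightarrow> k < n \<Longrightarrow> harm_coupling k (\<pi> k)"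
      "\<And>k. 1 \<le> k \<Longrightarrow> k < n \<Longrightarrow> coupling_cost k (\<pi> k) \<le> ennreal (cost_bound k) + harm_expectation k (\<lambda>h. ennreal (log_excess h))"
      by metis
    obtain \<rho> where \<rho>: "harm_coupling n \<rho>"
      "coupling_cost n \<rho> \<le> (\<integral>\<^sup>+u. ennreal (step_error n u) + ennreal (cost_bound (pair_quotient n u)) \<partial>unif_pair) +
        harm_expectation n (\<lambda>h. ennreal (log_excess h))"
      using glued_coupling[OF n \<pi>] by blast
    have "coupling_cost n \<rho> \<le> ennreal (cost_bound n) + harm_expectation n (\<lambda>h. ennreal (log_excess h))"
      using \<rho>(2) cost_bound_step[OF True n] by (meson add_right_mono order.trans)
    then show ?thesis using \<rho>(1) by blast
  qed
qed

section \<open>The rate of convergence\<close>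

lemma scaled_log_primes_in_seq_space:
  assumes "n \<ge> 2" "1 \<le> h" "h \<le> n"
  shows "(\<lambda>k. log_primes h k / ln (real n)) \<in> seq_space"
proof -
  define L where "L = ln (real n)"
  have L: "L > 0" using assms by (simp add: L_def)
  have h: "h > 0" using assms by simp
  have "(\<Sum>k. ennreal (log_primes h k / L)) = (\<Sum>k. ennreal (1 / L) * ennreal (log_primes h k))"
    using L log_primes_nonneg[OF h] by (intro suminf_cong) (simp flip: ennreal_mult)
  also have "\<dots> = ennreal (1 / L) * ennreal (log_radical h)"
    by (simp only: ennreal_suminf_cmult suminf_log_primes[OF h])
  also have "\<dots> = ennreal (1 / L * log_radical h)"
    using L by (intro ennreal_mult[symmetric] log_radical_nonneg) simp
  also have "\<dots> \<le> 1"
  proof -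
    have "log_radical h \<le> ln (real h)" by (rule log_radical_le[OF h])
    also have "\<dots> \<le> L" using assms by (simp add: L_def)
    finally have "1 / L * log_radical h \<le> 1" using L by simp
    then show ?thesis by (simp only: ennreal_le_1)
  qed
  finally show ?thesis
    unfolding seq_space_iff L_def[symmetric] using L log_primes_nonneg[OF h] decseq_log_primes[OF h]
    by (intro conjI allI) (simp_all add: decseq_def divide_right_mono)
qed

lemma wasserstein_le_coupling_cost:
  assumes n: "n \<ge> 2" and c: "harm_coupling n \<pi>"
  shows "wasserstein (prime_div_law n) (attenuation poisson_dirichlet) \<le> ennreal (1 / ln (real n)) * coupling_cost n \<pi>"
proof -
  define L where "L = ln (real n)"
  have L: "L > 0" using n by (simp add: L_def)
  interpret prob_space \<pi> using harm_couplingD(1)[OF c] .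
  \<comment> \<open>A coupling lives on all naturals, but the scaled prime sequence of a number
    above \<open>n\<close> may have mass above 1. Such numbers have probability 0 and are sent to
    the zero sequence, so that \<open>r\<close> maps into \<open>seq_space\<close>.\<close>
  define r where "r h = (if 1 \<le> h \<and> h \<le> n then (\<lambda>k. log_primes h k / L) else (\<lambda>_. 0))" for h
  have zero: "(\<lambda>_. 0) \<in> seq_space" by (simp add: seq_space_iff decseq_def)
  have r: "r h \<in> seq_space" for h
    using scaled_log_primes_in_seq_space[OF n, of h] zero by (simp add: r_def L_def)
  note m = harm_couplingD(6,7)[OF c]
  have mr: "(\<lambda>w. r (fst w)) \<in> \<pi> \<rightarrow>\<^sub>M seq_borel"
    by (rule measurable_compose[OF m(1)]) (use r in auto)
  have mp: "(\<lambda>w. (r (fst w), snd w)) \<in> \<pi> \<rightarrow>\<^sub>M seq_borel \<Otimes>\<^sub>M seq_borel"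
    by (rule measurable_Pair[OF mr m(2)])
  define \<rho> where "\<rho> = distr \<pi> (seq_borel \<Otimes>\<^sub>M seq_borel) (\<lambda>w. (r (fst w), snd w))"
  have "\<rho> \<in> couplings (prime_div_law n) (attenuation poisson_dirichlet)"
    unfolding couplings_def mem_Collect_eq
  proof (intro conjI)
    show "prob_space \<rho>" unfolding \<rho>_def by (rule prob_space_distr[OF mp])
    show "sets \<rho> = sets (seq_borel \<Otimes>\<^sub>M seq_borel)" by (simp add: \<rho>_def)
    have d1: "distr \<rho> seq_borel fst = distr \<pi> seq_borel (\<lambda>w. r (fst w))"
      unfolding \<rho>_def by (subst distr_distr[OF measurable_fst mp]) (simp add: comp_def)
    have d2: "distr \<rho> seq_borel snd = distr \<pi> seq_borel snd"
      unfolding \<rho>_def by (subst distr_distr[OF measurable_snd mp]) (simp add: comp_def)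
    have ml: "(\<lambda>h k. log_primes h k / L) \<in> harmonic_sample n \<rightarrow>\<^sub>M seq_borel"
      using scaled_log_primes_in_seq_space[OF n] by (auto simp: harmonic_sample_def measurable_point_measure_eq1 L_def)
    have law: "prime_div_law n = distr (harmonic_sample n) seq_borel (\<lambda>h k. log_primes h k / L)"
      by (simp add: prime_div_law_def log_primes_def L_def)
    show "distr \<rho> seq_borel fst = prime_div_law n"
      unfolding d1 law
    proof (rule measure_eqI)
      fix A assume "A \<in> sets (distr \<pi> seq_borel (\<lambda>w. r (fst w)))"
      then have A: "A \<in> sets seq_borel" by simp
      have "emeasure (distr \<pi> seq_borel (\<lambda>w. r (fst w))) A = (\<integral>\<^sup>+x. indicator A x \<partial>distr \<pi> seq_borel (\<lambda>w. r (fst w)))"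
        using A by simp
      also have "\<dots> = (\<integral>\<^sup>+w. indicator A (r (fst w)) \<partial>\<pi>)"
        using A by (intro nn_integral_distr[OF mr]) simp
      also have "\<dots> = harm_expectation n (\<lambda>h. indicator A (r h))"
        by (rule harm_couplingD(4)[OF c])
      also have "\<dots> = harm_expectation n (\<lambda>h. indicator A (\<lambda>k. log_primes h k / L))"
        by (rule harm_expectation_cong) (simp add: r_def)
      also have "\<dots> = (\<integral>\<^sup>+h. indicator A (\<lambda>k. log_primes h k / L) \<partial>harmonic_sample n)"
        by (rule nn_integral_harmonic_sample[symmetric])
      also have "\<dots> = (\<integral>\<^sup>+x. indicator A x \<partial>distr (harmonic_sample n) seq_borel (\<lambda>h k. log_primes h k / L))"
        using A by (intro nn_integral_distr[OF ml, symmetric]) simp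
      also have "\<dots> = emeasure (distr (harmonic_sample n) seq_borel (\<lambda>h k. log_primes h k / L)) A"
        using A by simp
      finally show "emeasure (distr \<pi> seq_borel (\<lambda>w. r (fst w))) A =
         emeasure (distr (harmonic_sample n) seq_borel (\<lambda>h k. log_primes h k / L)) A" .
    qed simp
    show "distr \<rho> seq_borel snd = attenuation poisson_dirichlet"
      unfolding d2 attenuated_pd_def[symmetric]
    proof (rule measure_eqI)
      fix A assume "A \<in> sets (distr \<pi> seq_borel snd)"
      then have A: "A \<in> sets seq_borel" by simp
      have "emeasure (distr \<pi> seq_borel snd) A = (\<integral>\<^sup>+x. indicator A x \<partial>distr \<pi> seq_borel snd)"
        using A by simp
      also have "\<dots> = (\<integral>\<^sup>+w. indicator A (snd w) \<partial>\<pi>)"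
        using A by (intro nn_integral_distr[OF m(2)]) simp
      also have "\<dots> = (\<integral>\<^sup>+z. indicator A z \<partial>attenuated_pd)"
        using A by (intro harm_couplingD(5)[OF c]) simp
      also have "\<dots> = emeasure attenuated_pd A"
        using A by simp
      finally show "emeasure (distr \<pi> seq_borel snd) A = emeasure attenuated_pd A" .
    qed simp
  qed
  then have "wasserstein (prime_div_law n) (attenuation poisson_dirichlet) \<le> (\<integral>\<^sup>+z. ennreal (seq_dist (fst z) (snd z)) \<partial>\<rho>)"
    unfolding wasserstein_def by (rule INF_lower)
  also have "\<dots> = (\<integral>\<^sup>+z. l1_dist (fst z) (snd z) \<partial>\<rho>)"
    by (intro nn_integral_cong) (auto simp: \<rho>_def space_pair_measure l1_dist_eq_seq_dist)
  also have "\<dots> = (\<integral>\<^sup>+w. l1_dist (r (fst w)) (snd w) \<partial>\<pi>)"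
  proof -
    have "(\<lambda>z. l1_dist (fst z) (snd z)) \<in> borel_measurable (seq_borel \<Otimes>\<^sub>M seq_borel)"
      by (intro measurable_l1_dist measurable_seq_borelD measurable_fst measurable_snd)
    then show ?thesis
      unfolding \<rho>_def by (subst nn_integral_distr[OF mp]) auto
  qed
  also have "\<dots> = (\<integral>\<^sup>+w. ennreal (1 / L) * l1_dist (log_primes (fst w)) (\<lambda>k. L * snd w k) \<partial>\<pi>)"
  proof (rule nn_integral_cong_AE)
    show "AE w in \<pi>. l1_dist (r (fst w)) (snd w) = ennreal (1 / L) * l1_dist (log_primes (fst w)) (\<lambda>k. L * snd w k)"
      using harm_coupling_AE[OF c]
    proof eventually_elim
      fix w :: "nat \<times> (nat \<Rightarrow> real)" assume w: "1 \<le> fst w \<and> fst w \<le> n"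
      have "ennreal (1 / L) * l1_dist (log_primes (fst w)) (\<lambda>k. L * snd w k) =
        l1_dist (\<lambda>k. 1 / L * log_primes (fst w) k) (\<lambda>k. 1 / L * (L * snd w k))"
        using L by (intro l1_dist_scale[symmetric]) simp
      then show "l1_dist (r (fst w)) (snd w) = ennreal (1 / L) * l1_dist (log_primes (fst w)) (\<lambda>k. L * snd w k)"
        using w L by (simp add: r_def)
    qed
  qed
  also have "\<dots> = ennreal (1 / L) * coupling_cost n \<pi>"
    unfolding coupling_cost_def L_def
    by (rule nn_integral_cmult) (rule measurable_l1_dist_log_primes[OF m])
  finally show ?thesis by (simp only: L_def)
qed

theorem theorem2p1:
  "\<exists>(C::real) (N::nat). C > 0 \<and>
     (\<forall>n\<ge>N. wasserstein (prime_div_law n) (attenuation poisson_dirichlet)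
        \<le> ennreal (C / ln (real n) * ln (ln (real n)) powr (exp 1 - 3 / 2)))"
proof (intro exI[of _ "8866 + excess_bound"] exI[of _ "nat \<lceil>exp (exp (1::real))\<rceil>"] conjI allI impI)
  \<comment> \<open>The threshold for \<open>n\<close> ensures \<open>ln (ln n) >= 1\<close>, so
    constants are absorbed by \<open>ln (ln n)\<close>. As \<open>ln (1 + L) <= 2 * ln L\<close>,
    the factor is \<open>2 * 2216 + 4434 = 8866\<close>, plus the bound for the excess.\<close>
  show "0 < 8866 + excess_bound" using excess_bound_nonneg by simp
  fix n :: nat assume n: "nat \<lceil>exp (exp (1::real))\<rceil> \<le> n"
  define L where "L = ln (real n)"
  have e2: "2 \<le> exp (1::real)" using exp_ge_add_one_self[of 1] by simp
  have "exp (exp 1) \<le> real n" using n by linarith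
  moreover have "0 < exp (exp (1::real))" by simp
  ultimately have n0: "0 < real n" by linarith
  have eL: "exp 1 \<le> L"
    using \<open>exp (exp 1) \<le> real n\<close> ln_ge_iff[OF n0] by (simp add: L_def)
  have L2: "2 \<le> L" using eL e2 by simp
  have n2: "n \<ge> 2"
  proof (rule ccontr)
    assume "\<not> n \<ge> 2"
    then have "n = 1" using n0 by auto
    then show False using L2 by (simp add: L_def)
  qed
  have lnL: "1 \<le> ln L" using eL L2 by (simp add: ln_ge_iff)
  obtain \<pi> where \<pi>: "harm_coupling n \<pi>"
    "coupling_cost n \<pi> \<le> ennreal (cost_bound n) + harm_expectation n (\<lambda>h. ennreal (log_excess h))"
    using coupling_with_cost_bound[of n] n2 by auto
  have "coupling_cost n \<pi> \<le> ennreal (cost_bound n) + ennreal excess_bound"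
    using \<pi>(2) harm_expectation_log_excess[of n] n2 by (meson add_left_mono order.trans zero_less_numeral less_le_trans)
  also have "\<dots> = ennreal (cost_bound n + excess_bound)"
    using n2 by (simp add: ennreal_plus cost_bound_nonneg excess_bound_nonneg)
  finally have cost: "coupling_cost n \<pi> \<le> ennreal (cost_bound n + excess_bound)" .
  have "ln (1 + L) \<le> ln (L\<^sup>2)"
  proof -
    have "2 * L \<le> L * L" using L2 by (intro mult_right_mono) auto
    then have "1 + L \<le> L\<^sup>2" using L2 unfolding power2_eq_square by linarith
    then show ?thesis using L2 by simp
  qed
  also have "\<dots> = 2 * ln L" using L2 by (simp add: ln_realpow)
  finally have "cost_bound n + excess_bound \<le> 4432 * ln L + (4434 + excess_bound) * 1"
    by (simp add: cost_bound_def L_def)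
  also have "\<dots> \<le> 4432 * ln L + (4434 + excess_bound) * ln L"
    using lnL excess_bound_nonneg by (intro add_left_mono mult_left_mono) auto
  also have "\<dots> = (8866 + excess_bound) * ln L" by (simp add: algebra_simps)
  also have "\<dots> \<le> (8866 + excess_bound) * ln L powr (exp 1 - 3 / 2)"
  proof (rule mult_left_mono)
    \<comment> \<open>The Taylor polynomial gives \<open>exp 1 >= 1 + 1 + 1/2\<close>, so the
      exponent is at least 1; with \<open>ln L >= 1\<close> the power dominates \<open>ln L\<close>
      itself.\<close>
    have "5 / 2 \<le> exp (1::real)" using exp_lower_Taylor_quadratic[of "1::real"] by simp
    then have "ln L powr 1 \<le> ln L powr (exp 1 - 3 / 2)" using lnL by (intro powr_mono) auto
    then show "ln L \<le> ln L powr (exp 1 - 3 / 2)" using lnL by simp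
  qed (use excess_bound_nonneg in simp)
  finally have bound: "cost_bound n + excess_bound \<le> (8866 + excess_bound) * ln L powr (exp 1 - 3 / 2)" .
  have "wasserstein (prime_div_law n) (attenuation poisson_dirichlet) \<le> ennreal (1 / L) * coupling_cost n \<pi>"
    unfolding L_def by (rule wasserstein_le_coupling_cost[OF n2 \<pi>(1)])
  also have "\<dots> \<le> ennreal (1 / L) * ennreal ((8866 + excess_bound) * ln L powr (exp 1 - 3 / 2))"
    by (intro mult_left_mono order.trans[OF cost] ennreal_leI bound) simp
  also have "\<dots> = ennreal (1 / L * ((8866 + excess_bound) * ln L powr (exp 1 - 3 / 2)))"
    using L2 excess_bound_nonneg by (intro ennreal_mult[symmetric] mult_nonneg_nonneg) auto
  also have "1 / L * ((8866 + excess_bound) * ln L powr (exp 1 - 3 / 2)) =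
      (8866 + excess_bound) / ln (real n) * ln (ln (real n)) powr (exp 1 - 3 / 2)"
    by (simp add: L_def)
  finally show "wasserstein (prime_div_law n) (attenuation poisson_dirichlet)
      \<le> ennreal ((8866 + excess_bound) / ln (real n) * ln (ln (real n)) powr (exp 1 - 3 / 2))" .
qed

end
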